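(* Let $a$ be a positive integer with $a\equiv 3\pmod 6$ and $a<100$. Let $m$ be a nonnegative integer such that $m$ is odd if $a\equiv 3\pmod{12}$ and $m$ is even if $a\equiv 9\pmod{12}$. Then there exists a $\mathrm{TOC}_3(3^m a,5,3)$ if $a\notin\{57,87,93\}$, and there exists a $\mathrm{TOC}_3(3^m a+1,5,3)$ if $a\notin\{51,69,75\}$.
   Context: $\mathcal{H}_q(n,w)$ is the set of all words of length $n$ over $\mathbb{Z}_q$ with exactly $w$ nonzero entries, with the Hamming distance. An $(n,d,w)_q$-code is a nonempty subset of $\mathcal{H}_q(n,w)$ in which any two distinct words have Hamming distance at least $d$; $A_q(n,d,w)$ is the maximum size of such a code and a code of this size is optimal. A $\mathrm{TOC}_q(n,d,w)$ is a partition of $\mathcal{H}_q(n,w)$ into mutually disjoint optimal $(n,d,w)_q$-codes. *)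

theory Defs
  imports Main
begin

definition words :: "nat \<Rightarrow> nat \<Rightarrow> (nat \<Rightarrow> nat) set" where
  "words q n = {x. (\<forall>i<n. x i < q) \<and> (\<forall>i\<ge>n. x i = 0)}"

definition hamming_dist :: "nat \<Rightarrow> (nat \<Rightarrow> nat) \<Rightarrow> (nat \<Rightarrow> nat) \<Rightarrow> nat" where
  "hamming_dist n x y = card {i. i < n \<and> x i \<noteq> y i}"

definition weight :: "nat \<Rightarrow> (nat \<Rightarrow> nat) \<Rightarrow> nat" where
  "weight n x = card {i. i < n \<and> x i \<noteq> 0}"

definition H :: "nat \<Rightarrow> nat \<Rightarrow> nat \<Rightarrow> (nat \<Rightarrow> nat) set" where
  "H q n w = {x \<in> words q n. weight n x = w}"

definition is_code :: "nat \<Rightarrow> nat \<Rightarrow> nat \<Rightarrow> nat \<Rightarrow> (nat \<Rightarrow> nat) set \<Rightarrow> bool" where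
  "is_code q n d w C \<longleftrightarrow> C \<noteq> {} \<and> C \<subseteq> H q n w \<and>
     (\<forall>x\<in>C. \<forall>y\<in>C. x \<noteq> y \<longrightarrow> hamming_dist n x y \<ge> d)"

definition A :: "nat \<Rightarrow> nat \<Rightarrow> nat \<Rightarrow> nat \<Rightarrow> nat" where
  "A q n d w = Max {card C | C. is_code q n d w C}"

definition optimal_code :: "nat \<Rightarrow> nat \<Rightarrow> nat \<Rightarrow> nat \<Rightarrow> (nat \<Rightarrow> nat) set \<Rightarrow> bool" where
  "optimal_code q n d w C \<longleftrightarrow> is_code q n d w C \<and> card C = A q n d w"

definition is_TOC :: "nat \<Rightarrow> nat \<Rightarrow> nat \<Rightarrow> nat \<Rightarrow> (nat \<Rightarrow> nat) set set \<Rightarrow> bool" where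
  "is_TOC q n d w P \<longleftrightarrow> \<Union>P = H q n w \<and>
     (\<forall>C\<in>P. optimal_code q n d w C) \<and>
     (\<forall>C\<in>P. \<forall>D\<in>P. C \<noteq> D \<longrightarrow> C \<inter> D = {})"

definition TOC_exists :: "nat \<Rightarrow> nat \<Rightarrow> nat \<Rightarrow> nat \<Rightarrow> bool" where
  "TOC_exists q n d w \<longleftrightarrow> (\<exists>P. is_TOC q n d w P)"

end

theory Submission
  imports Defs "HOL-Library.Disjoint_Sets" "HOL-Library.Multiset"
begin

text \<open>A ternary word of weight three is a triple of positions with signs. Suppose the triples of an
  \<open>N\<close>-set are partitioned into classes, each covering all points (all but one if \<open>N mod 3 = 1\<close>), and the
  classes are arranged in cycles such that blocks of consecutive classes meet in at most one point. The
  blocks of two consecutive classes form a bipartite graph with the points as edges; by Koenig's theorem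
  its edges have a proper 3-colouring. Signing the blocks of the first class by an even-weight pattern on
  the three colours, and those of the second by its complement, gives an optimal code, since blocks meeting
  in a point have different signs there. All words arise, because the parity of a signed triple does
  not depend on the colouring.

  Such cyclically linked partitions exist for \<open>3 n\<close> points whenever they exist for an odd
  multiple \<open>n\<close> of three, and for \<open>9 W + 1\<close> points whenever they exist for
  \<open>W + 1\<close>, \<open>W mod 6 = 3\<close>, \<open>W \<ge> 9\<close>. The starting orders are given by base classes
  developed under an affine group, one or two points being fixed.\<close>

section \<open>Linked parallel classes\<close>

text \<open>Each class is used twice: its blocks carry the even sign patterns in the code shared
  with its successor and the odd ones in the code shared with its predecessor. A class cannot be its
  own successor, so a partition of the triples into parallel classes is not enough. Every
  construction has to provide successors, and families without cycles of their own are inserted into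
  cycles already built. On the other hand blocks need only be shown to cover the triples: the number
  of classes is exact, so nothing can occur twice. The condition on \<open>m\<close> makes W = 3^m a
  congruent to 9 modulo 12. Removing factors 9 from W leads to starting orders W + 1 = 2 p with p
  congruent to 5 modulo 6, realised on two copies of Z_p. With multipliers of odd order prime to
  three no triple there has a symmetry, so all classes come in full orbits. The orders q + 2,
  realised on Z_q with two fixed points, do have symmetric triples, and these need one invariant
  class of their own.\<close>

definition triples :: "'a set \<Rightarrow> 'a set set" where
  "triples X = {B. B \<subseteq> X \<and> card B = 3}"

definition pclass :: "'a set \<Rightarrow> 'a set set \<Rightarrow> bool" where
  "pclass X P \<longleftrightarrow> P \<subseteq> triples X \<and> pairwise disjnt P \<and> card P = card X div 3"

definition meet_once :: "'a set set \<Rightarrow> 'a set set \<Rightarrow> bool" where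
  "meet_once P Q \<longleftrightarrow> (\<forall>B\<in>P. \<forall>C\<in>Q. \<forall>x\<in>B \<inter> C. \<forall>y\<in>B \<inter> C. x = y)"

text \<open>The permutation \<open>s\<close> arranges the classes in cycles. None has length one,
  because a block meets itself in three points. For \<open>T\<close> only a cover is asked;
  disjointness of the classes follows by counting in \<open>linked_unique\<close>.\<close>

definition linked_family ::
    "'a set \<Rightarrow> 'i set \<Rightarrow> ('i \<Rightarrow> 'a set set) \<Rightarrow> ('i \<Rightarrow> 'i) \<Rightarrow> 'a set set \<Rightarrow> bool" where
  "linked_family X I P s T \<longleftrightarrow> finite I \<and> (\<forall>i\<in>I. pclass X (P i)) \<and> bij_betw s I I \<and>
     (\<forall>i\<in>I. meet_once (P i) (P (s i))) \<and> (\<forall>B\<in>T. \<exists>i\<in>I. B \<in> P i)"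

text \<open>The indices are naturals so that the existential quantifier stays within one type. The
  constructions index by tuples and sums and come back through \<open>linkedI\<close>.\<close>

definition linked :: "'a set \<Rightarrow> nat \<Rightarrow> 'a set set \<Rightarrow> bool" where
  "linked X m T \<longleftrightarrow> (\<exists>(I::nat set) P s. linked_family X I P s T \<and> card I = m)"

lemma meet_once_sym: "meet_once P Q \<Longrightarrow> meet_once Q P"
  unfolding meet_once_def by blast

lemma meet_onceI:
  "(\<And>B C x y. B \<in> P \<Longrightarrow> C \<in> Q \<Longrightarrow> x \<in> B \<Longrightarrow> x \<in> C \<Longrightarrow> y \<in> B \<Longrightarrow> y \<in> C \<Longrightarrow> x = y) \<Longrightarrow> meet_once P Q"
  unfolding meet_once_def by blast

lemma meet_onceD:
  "meet_once P Q \<Longrightarrow> B \<in> P \<Longrightarrow> C \<in> Q \<Longrightarrow> x \<in> B \<Longrightarrow> x \<in> C \<Longrightarrow> y \<in> B \<Longrightarrow> y \<in> C \<Longrightarrow> x = y"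
  unfolding meet_once_def by blast

lemma finite_triples: "finite X \<Longrightarrow> finite (triples X)"
  unfolding triples_def by (rule finite_subset[of _ "Pow X"]) auto

lemma card_triples: "finite X \<Longrightarrow> card (triples X) = card X choose 3"
  unfolding triples_def by (rule n_subsets)

lemma pclass_finite: "finite X \<Longrightarrow> pclass X P \<Longrightarrow> finite P"
  unfolding pclass_def using finite_triples finite_subset by metis

text \<open>A family of \<open>k\<close> sets of size at most three whose union has \<open>3 k\<close> points consists of
  disjoint triples: only coverage of the points has to be checked.\<close>

lemma pclass_familyI:
  assumes fX: "finite X" and fJ: "finite J" and cJ: "card J = card X div 3"
    and F: "\<And>j. j \<in> J \<Longrightarrow> F j \<subseteq> X \<and> card (F j) \<le> 3"
    and cov: "3 * (card X div 3) \<le> card (\<Union>j\<in>J. F j)"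
  shows "pclass X (F ` J)"
proof -
  let ?k = "card X div 3"
  have finF: "finite (F j)" if "j \<in> J" for j using F[OF that] fX finite_subset by blast
  have rest: "card (\<Union>i\<in>J-{j}. F i) \<le> 3 * (?k - 1)" if "j \<in> J" for j
  proof -
    have "card (\<Union>i\<in>J-{j}. F i) \<le> (\<Sum>i\<in>J-{j}. card (F i))"
      using fJ by (intro card_UN_le) auto
    also have "\<dots> \<le> (\<Sum>i\<in>J-{j}. 3)" using F by (intro sum_mono) auto
    also have "\<dots> = 3 * (?k - 1)" using that fJ cJ by simp
    finally show ?thesis .
  qed
  have kpos: "?k \<ge> 1" if "j \<in> J" for j using that fJ cJ
    by (metis One_nat_def Suc_leI card_gt_0_iff empty_iff)
  have small: "3 \<le> card (F j - (\<Union>i\<in>J-{j}. F i))" if j: "j \<in> J" for j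
  proof -
    have "(\<Union>i\<in>J. F i) = (\<Union>i\<in>J-{j}. F i) \<union> (F j - (\<Union>i\<in>J-{j}. F i))" using j by auto
    then have "card (\<Union>i\<in>J. F i) \<le> card (\<Union>i\<in>J-{j}. F i) + card (F j - (\<Union>i\<in>J-{j}. F i))"
      by (metis card_Un_le)
    then show ?thesis using rest[OF j] cov kpos[OF j] by simp
  qed
  have c3: "card (F j) = 3" if j: "j \<in> J" for j
  proof -
    have "card (F j - (\<Union>i\<in>J-{j}. F i)) \<le> card (F j)" using finF[OF j] by (intro card_mono) auto
    then show ?thesis using small[OF j] F[OF j] by simp
  qed
  have dis: "F i \<inter> F j = {}" if i: "i \<in> J" and j: "j \<in> J" and "i \<noteq> j" for i j
  proof -
    have "card (F j - (\<Union>i\<in>J-{j}. F i)) = card (F j)" 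
      using small[OF j] c3[OF j] finF[OF j] by (metis Diff_subset card_mono order_antisym)
    then have "F j - (\<Union>i\<in>J-{j}. F i) = F j" using finF[OF j] by (intro card_subset_eq) auto
    then show ?thesis using that by blast
  qed
  have inj: "inj_on F J"
  proof (rule inj_onI)
    fix i j assume "i \<in> J" "j \<in> J" "F i = F j"
    then show "i = j" using dis[of i j] c3[of i] by (cases "i = j") auto
  qed
  show ?thesis unfolding pclass_def
  proof (intro conjI)
    show "F ` J \<subseteq> triples X" using F c3 unfolding triples_def by blast
    show "pairwise disjnt (F ` J)" 
      unfolding pairwise_def disjnt_def using dis by blast
    show "card (F ` J) = ?k" using inj cJ by (simp add: card_image)
  qed
qed

lemma linkedI:
  assumes "linked_family X I P s T" "card I = m"
  shows "linked X m T"
proof -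
  have fI: "finite I" using assms unfolding linked_family_def by simp
  obtain h where h: "bij_betw h I {..<m}"
    using assms(2) fI by (metis finite_same_card_bij card_lessThan finite_lessThan)
  let ?g = "inv_into I h"
  have g: "bij_betw ?g {..<m} I" using h by (rule bij_betw_inv_into)
  have gh: "?g (h i) = i" if "i \<in> I" for i using h that by (simp add: bij_betw_inv_into_left)
  have gI: "?g j \<in> I" if "j \<in> {..<m}" for j using g that bij_betwE by blast
  have sI: "s i \<in> I" if "i \<in> I" for i
    using assms that bij_betwE unfolding linked_family_def by blast
  have "linked_family X {..<m} (\<lambda>j. P (?g j)) (h \<circ> s \<circ> ?g) T"
    unfolding linked_family_def
  proof (intro conjI ballI)
    show "bij_betw (h \<circ> s \<circ> ?g) {..<m} {..<m}"
      using g h assms unfolding linked_family_def by (blast intro: bij_betw_trans)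
    fix j assume j: "j \<in> {..<m}"
    show "pclass X (P (?g j))" using assms gI[OF j] unfolding linked_family_def by blast
    show "meet_once (P (?g j)) (P (?g ((h \<circ> s \<circ> ?g) j)))"
      using assms gI[OF j] sI gh unfolding linked_family_def by simp
  next
    fix B assume "B \<in> T"
    then obtain i where "i \<in> I" "B \<in> P i" using assms unfolding linked_family_def by blast
    then show "\<exists>j\<in>{..<m}. B \<in> P (?g j)" using gh h bij_betwE by metis
  qed simp
  then show ?thesis unfolding linked_def by (metis card_lessThan)
qed

lemma linked_Un:
  assumes "linked X m T" "linked X n U"
  shows "linked X (m + n) (T \<union> U)"
proof -
  obtain I :: "nat set" and P s where a: "linked_family X I P s T" "card I = m"
    using assms(1) unfolding linked_def by blast
  obtain J :: "nat set" and Q t where b: "linked_family X J Q t U" "card J = n"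
    using assms(2) unfolding linked_def by blast
  have fin: "finite I" "finite J" using a b unfolding linked_family_def by auto
  have bs: "bij_betw s I I" "bij_betw t J J" using a b unfolding linked_family_def by auto
  have "bij_betw (map_sum s t) (Inl ` I \<union> Inr ` J) (Inl ` I \<union> Inr ` J)"
  proof (rule bij_betw_combine)
    show "bij_betw (map_sum s t) (Inl ` I) (Inl ` I)"
      using bs(1) unfolding bij_betw_def inj_on_def by (auto simp: image_image)
    show "bij_betw (map_sum s t) (Inr ` J) (Inr ` J)"
      using bs(2) unfolding bij_betw_def inj_on_def by (auto simp: image_image)
  qed auto
  then have "linked_family X (Inl ` I \<union> Inr ` J) (case_sum P Q) (map_sum s t) (T \<union> U)"
    using a(1) b(1) unfolding linked_family_def by (auto simp: ball_Un bex_Un)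
  moreover have "card (Inl ` I \<union> Inr ` J) = m + n"
    using fin a(2) b(2) by (subst card_Un_disjoint) (auto simp: card_image)
  ultimately show ?thesis by (rule linkedI)
qed

lemma linked_mono: "linked X m T \<Longrightarrow> U \<subseteq> T \<Longrightarrow> linked X m U"
proof -
  assume "linked X m T" "U \<subseteq> T"
  moreover from \<open>linked X m T\<close> obtain I :: "nat set" and P s where "linked_family X I P s T" "card I = m"
    unfolding linked_def by blast
  ultimately have "linked_family X I P s U" unfolding linked_family_def by blast
  then show ?thesis using \<open>card I = m\<close> by (rule linkedI)
qed

text \<open>Each class \<open>Q j\<close> is inserted into the cycle of \<open>s\<close> between \<open>h j\<close> and \<open>s (h j)\<close>.\<close>

lemma linked_insert:
  assumes a: "linked_family X I P s T" and fJ: "finite J"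
    and Q: "\<And>j. j \<in> J \<Longrightarrow> pclass X (Q j)"
    and h: "inj_on h J" "h ` J \<subseteq> I"
    and m1: "\<And>j. j \<in> J \<Longrightarrow> meet_once (P (h j)) (Q j)"
    and m2: "\<And>j. j \<in> J \<Longrightarrow> meet_once (Q j) (P (s (h j)))"
  shows "linked X (card I + card J) (T \<union> (\<Union>j\<in>J. Q j))"
proof -
  let ?L = "Inl ` I \<union> Inr ` J"
  let ?k = "inv_into J h"
  define r where "r = case_sum (\<lambda>i. if i \<in> h ` J then Inr (?k i) else Inl (s i)) (\<lambda>j. Inl (s (h j)))"
  have fI: "finite I" and bs: "bij_betw s I I" using a unfolding linked_family_def by auto
  have kh: "?k (h j) = j" if "j \<in> J" for j using h(1) that by simp
  have sub: "?L \<subseteq> r ` ?L"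
  proof
    fix x assume "x \<in> ?L"
    then show "x \<in> r ` ?L"
    proof
      assume "x \<in> Inl ` I"
      then obtain i where i: "i \<in> I" "x = Inl (s i)" using bs unfolding bij_betw_def by auto
      show ?thesis
      proof (cases "i \<in> h ` J")
        case True
        then obtain j where "j \<in> J" "i = h j" by blast
        then have "x = r (Inr j)" using i by (simp add: r_def)
        then show ?thesis using \<open>j \<in> J\<close> by blast
      next
        case False
        then have "x = r (Inl i)" using i by (simp add: r_def)
        then show ?thesis using i by blast
      qed
    next
      assume "x \<in> Inr ` J"
      then obtain j where j: "j \<in> J" "x = Inr j" by blast
      then have "x = r (Inl (h j))" using kh by (simp add: r_def)
      then show ?thesis using j h by blast
    qed
  qed
  have "finite ?L" using fI fJ by simp
  moreover have "s i \<in> I" if "i \<in> I" for i using bs that bij_betwE by blast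
  then have "r ` ?L \<subseteq> ?L"
    using h kh unfolding r_def by auto
  ultimately have bij: "bij_betw r ?L ?L" using sub unfolding bij_betw_def
    by (metis eq_card_imp_inj_on subset_antisym)
  have "linked_family X ?L (case_sum P Q) r (T \<union> (\<Union>j\<in>J. Q j))"
    unfolding linked_family_def
  proof (intro conjI ballI)
    fix i assume i: "i \<in> ?L"
    show "pclass X (case_sum P Q i)" using i a Q unfolding linked_family_def by auto
    show "meet_once (case_sum P Q i) (case_sum P Q (r i))"
      using i a m1 m2 kh unfolding linked_family_def r_def by auto
  next
    fix B assume "B \<in> T \<union> (\<Union>j\<in>J. Q j)"
    then show "\<exists>i\<in>?L. B \<in> case_sum P Q i"
      using a unfolding linked_family_def by (auto simp: bex_Un)
  qed (use bij fI fJ in auto)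
  moreover have "card ?L = card I + card J"
    using fI fJ by (subst card_Un_disjoint) (auto simp: card_image)
  ultimately show ?thesis by (rule linkedI)
qed

lemma pclass_image:
  assumes f: "inj_on f X" "f ` X = Y" and fX: "finite X" and P: "pclass X P"
  shows "pclass Y ((`) f ` P)"
proof -
  have sub: "B \<subseteq> X" "card B = 3" if "B \<in> P" for B using P that unfolding pclass_def triples_def by auto
  have inj: "inj_on ((`) f) P" 
    using inj_on_image_Pow[OF f(1)] by (rule inj_on_subset) (use sub in auto)
  have "card Y = card X" using f by (metis card_image)
  then show ?thesis unfolding pclass_def
  proof (intro conjI)
    show "(`) f ` P \<subseteq> triples Y" 
      using sub f unfolding triples_def by (auto simp: card_image inj_on_subset)
    show "pairwise disjnt ((`) f ` P)"
    proof (rule pairwise_imageI)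
      fix B C assume "B \<in> P" "C \<in> P" "B \<noteq> C"
      then show "disjnt (f ` B) (f ` C)"
        using P sub f(1) unfolding pclass_def pairwise_def disjnt_def
        by (metis image_empty inj_on_image_Int)
    qed
    show "card ((`) f ` P) = card Y div 3" 
      using P inj \<open>card Y = card X\<close> unfolding pclass_def by (simp add: card_image)
  qed
qed

lemma meet_once_image:
  assumes f: "inj_on f X" and "\<Union>P \<subseteq> X" "\<Union>Q \<subseteq> X" and "meet_once P Q"
  shows "meet_once ((`) f ` P) ((`) f ` Q)"
proof (rule meet_onceI)
  fix B C x y assume "B \<in> (`) f ` P" "C \<in> (`) f ` Q" and xy: "x \<in> B" "x \<in> C" "y \<in> B" "y \<in> C"
  then obtain B' C' where BC: "B' \<in> P" "B = f ` B'" "C' \<in> Q" "C = f ` C'" by blast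
  have "B \<inter> C = f ` (B' \<inter> C')" unfolding BC
    using assms BC by (intro inj_on_image_Int[symmetric]) auto
  then obtain x' y' where "x' \<in> B' \<inter> C'" "y' \<in> B' \<inter> C'" "x = f x'" "y = f y'" using xy by blast
  then show "x = y" using meet_onceD[OF assms(4) BC(1,3)] by auto
qed

lemma pclass_Union: "pclass X P \<Longrightarrow> \<Union>P \<subseteq> X"
  unfolding pclass_def triples_def by auto

lemma linked_transfer:
  assumes L: "linked X m (triples X)" and fX: "finite X" and c: "card Y = card X" "finite Y"
  shows "linked Y m (triples Y)"
proof -
  obtain f where f: "bij_betw f X Y" using fX c by (metis finite_same_card_bij)
  obtain I :: "nat set" and P s where a: "linked_family X I P s (triples X)" and cI: "card I = m"
    using L unfolding linked_def by blast
  have sI: "s i \<in> I" if "i \<in> I" for i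
    using a that bij_betwE unfolding linked_family_def by blast
  have "linked_family Y I (\<lambda>i. (`) f ` P i) s (triples Y)"
    unfolding linked_family_def
  proof (intro conjI ballI)
    fix i assume i: "i \<in> I"
    show "pclass Y ((`) f ` P i)" 
      using a i f fX pclass_image unfolding linked_family_def bij_betw_def by blast
    show "meet_once ((`) f ` P i) ((`) f ` P (s i))"
      using a i f sI pclass_Union unfolding linked_family_def bij_betw_def 
      by (intro meet_once_image[of f X]) blast+
  next
    fix B assume B: "B \<in> triples Y"
    obtain C where C: "C \<subseteq> X" "B = f ` C" using B f unfolding triples_def bij_betw_def
      by (metis (no_types, lifting) mem_Collect_eq subset_image_iff)
    have "card B = card C" using C f unfolding bij_betw_def by (metis card_image inj_on_subset)
    then have "C \<in> triples X" using C B unfolding triples_def by simp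
    then show "\<exists>i\<in>I. B \<in> (`) f ` P i" using a C unfolding linked_family_def by blast
  qed (use a in \<open>auto simp: linked_family_def\<close>)
  then show ?thesis using cI by (rule linkedI)
qed

text \<open>Here \<open>m\<close> classes of \<open>N div 3\<close> blocks hold exactly as many
  blocks as there are triples, which turns the cover into a partition.\<close>

definition resolved :: "nat \<Rightarrow> bool" where
  "resolved N \<longleftrightarrow> (\<exists>m. linked {..<N} m (triples {..<N}) \<and> m * (N div 3) = N choose 3)"

lemma resolvedI:
  assumes "linked X m (triples X)" "finite X" "card X = N" "m * (N div 3) = N choose 3"
  shows "resolved N"
  unfolding resolved_def using linked_transfer[OF assms(1,2), of "{..<N}"] assms by auto

text \<open>A block lying in two classes could be dropped from one of them without uncovering a
  triple, and fewer blocks than triples would remain.\<close>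

lemma linked_unique:
  assumes a: "linked_family X I P s (triples X)" and fX: "finite X"
    and c: "card I * (card X div 3) = card X choose 3"
    and "i \<in> I" "j \<in> I" "B \<in> P i" "B \<in> P j"
  shows "i = j"
proof (rule ccontr)
  assume ne: "i \<noteq> j"
  have fI: "finite I" using a unfolding linked_family_def by blast
  have P: "pclass X (P k)" if "k \<in> I" for k using a that unfolding linked_family_def by blast
  have cP: "card (P k) = card X div 3" "finite (P k)" if "k \<in> I" for k 
    using P[OF that] pclass_finite[OF fX] unfolding pclass_def by auto
  have "triples X \<subseteq> (\<Union>k\<in>I-{i}. P k) \<union> (P i - {B})"
    using a assms ne unfolding linked_family_def by blast
  then have "card X choose 3 \<le> card ((\<Union>k\<in>I-{i}. P k) \<union> (P i - {B}))"
    using cP fI assms by (subst card_triples[OF fX, symmetric], intro card_mono) auto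
  also have "\<dots> \<le> card (\<Union>k\<in>I-{i}. P k) + card (P i - {B})" by (rule card_Un_le)
  also have "card (\<Union>k\<in>I-{i}. P k) \<le> (\<Sum>k\<in>I-{i}. card (P k))"
    using fI by (intro card_UN_le) auto
  also have "(\<Sum>k\<in>I-{i}. card (P k)) = (card I - 1) * (card X div 3)"
    using cP fI assms by simp
  also have "card (P i - {B}) < card (P i)" using cP assms by (intro card_Diff1_less) auto
  finally have "card X choose 3 < (card I - 1) * (card X div 3) + card X div 3" using cP assms by simp
  moreover have "(card I - 1) * (card X div 3) + card X div 3 = card I * (card X div 3)"
    using fI assms(4) by (cases "card I") auto
  ultimately show False using c by simp
qed

section \<open>Colouring the points by two linked classes\<close>

text \<open>With \<open>y0\<close> a point of colour \<open>b\<close> in the \<open>P\<close>-block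
  of an uncoloured point, this is the Kempe chain that leaves \<open>y0\<close> on the side of
  \<open>Q\<close>. A point of colour \<open>b\<close> is left through its \<open>Q\<close>-block
  and a point of colour \<open>a\<close> through its \<open>P\<close>-block, which builds the parity
  argument for bipartite graphs into the rules.\<close>

inductive_set kempe :: "'a set set \<Rightarrow> 'a set set \<Rightarrow> 'a set \<Rightarrow> ('a \<Rightarrow> nat) \<Rightarrow> nat \<Rightarrow> nat \<Rightarrow> 'a \<Rightarrow> 'a set"
  for P Q X col a b y0 where
  start: "y0 \<in> kempe P Q X col a b y0"
| stepQ: "\<lbrakk>y \<in> kempe P Q X col a b y0; col y = b; C \<in> Q; y \<in> C; z \<in> C; z \<in> X; col z = a\<rbrakk>
    \<Longrightarrow> z \<in> kempe P Q X col a b y0"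
| stepP: "\<lbrakk>y \<in> kempe P Q X col a b y0; col y = a; B \<in> P; y \<in> B; z \<in> B; z \<in> X; col z = b\<rbrakk>
    \<Longrightarrow> z \<in> kempe P Q X col a b y0"

text \<open>Blocks of \<open>P\<close> and \<open>Q\<close> are the vertices and points the edges of a bipartite graph of degree
  at most three; the colouring is the edge colouring of Koenig's theorem.\<close>

lemma rainbow_colouring:
  fixes P Q :: "'a set set"
  assumes fX: "finite X" and dP: "pairwise disjnt P" and dQ: "pairwise disjnt Q"
    and c: "\<And>B. B \<in> P \<union> Q \<Longrightarrow> card B = 3"
  shows "\<exists>col::'a \<Rightarrow> nat. (\<forall>x. col x < 3) \<and> (\<forall>B\<in>P \<union> Q. inj_on col (B \<inter> X))"
  using fX
proof (induction X)
  case empty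
  then show ?case by (intro exI[of _ "\<lambda>_. 0"]) auto
next
  case (insert x X)
  then obtain col :: "'a \<Rightarrow> nat" where col3: "\<And>y. col y < 3"
    and inj: "\<And>B. B \<in> P \<union> Q \<Longrightarrow> inj_on col (B \<inter> X)" by blast
  have uniq: "B = C" if "R = P \<or> R = Q" "B \<in> R" "C \<in> R" "y \<in> B" "y \<in> C" for R B C and y :: 'a
    using that dP dQ unfolding pairwise_def disjnt_def by blast
  have free: "\<exists>a<3. \<forall>B\<in>R. x \<in> B \<longrightarrow> a \<notin> col ` (B \<inter> X)" if R: "R = P \<or> R = Q" for R
  proof (cases "\<exists>B\<in>R. x \<in> B")
    case True
    then obtain B where B: "B \<in> R" "x \<in> B" by blast
    have cB: "card B = 3" using B R c by blast
    then have fB: "finite B" by (metis card.infinite zero_neq_numeral)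
    have "card (col ` (B \<inter> X)) \<le> card (B \<inter> X)" using fB by (intro card_image_le) auto
    also have "\<dots> \<le> card (B - {x})" using fB insert by (intro card_mono) auto
    also have "\<dots> < card {..<3::nat}" using cB B fB by simp
    finally have "\<not> {..<3} \<subseteq> col ` (B \<inter> X)" using fB 
      by (metis card_mono finite_Int finite_imageI leD)
    then obtain a where "a < 3" "a \<notin> col ` (B \<inter> X)" by auto
    then show ?thesis using uniq[OF R B(1)] B by metis
  qed (auto intro: exI[of _ 0])
  \<comment> \<open>\<open>a\<close> is free in the \<open>P\<close>-block of \<open>x\<close> and
    \<open>b\<close> in its \<open>Q\<close>-block. The aim is a recolouring after which
    \<open>b\<close> is free in both.\<close>
  obtain a where a: "a < 3" "\<And>B y. B \<in> P \<Longrightarrow> x \<in> B \<Longrightarrow> y \<in> B \<Longrightarrow> y \<in> X \<Longrightarrow> col y \<noteq> a" 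
    using free[of P] by blast
  obtain b where b: "b < 3" "\<And>B y. B \<in> Q \<Longrightarrow> x \<in> B \<Longrightarrow> y \<in> B \<Longrightarrow> y \<in> X \<Longrightarrow> col y \<noteq> b" 
    using free[of Q] by blast
  have extend: ?case if "\<And>y. k y < 3" "e < 3" "\<And>B. B \<in> P \<union> Q \<Longrightarrow> inj_on k (B \<inter> X)"
    "\<And>B y. B \<in> P \<union> Q \<Longrightarrow> x \<in> B \<Longrightarrow> y \<in> B \<Longrightarrow> y \<in> X \<Longrightarrow> k y \<noteq> e" for k :: "'a \<Rightarrow> nat" and e
  proof (intro exI[of _ "k(x := e)"] conjI allI ballI)
    show "(k(x := e)) y < 3" for y using that by simp
    fix B assume B: "B \<in> P \<union> Q"
    show "inj_on (k(x := e)) (B \<inter> insert x X)"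
      using that(3,4)[OF B] insert.hyps unfolding inj_on_def by (auto split: if_splits)
  qed
  show ?case
  proof (cases "\<exists>B y. B \<in> P \<and> x \<in> B \<and> y \<in> B \<and> y \<in> X \<and> col y = b")
    case False
    show ?thesis
    proof (rule extend[of col b])
      fix B y assume "B \<in> P \<union> Q" "x \<in> B" "y \<in> B" "y \<in> X"
      then show "col y \<noteq> b" using False b(2) by blast
    qed (use col3 b(1) inj in auto)
  next
    case True
    then obtain B0 y0 where y0: "B0 \<in> P" "x \<in> B0" "y0 \<in> B0" "y0 \<in> X" "col y0 = b" by blast
    have ab: "a \<noteq> b" using a(2)[OF y0(1-4)] y0 by simp
    let ?K = "kempe P Q X col a b y0"
    have KX: "y \<in> X \<and> (col y = a \<or> col y = b)" if "y \<in> ?K" for y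
      using that by (induction) (use y0 in auto)
    have Ka: "\<exists>y\<in>?K. col y = b \<and> (\<exists>C\<in>Q. y \<in> C \<and> z \<in> C)" if "z \<in> ?K" "col z = a" for z
      using that by (cases) (use y0 ab in auto)
    have Kb: "z = y0 \<or> (\<exists>y\<in>?K. col y = a \<and> (\<exists>B\<in>P. y \<in> B \<and> z \<in> B))" if "z \<in> ?K" "col z = b" for z
      using that by (cases) (use ab in auto)
    \<comment> \<open>The rules are directed, but the chain is closed in both directions: a block
      has at most one point of each colour, so the predecessor of a point is the only candidate.
      Only \<open>y0\<close> lacks a predecessor, and its \<open>P\<close>-block has no point of
      colour \<open>a\<close>.\<close>
    have closed: "w \<in> ?K" if B: "B \<in> P \<union> Q" "z \<in> B" "w \<in> B" "w \<in> X" and zK: "z \<in> ?K"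
      and cw: "col w = a \<or> col w = b" and ne: "z \<noteq> w" for B z w
    proof -
      have zX: "z \<in> X" using KX zK by blast
      have cne: "col z \<noteq> col w" using inj_onD[OF inj[OF B(1)], of z w] B zX ne by blast
      consider "B \<in> P" "col z = a" "col w = b" | "B \<in> P" "col z = b" "col w = a"
        | "B \<in> Q" "col z = a" "col w = b" | "B \<in> Q" "col z = b" "col w = a"
        using KX[OF zK] cw cne B by auto
      then show ?thesis
      proof cases
        case 1 then show ?thesis using kempe.stepP[OF zK] B by blast
      next
        case 2
        have "z \<noteq> y0"
        proof
          assume "z = y0"
          then have "B = B0" using uniq[of P B B0 y0] y0 2 B by blast
          then show False using a(2)[of B w] y0 2 B by blast
        qed
        then obtain y C where "y \<in> ?K" "col y = a" "C \<in> P" "y \<in> C" "z \<in> C" using Kb zK 2 by blast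
        moreover from this have "C = B" using uniq[of P C B z] 2 B by blast
        ultimately have "y = w" using inj_onD[OF inj[OF B(1)], of y w] KX[of y] B 2 by auto
        then show ?thesis using \<open>y \<in> ?K\<close> by simp
      next
        case 3
        then obtain y C where "y \<in> ?K" "col y = b" "C \<in> Q" "y \<in> C" "z \<in> C" using Ka zK by blast
        moreover from this have "C = B" using uniq[of Q C B z] 3 B by blast
        ultimately have "y = w" using inj_onD[OF inj[OF B(1)], of y w] KX[of y] B 3 by auto
        then show ?thesis using \<open>y \<in> ?K\<close> by simp
      next
        case 4 then show ?thesis using kempe.stepQ[OF zK] B by blast
      qed
    qed
    \<comment> \<open>Exchanging \<open>a\<close> and \<open>b\<close> along the chain recolours
      \<open>y0\<close>, which frees \<open>b\<close> in the \<open>P\<close>-block of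
      \<open>x\<close>.\<close>
    define k where "k y = (if y \<in> ?K then (if col y = a then b else a) else col y)" for y
    show ?thesis
    proof (rule extend[of k b])
      show "k y < 3" for y using a b col3 unfolding k_def by auto
      show "b < 3" by (rule b)
    next
      fix B assume B: "B \<in> P \<union> Q"
      show "inj_on k (B \<inter> X)"
      proof (rule inj_onI, rule ccontr)
        fix z w assume zw: "z \<in> B \<inter> X" "w \<in> B \<inter> X" "k z = k w" "z \<noteq> w"
        have cne: "col z \<noteq> col w" using inj_onD[OF inj[OF B], of z w] zw by blast
        have c1: "z \<in> ?K \<Longrightarrow> col w = a \<or> col w = b \<Longrightarrow> w \<in> ?K" using closed[of B z w] B zw by blast
        have c2: "w \<in> ?K \<Longrightarrow> col z = a \<or> col z = b \<Longrightarrow> z \<in> ?K" using closed[of B w z] B zw by blast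
        have kz: "k z = (if z \<in> ?K then (if col z = a then b else a) else col z)"
          "k w = (if w \<in> ?K then (if col w = a then b else a) else col w)" by (simp_all add: k_def)
        show False
        proof (cases "z \<in> ?K"; cases "w \<in> ?K")
          assume "z \<in> ?K" "w \<in> ?K"
          then show False using kz zw(3) cne ab KX by (metis (full_types))
        next
          assume *: "z \<in> ?K" "w \<notin> ?K"
          then have "k w \<noteq> a" "k w \<noteq> b" using c1 kz by auto
          then show False using kz * zw(3) by (metis (full_types))
        next
          assume *: "z \<notin> ?K" "w \<in> ?K"
          then have "k z \<noteq> a" "k z \<noteq> b" using c2 kz by auto
          then show False using kz * zw(3) by (metis (full_types))
        next
          assume "z \<notin> ?K" "w \<notin> ?K"
          then show False using kz zw(3) cne by simp
        qed
      qed
      fix y assume y: "x \<in> B" "y \<in> B" "y \<in> X"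
      show "k y \<noteq> b"
      proof
        assume ky: "k y = b"
        have yK: "y \<in> ?K \<and> col y = a \<or> y \<notin> ?K \<and> col y = b" 
          using ky KX[of y] ab k_def[of y] by (metis (full_types))
        show False
        proof (cases "B \<in> P")
          case True
          then have "B = B0" using uniq[of P B B0 x] y0 y by blast
          then have "col y = b \<Longrightarrow> y = y0" using inj_onD[OF inj[OF B], of y y0] y y0 by auto
          then show False using yK a(2)[OF True y] kempe.start[of y0 P Q X col a b] by auto
        next
          case False
          then have BQ: "B \<in> Q" using B by blast
          then have "col y \<noteq> b" using b(2) y by blast
          then have "y \<in> ?K" "col y = a" using yK by auto
          \<comment> \<open>The chain cannot spoil the \<open>Q\<close>-block of \<open>x\<close>: a
            point of colour \<open>a\<close> is only entered from a point of colour \<open>b\<close>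
            in the same \<open>Q\<close>-block, and that block has none.\<close>
          then obtain z C where z: "z \<in> ?K" "col z = b" "C \<in> Q" "z \<in> C" "y \<in> C" using Ka by blast
          then have "C = B" using uniq[of Q C B y] BQ y by blast
          then show False using b(2)[OF BQ y(1), of z] z KX by blast
        qed
      qed
    qed
  qed
qed

section \<open>The size of optimal codes\<close>

lemma code_card_le:
  assumes "is_code 3 N 5 3 C"
  shows "3 * card C \<le> 2 * N"
proof -
  have C: "C \<subseteq> H 3 N 3" "\<And>x y. x \<in> C \<Longrightarrow> y \<in> C \<Longrightarrow> x \<noteq> y \<Longrightarrow> hamming_dist N x y \<ge> 5"
    using assms unfolding is_code_def by auto
  let ?S = "\<lambda>w::nat \<Rightarrow> nat. {i. i < N \<and> w i \<noteq> 0}"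
  have cS: "card (?S w) = 3" if "w \<in> C" for w
    using C(1) that unfolding H_def weight_def by auto
  have "finite C"
  proof (rule ccontr)
    assume "infinite C"
    have "finite {w. \<forall>i. (i \<in> {..<N} \<longrightarrow> w i \<in> {..<3}) \<and> (i \<notin> {..<N} \<longrightarrow> w i = (0::nat))}"
      by (rule finite_set_of_finite_funs) auto
    moreover have "C \<subseteq> {w. \<forall>i. (i \<in> {..<N} \<longrightarrow> w i \<in> {..<3}) \<and> (i \<notin> {..<N} \<longrightarrow> w i = (0::nat))}"
      using C(1) unfolding H_def words_def by auto
    ultimately show False using \<open>infinite C\<close> finite_subset by blast
  qed
  \<comment> \<open>Words with the same nonzero symbol at a common position differ at most at the
    two plus two other positions of their supports. Hence each of the \<open>2 * N\<close> pairs of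
    a position and a nonzero symbol belongs to at most one word, and every word takes three of
    them.\<close>
  have inj: "inj_on (\<lambda>(w, i). (i, w i)) (SIGMA w:C. ?S w)"
  proof (rule inj_onI, clarsimp)
    fix v w i assume vw: "v \<in> C" "w \<in> C" "i < N" "v i = w i" "0 < w i"
    show "v = w"
    proof (rule ccontr)
      assume "v \<noteq> w"
      have "{j. j < N \<and> v j \<noteq> w j} \<subseteq> (?S v - {i}) \<union> (?S w - {i})" using vw by auto
      then have "hamming_dist N v w \<le> card ((?S v - {i}) \<union> (?S w - {i}))"
        unfolding hamming_dist_def by (intro card_mono) auto
      also have "\<dots> \<le> card (?S v - {i}) + card (?S w - {i})" by (rule card_Un_le)
      also have "\<dots> = 4" using cS vw by simp
      finally show False using C(2)[OF vw(1,2) \<open>v \<noteq> w\<close>] by simp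
    qed
  qed
  have "3 * card C = card (SIGMA w:C. ?S w)" using \<open>finite C\<close> cS by (simp add: card_SigmaI)
  also have "\<dots> = card ((\<lambda>(w, i). (i, w i)) ` (SIGMA w:C. ?S w))" using inj by (simp add: card_image)
  also have "\<dots> \<le> card ({..<N} \<times> {1,2::nat})"
  proof (intro card_mono)
    show "(\<lambda>(w, i). (i, w i)) ` (SIGMA w:C. ?S w) \<subseteq> {..<N} \<times> {1,2}"
    proof (rule subsetI)
      fix p assume "p \<in> (\<lambda>(w, i). (i, w i)) ` (SIGMA w:C. ?S w)"
      then obtain w i where wi: "w \<in> C" "i < N" "w i \<noteq> 0" "p = (i, w i)" by auto
      then have "w i < 3" using C(1) unfolding H_def words_def by auto
      then have "w i = 1 \<or> w i = 2" using wi(3) by linarith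
      then show "p \<in> {..<N} \<times> {1,2}" using wi by auto
    qed
  qed auto
  finally show ?thesis by simp
qed

text \<open>For \<open>N = 3 q\<close> and \<open>N = 3 q + 1\<close> the bound
  \<open>2 N / 3\<close> rounds down to \<open>2 q\<close>. For \<open>N = 3 q + 2\<close> it would
  allow one word more.\<close>

lemma optimal_codeI:
  assumes "is_code 3 N 5 3 C" "card C = 2 * (N div 3)" "N mod 3 \<noteq> 2"
  shows "optimal_code 3 N 5 3 C"
proof -
  have le: "card D \<le> card C" if "is_code 3 N 5 3 D" for D
  proof -
    define q r where "q = N div 3" and "r = N mod 3"
    have "N = 3 * q + r" "r < 3" "r \<noteq> 2" using assms(3) by (auto simp: q_def r_def)
    then show ?thesis using code_card_le[OF that] assms(2) q_def by linarith
  qed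
  have "Max {card D | D. is_code 3 N 5 3 D} = card C"
  proof (rule Max_eqI)
    show "finite {card D | D. is_code 3 N 5 3 D}"
    proof (rule finite_subset)
      show "{card D | D. is_code 3 N 5 3 D} \<subseteq> {..card C}" using le by blast
    qed simp
    show "y \<le> card C" if "y \<in> {card D | D. is_code 3 N 5 3 D}" for y using le that by blast
    show "card C \<in> {card D | D. is_code 3 N 5 3 D}" using assms(1) by blast
  qed
  then show ?thesis unfolding optimal_code_def A_def using assms by simp
qed

section \<open>Codes from linked classes\<close>

definition word_on :: "nat set \<Rightarrow> (nat \<Rightarrow> nat) \<Rightarrow> nat \<Rightarrow> nat" where
  "word_on B e = (\<lambda>x. if x \<in> B then Suc (e x) else 0)"

text \<open>The even-weight vectors of length three; \<open>even_word u c\<close> is coordinate \<open>c\<close> of vector \<open>u\<close>.\<close>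

definition even_word :: "nat \<Rightarrow> nat \<Rightarrow> nat" where
  "even_word u c = (if u = 0 \<or> u = Suc c then 0 else 1)"

lemma even_word_le: "even_word u c \<le> 1"
  unfolding even_word_def by simp

text \<open>The length is odd, so complementing flips the parity of the weight: the four even
  vectors and their complements are all eight sign patterns.\<close>

lemma even_word_parity:
  assumes "u < 4"
  shows "even (even_word u 0 + even_word u (Suc 0) + even_word u 2)"
    and "odd ((1 - even_word u 0) + (1 - even_word u (Suc 0)) + (1 - even_word u 2))"
proof -
  have "u = 0 \<or> u = 1 \<or> u = 2 \<or> u = 3" using assms by auto
  then show "even (even_word u 0 + even_word u (Suc 0) + even_word u 2)"
    and "odd ((1 - even_word u 0) + (1 - even_word u (Suc 0)) + (1 - even_word u 2))"
    by (auto simp: even_word_def)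
qed

lemma ex_even_word:
  assumes "a \<le> 1" "b \<le> 1" "c \<le> 1" "even (a + b + c)"
  shows "\<exists>u<4. even_word u 0 = a \<and> even_word u (Suc 0) = b \<and> even_word u 2 = c"
proof -
  have "a = 0 \<or> a = 1" "b = 0 \<or> b = 1" "c = 0 \<or> c = 1" using assms by auto
  then consider "a = 0 \<and> b = 0 \<and> c = 0" | "a = 0 \<and> b = 1 \<and> c = 1"
    | "a = 1 \<and> b = 0 \<and> c = 1" | "a = 1 \<and> b = 1 \<and> c = 0"
    using assms(4) by auto
  then show ?thesis
  proof cases
    case 1 then show ?thesis by (intro exI[of _ 0]) (auto simp: even_word_def)
  next
    case 2 then show ?thesis by (intro exI[of _ 1]) (auto simp: even_word_def)
  next
    case 3 then show ?thesis by (intro exI[of _ 2]) (auto simp: even_word_def)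
  next
    case 4 then show ?thesis by (intro exI[of _ 3]) (auto simp: even_word_def)
  qed
qed

lemma even_word_inj:
  assumes "u < 4" "v < 4" "even_word u 0 = even_word v 0" "even_word u (Suc 0) = even_word v (Suc 0)"
    "even_word u 2 = even_word v 2"
  shows "u = v"
proof -
  have "u = 0 \<or> u = 1 \<or> u = 2 \<or> u = 3" "v = 0 \<or> v = 1 \<or> v = 2 \<or> v = 3" using assms by auto
  then show ?thesis using assms(3-5) by (auto simp: even_word_def)
qed

lemma word_on_H:
  assumes "B \<in> triples {..<N}" "\<And>x. e x \<le> 1"
  shows "word_on B e \<in> H 3 N 3"
proof -
  have "{i. i < N \<and> word_on B e i \<noteq> 0} = B"
    using assms(1) unfolding triples_def word_on_def by auto
  then show ?thesis using assms unfolding H_def words_def weight_def triples_def word_on_def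
    by (auto simp: le_imp_less_Suc numeral_3_eq_3 less_Suc_eq_le)
qed

text \<open>The supports share at most one point and the symbols differ there, so the words differ
  on the whole union, which has at least \<open>3 + 3 - 1\<close> points.\<close>

lemma word_on_dist:
  assumes B: "B \<in> triples {..<N}" and C: "C \<in> triples {..<N}"
    and one: "\<And>x y. x \<in> B \<inter> C \<Longrightarrow> y \<in> B \<inter> C \<Longrightarrow> x = y"
    and ne: "\<And>x. x \<in> B \<inter> C \<Longrightarrow> e x \<noteq> f x"
  shows "hamming_dist N (word_on B e) (word_on C f) \<ge> 5"
proof -
  have fin: "finite B" "finite C" "card B = 3" "card C = 3" using B C unfolding triples_def
    by (auto intro: finite_subset)
  have "card (B \<inter> C) \<le> 1" using one fin by (simp add: card_le_Suc0_iff_eq)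
  then have "card (B \<union> C) \<ge> 5" using card_Un_Int[of B C] fin by linarith
  moreover have "{i. i < N \<and> word_on B e i \<noteq> word_on C f i} = B \<union> C"
    using B C ne unfolding triples_def word_on_def by (auto split: if_splits)
  ultimately show ?thesis unfolding hamming_dist_def by simp
qed

lemma word_on_eqD: "word_on B e = word_on C f \<Longrightarrow> B = C \<and> (\<forall>x\<in>B. e x = f x)"
proof -
  assume a: "word_on B e = word_on C f"
  have b: "x \<in> B \<longleftrightarrow> x \<in> C" for x using fun_cong[OF a, of x] unfolding word_on_def by (auto split: if_splits)
  have "e x = f x" if "x \<in> B" for x 
    using fun_cong[OF a, of x] b that unfolding word_on_def by (auto split: if_splits)
  then show ?thesis using b by blast
qed

lemma H_word_on:
  assumes "w \<in> H 3 N 3"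
  shows "\<exists>B e. B \<in> triples {..<N} \<and> (\<forall>x. e x \<le> 1) \<and> w = word_on B e"
proof -
  define B where "B = {i. i < N \<and> w i \<noteq> 0}"
  have "B \<in> triples {..<N}" using assms unfolding H_def weight_def triples_def B_def by auto
  moreover have w3: "w x < 3" for x using assms unfolding H_def words_def by (cases "x < N") auto
  then have "w x - 1 \<le> 1" for x using w3[of x] by linarith
  moreover have "w x = word_on B (\<lambda>x. w x - 1) x" for x
    using assms unfolding H_def words_def word_on_def B_def by (cases "x < N") auto
  then have "w = word_on B (\<lambda>x. w x - 1)" by (rule ext)
  ultimately show ?thesis by (intro exI conjI allI) assumption+
qed

lemma rainbow_block:
  assumes "card B = 3" "inj_on col B" "\<And>x. col x < (3::nat)"
  obtains p q r where "B = {p, q, r}" "col p = 0" "col q = Suc 0" "col r = 2" "p \<noteq> q" "p \<noteq> r" "q \<noteq> r"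
proof -
  have fB: "finite B" using assms(1) by (metis card.infinite zero_neq_numeral)
  have "card (col ` B) = card {..<3::nat}" using assms by (simp add: card_image)
  then have "col ` B = {..<3}" using assms(3) by (intro card_subset_eq) auto
  then have "0 \<in> col ` B" "Suc 0 \<in> col ` B" "2 \<in> col ` B" by auto
  then obtain p q r where pqr: "p \<in> B" "col p = 0" "q \<in> B" "col q = Suc 0" "r \<in> B" "col r = 2"
    by (auto simp: image_iff)
  then have ne: "p \<noteq> q" "p \<noteq> r" "q \<noteq> r" by auto
  have "{p, q, r} = B" using pqr ne assms(1) fB by (intro card_subset_eq) auto
  then show ?thesis using that pqr ne by blast
qed

text \<open>Every index \<open>i\<close> yields four codes \<open>D i u \<union> E i u\<close>, one
  for each even vector \<open>u\<close>. The words on a block of \<open>P j\<close> are split by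
  parity: the even patterns occur in the codes of \<open>j\<close>, the odd ones in the codes of the
  predecessor of \<open>j\<close>. As \<open>s\<close> is a bijection, each word is met exactly
  once.\<close>

theorem resolved_TOC:
  assumes res: "resolved N" and N3: "N \<ge> 3" "N mod 3 \<noteq> 2"
  shows "TOC_exists 3 N 5 3"
proof -
  let ?X = "{..<N}"
  obtain I :: "nat set" and P s where L: "linked_family ?X I P s (triples ?X)"
    and cI: "card I * (N div 3) = N choose 3"
    using res unfolding resolved_def linked_def by blast
  have fI: "finite I" and pc: "\<And>i. i \<in> I \<Longrightarrow> pclass ?X (P i)" and bij: "bij_betw s I I"
    and mo: "\<And>i. i \<in> I \<Longrightarrow> meet_once (P i) (P (s i))"
    and cov: "\<And>B. B \<in> triples ?X \<Longrightarrow> \<exists>i\<in>I. B \<in> P i"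
    using L unfolding linked_family_def by auto
  have sI: "s i \<in> I" if "i \<in> I" for i using bij that bij_betwE by blast
  have uniq: "i = j" if "i \<in> I" "j \<in> I" "B \<in> P i" "B \<in> P j" for i j B
    using linked_unique[OF L, of i j B] cI that by simp
  have PT: "B \<in> triples ?X" if "i \<in> I" "B \<in> P i" for i B using pc[OF that(1)] that unfolding pclass_def by blast
  have "\<exists>col::nat \<Rightarrow> nat. (\<forall>x. col x < 3) \<and> (\<forall>B\<in>P i \<union> P (s i). inj_on col B)" if i: "i \<in> I" for i
  proof -
    have "\<exists>col::nat \<Rightarrow> nat. (\<forall>x. col x < 3) \<and> (\<forall>B\<in>P i \<union> P (s i). inj_on col (B \<inter> ?X))"
    proof (rule rainbow_colouring)
      show "card B = 3" if "B \<in> P i \<union> P (s i)" for B 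
        using PT[OF i, of B] PT[OF sI[OF i], of B] that unfolding triples_def by auto
    qed (use pc[OF i] pc[OF sI[OF i]] in \<open>auto simp: pclass_def\<close>)
    moreover have "B \<inter> ?X = B" if "B \<in> P i \<union> P (s i)" for B
      using PT[OF i, of B] PT[OF sI[OF i], of B] that unfolding triples_def by auto
    ultimately show ?thesis by metis
  qed
  then obtain col :: "nat \<Rightarrow> nat \<Rightarrow> nat" where c3: "\<And>i x. i \<in> I \<Longrightarrow> col i x < 3"
    and rb: "\<And>i B. i \<in> I \<Longrightarrow> B \<in> P i \<or> B \<in> P (s i) \<Longrightarrow> inj_on (col i) B" by (metis UnCI)
  define e where "e i u x = even_word u (col i x)" for i u x
  \<comment> \<open>Where a block of \<open>P i\<close> meets a block of \<open>P (s i)\<close>,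
    both read the same colour of the common point, and complementary signs make the symbols
    differ.\<close>
  define f where "f i u x = 1 - e i u x" for i u x
  have e1: "e i u x \<le> 1" and f1: "f i u x \<le> 1" for i u x
    unfolding e_def f_def using even_word_le by auto
  define D where "D i u = (\<lambda>B. word_on B (e i u)) ` P i" for i u
  define E where "E i u = (\<lambda>B. word_on B (f i u)) ` P (s i)" for i u
  have block: thesis if "i \<in> I" "B \<in> P i \<or> B \<in> P (s i)"
    "\<And>p q r. \<lbrakk>B = {p, q, r}; col i p = 0; col i q = Suc 0; col i r = 2; p \<noteq> q; p \<noteq> r; q \<noteq> r\<rbrakk> \<Longrightarrow> thesis"
    for i B and thesis :: bool
  proof -
    have "card B = 3" using PT[OF that(1), of B] PT[OF sI[OF that(1)], of B] that(2) unfolding triples_def by auto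
    then show ?thesis using rainbow_block[of B "col i"] rb[OF that(1,2)] c3[OF that(1)] that(3) by blast
  qed
  \<comment> \<open>A symbol is its sign plus one, so the sum of the entries is three plus the
    weight of the pattern. Its parity tells the two halves of a code apart without reference to a
    colouring, which matters because \<open>P j\<close> is coloured differently in its two
    roles.\<close>
  have parD: "odd (sum w ?X)" if h: "w \<in> D i u" "i \<in> I" "u < 4" for w i u
  proof -
    obtain B where B: "B \<in> P i" "w = word_on B (e i u)" using h unfolding D_def by blast
    show ?thesis
    proof (rule block[OF that(2), of B])
      show "B \<in> P i \<or> B \<in> P (s i)" using B by blast
      fix p q r assume *: "B = {p, q, r}" "col i p = 0" "col i q = Suc 0" "col i r = 2" "p \<noteq> q" "p \<noteq> r" "q \<noteq> r"
      have "sum w ?X = sum w B" using PT[OF that(2) B(1)] B unfolding triples_def word_on_def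
        by (intro sum.mono_neutral_right) auto
      also have "\<dots> = 3 + even_word u 0 + even_word u (Suc 0) + even_word u 2"
        using B * by (simp add: word_on_def e_def)
      finally show ?thesis using even_word_parity(1)[OF h(3)] by auto
    qed
  qed
  have parE: "even (sum w ?X)" if h: "w \<in> E i u" "i \<in> I" "u < 4" for w i u
  proof -
    obtain B where B: "B \<in> P (s i)" "w = word_on B (f i u)" using h unfolding E_def by blast
    show ?thesis
    proof (rule block[OF that(2), of B])
      show "B \<in> P i \<or> B \<in> P (s i)" using B by blast
      fix p q r assume *: "B = {p, q, r}" "col i p = 0" "col i q = Suc 0" "col i r = 2" "p \<noteq> q" "p \<noteq> r" "q \<noteq> r"
      have "sum w ?X = sum w B" using PT[OF sI[OF that(2)] B(1)] B unfolding triples_def word_on_def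
        by (intro sum.mono_neutral_right) auto
      also have "\<dots> = 3 + (1 - even_word u 0) + (1 - even_word u (Suc 0)) + (1 - even_word u 2)"
        using B * by (simp add: word_on_def e_def f_def)
      finally show ?thesis using even_word_parity(2)[OF h(3)] by auto
    qed
  qed
  have eqe: "u = v" if "i \<in> I" "B \<in> P i \<or> B \<in> P (s i)" "u < 4" "v < 4" "\<And>x. x \<in> B \<Longrightarrow> e i u x = e i v x" for i B u v
  proof (rule block[OF that(1,2)])
    fix p q r assume *: "B = {p, q, r}" "col i p = 0" "col i q = Suc 0" "col i r = 2" "p \<noteq> q" "p \<noteq> r" "q \<noteq> r"
    show "u = v" using that(5)[of p] that(5)[of q] that(5)[of r] * even_word_inj[OF that(3,4)] by (simp add: e_def)
  qed
  have ef: "f i u x \<noteq> e i u x" "e i u x \<noteq> f i u x" for i u x using e1[of i u x] unfolding f_def by arith+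
  have code: "is_code 3 N 5 3 (D i u \<union> E i u)" if i: "i \<in> I" for i u
    unfolding is_code_def
  proof (intro conjI ballI impI)
    have "N div 3 > 0" using N3 by (simp add: div_greater_zero_iff)
    then have "P i \<noteq> {}" using pc[OF i] unfolding pclass_def by auto
    then show "D i u \<union> E i u \<noteq> {}" unfolding D_def by blast
    show "D i u \<union> E i u \<subseteq> H 3 N 3"
      using word_on_H[OF PT[OF i], of _ "e i u"] word_on_H[OF PT[OF sI[OF i]], of _ "f i u"] e1 f1 unfolding D_def E_def by auto
    have dis: "B \<inter> C = {}" if "B \<in> P j" "C \<in> P j" "B \<noteq> C" "j \<in> I" for B C j
      using pc[OF that(4)] that unfolding pclass_def pairwise_def disjnt_def by blast
    fix x y assume x: "x \<in> D i u \<union> E i u" and y: "y \<in> D i u \<union> E i u" and xy: "x \<noteq> y"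
    have m: "z = z'" if "B \<in> P i" "C \<in> P (s i)" "z \<in> B \<inter> C" "z' \<in> B \<inter> C" for B C z z'
      using meet_onceD[OF mo[OF i] that(1,2)] that(3,4) by blast
    consider B C where "x = word_on B (e i u)" "y = word_on C (e i u)" "B \<in> P i" "C \<in> P i"
      | B C where "x = word_on B (f i u)" "y = word_on C (f i u)" "B \<in> P (s i)" "C \<in> P (s i)"
      | B C where "x = word_on B (e i u)" "y = word_on C (f i u)" "B \<in> P i" "C \<in> P (s i)"
      | B C where "x = word_on B (f i u)" "y = word_on C (e i u)" "B \<in> P (s i)" "C \<in> P i"
      using x y unfolding D_def E_def by blast
    then show "hamming_dist N x y \<ge> 5"
    proof cases
      case 1
      then have "B \<inter> C = {}" using dis[OF 1(3,4)] xy i by blast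
      then show ?thesis unfolding 1(1,2) using PT[OF i] 1 by (intro word_on_dist) auto
    next
      case 2
      then have "B \<inter> C = {}" using dis[OF 2(3,4)] xy sI[OF i] by blast
      then show ?thesis unfolding 2(1,2) using PT[OF sI[OF i]] 2 by (intro word_on_dist) auto
    next
      case 3
      show ?thesis unfolding 3(1,2)
        by (rule word_on_dist[OF PT[OF i 3(3)] PT[OF sI[OF i] 3(4)] m[OF 3(3,4)] ef(2)])
    next
      case 4
      show ?thesis unfolding 4(1,2)
        by (rule word_on_dist[OF PT[OF sI[OF i] 4(3)] PT[OF i 4(4)] _ ef(1)]) (use m[OF 4(4,3)] in blast)
    qed
  qed
  have cardDE: "card (D i u \<union> E i u) = 2 * (N div 3)" if i: "i \<in> I" and u: "u < 4" for i u
  proof -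
    have fin: "finite (P i)" "finite (P (s i))" using pclass_finite pc i sI by (metis finite_lessThan)+
    have "D i u \<inter> E i u = {}" using parD[OF _ i u] parE[OF _ i u] by blast
    then have "card (D i u \<union> E i u) = card (D i u) + card (E i u)"
      unfolding D_def E_def using fin by (intro card_Un_disjoint) auto
    also have "card (D i u) = card (P i)" unfolding D_def
      by (intro card_image inj_onI) (use word_on_eqD in blast)
    also have "card (E i u) = card (P (s i))" unfolding E_def
      by (intro card_image inj_onI) (use word_on_eqD in blast)
    finally show ?thesis using pc[OF i] pc[OF sI[OF i]] unfolding pclass_def by simp
  qed
  define Z where "Z = (\<lambda>(i, u). D i u \<union> E i u) ` (I \<times> {..<4})"
  have "is_TOC 3 N 5 3 Z" unfolding is_TOC_def
  proof (intro conjI ballI impI)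
    show "\<Union>Z = H 3 N 3"
    proof
      have "D i u \<union> E i u \<subseteq> H 3 N 3" if "i \<in> I" for i u using code[OF that] unfolding is_code_def by blast
      then show "\<Union>Z \<subseteq> H 3 N 3" unfolding Z_def by blast
      show "H 3 N 3 \<subseteq> \<Union>Z"
      proof
        fix w assume "w \<in> H 3 N 3"
        then obtain B g where B: "B \<in> triples ?X" and g: "\<And>x. g x \<le> 1" and w: "w = word_on B g"
          using H_word_on by blast
        obtain j where j: "j \<in> I" "B \<in> P j" using cov[OF B] by blast
        \<comment> \<open>An odd word is sought in the codes of the predecessor \<open>i\<close>, so
          its pattern is read off through \<open>col i\<close> and not through
          \<open>col j\<close>.\<close>
        have "j \<in> s ` I" using bij j unfolding bij_betw_def by simp
        then obtain i where i: "i \<in> I" "s i = j" by blast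
        have eqw: "word_on B g = word_on B h" if "\<And>x. x \<in> B \<Longrightarrow> g x = h x" for h
          using that unfolding word_on_def by auto
        show "w \<in> \<Union>Z"
        proof (cases "even (sum g B)")
          case True
          show ?thesis
          proof (rule block[OF j(1), of B])
            show "B \<in> P j \<or> B \<in> P (s j)" using j by blast
            fix p q r assume *: "B = {p, q, r}" "col j p = 0" "col j q = Suc 0" "col j r = 2" "p \<noteq> q" "p \<noteq> r" "q \<noteq> r"
            have "even (g p + g q + g r)" using True * by (simp add: add.assoc)
            then obtain u where u: "u < 4" "even_word u 0 = g p" "even_word u (Suc 0) = g q" "even_word u 2 = g r"
              using ex_even_word[OF g g g] by blast
            have "w = word_on B (e j u)" unfolding w by (rule eqw) (use * u in \<open>auto simp: e_def\<close>)
            then have "w \<in> D j u" using j unfolding D_def by blast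
            then show ?thesis using j u unfolding Z_def by blast
          qed
        next
          case False
          show ?thesis
          proof (rule block[OF i(1), of B])
            show "B \<in> P i \<or> B \<in> P (s i)" using i j by blast
            fix p q r assume *: "B = {p, q, r}" "col i p = 0" "col i q = Suc 0" "col i r = 2" "p \<noteq> q" "p \<noteq> r" "q \<noteq> r"
            have "odd (g p + g q + g r)" using False * by (simp add: add.assoc)
            then have "even ((1 - g p) + (1 - g q) + (1 - g r))" using g[of p] g[of q] g[of r] by auto
            then obtain u where u: "u < 4" "even_word u 0 = 1 - g p" "even_word u (Suc 0) = 1 - g q" "even_word u 2 = 1 - g r"
              using ex_even_word[of "1 - g p" "1 - g q" "1 - g r"] by auto
            have "w = word_on B (f i u)" unfolding w
              by (rule eqw) (use * u g[of p] g[of q] g[of r] in \<open>auto simp: e_def f_def\<close>)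
            then have "w \<in> E i u" using i j unfolding E_def by blast
            then show ?thesis using i u unfolding Z_def by blast
          qed
        qed
      qed
    qed
    fix C assume "C \<in> Z"
    then show "optimal_code 3 N 5 3 C"
      using optimal_codeI[OF code cardDE N3(2)] unfolding Z_def by auto
  next
    fix C C' assume "C \<in> Z" "C' \<in> Z" and ne: "C \<noteq> C'"
    then obtain i u j v where C: "i \<in> I" "u < 4" "C = D i u \<union> E i u" 
      and C': "j \<in> I" "v < 4" "C' = D j v \<union> E j v" unfolding Z_def by auto
    show "C \<inter> C' = {}"
    proof (rule ccontr)
      assume "C \<inter> C' \<noteq> {}"
      then obtain w where w: "w \<in> C" "w \<in> C'" by blast
      have "i = j \<and> u = v"
      proof (cases "odd (sum w ?X)")
        case True
        then have "w \<in> D i u" "w \<in> D j v" using w C C' parE by blast+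
        then obtain B B' where B: "B \<in> P i" "w = word_on B (e i u)" "B' \<in> P j" "w = word_on B' (e j v)"
          unfolding D_def by blast
        then have BB: "B = B' \<and> (\<forall>x\<in>B. e i u x = e j v x)" using word_on_eqD by metis
        then have "i = j" using uniq[of i j B] B C C' by blast
        then show ?thesis using eqe[of i B u v] B BB C C' by blast
      next
        case False
        then have "w \<in> E i u" "w \<in> E j v" using w C C' parD by blast+
        then obtain B B' where B: "B \<in> P (s i)" "w = word_on B (f i u)" "B' \<in> P (s j)" "w = word_on B' (f j v)"
          unfolding E_def by blast
        then have BB: "B = B' \<and> (\<forall>x\<in>B. f i u x = f j v x)" using word_on_eqD by metis
        then have "s i = s j" using uniq[of "s i" "s j" B] B C C' sI by blast
        then have ij: "i = j" using bij C C' unfolding bij_betw_def inj_on_def by blast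
        have "e i u x = e i v x" if "x \<in> B" for x
          using BB that ij e1[of i u x] e1[of i v x] unfolding f_def by fastforce
        then show ?thesis using eqe[of i B u v] B C C' ij by blast
      qed
      then show False using ne C C' by blast
    qed
  qed
  then show ?thesis unfolding TOC_exists_def by blast
qed

section \<open>Base classes developed under a group\<close>

fun merge :: "int list \<Rightarrow> int list \<Rightarrow> int list" where
  "merge [] ys = ys"
| "merge xs [] = xs"
| "merge (x # xs) (y # ys) = (if x \<le> y then x # merge xs (y # ys) else y # merge (x # xs) ys)"

text \<open>The two parts change places at every element, which keeps them balanced in a single
  pass.\<close>

fun halves :: "'a list \<Rightarrow> 'a list \<times> 'a list" where
  "halves [] = ([], [])"
| "halves (x # xs) = (case halves xs of (ys, zs) \<Rightarrow> (x # zs, ys))"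

lemma mset_merge: "mset (merge xs ys) = mset xs + mset ys"
  by (induction xs ys rule: merge.induct) auto

lemma mset_halves: "halves xs = (ys, zs) \<Longrightarrow> mset ys + mset zs = mset xs"
  by (induction xs arbitrary: ys zs) (auto split: prod.splits simp: add.commute)

text \<open>The first argument bounds the recursion depth.\<close>

fun msort :: "nat \<Rightarrow> int list \<Rightarrow> int list" where
  "msort 0 xs = xs"
| "msort (Suc n) [] = []"
| "msort (Suc n) [x] = [x]"
| "msort (Suc n) xs = (case halves xs of (ys, zs) \<Rightarrow> merge (msort n ys) (msort n zs))"

lemma mset_msort: "mset (msort n xs) = mset xs"
proof (induction n xs rule: msort.induct)
  case (4 n x y xs)
  obtain ys zs where h: "halves (x # y # xs) = (ys, zs)" by (cases "halves (x # y # xs)")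
  show ?case using 4(1)[OF h[symmetric]] 4(2)[OF h[symmetric]] mset_halves[OF h] by (simp add: h mset_merge del: halves.simps)
qed auto

lemma set_msort: "set (msort n xs) = set xs"
  using mset_msort[of n xs] by (metis set_mset_mset)

fun increasing :: "int list \<Rightarrow> bool" where
  "increasing (x # y # xs) \<longleftrightarrow> x < y \<and> increasing (y # xs)"
| "increasing _ \<longleftrightarrow> True"

lemma increasing_distinct: "increasing xs \<Longrightarrow> distinct xs"
proof -
  have "increasing xs \<Longrightarrow> sorted_wrt (<) xs"
  proof (induction xs rule: increasing.induct)
    case (1 x y xs)
    then show ?case by (auto intro: less_trans)
  qed auto
  then show "increasing xs \<Longrightarrow> distinct xs" using strict_sorted_iff by blast
qed

text \<open>This makes one comparison of neighbours in a sorted list certify that hundreds of coded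
  pairs are different, where \<open>distinct\<close> would compare each with all others during
  evaluation.\<close>

lemma msort_increasing_distinct: "increasing (msort n xs) \<Longrightarrow> distinct xs"
  using increasing_distinct mset_msort mset_eq_imp_distinct_iff by metis

text \<open>The successor of the class \<open>g (b k)\<close> is \<open>g (c k (b k))\<close>, so
  \<open>r k\<close> is multiplication by \<open>c k\<close> on the right. Two consecutive classes
  are then the images under one map \<open>g\<close> of \<open>b k\<close> and
  \<open>c k (b k)\<close>, and a single check for each base class serves its whole orbit.\<close>

lemma orbit_linked:
  assumes fin: "finite X" "finite K" "finite G"
    and act: "\<And>g. g \<in> G \<Longrightarrow> inj_on (act g) X" "\<And>g x. g \<in> G \<Longrightarrow> x \<in> X \<Longrightarrow> act g x \<in> X"
    and b: "\<And>k. k \<in> K \<Longrightarrow> pclass X (b k)"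
    and r: "\<And>k. k \<in> K \<Longrightarrow> inj_on (r k) G" "\<And>k g. k \<in> K \<Longrightarrow> g \<in> G \<Longrightarrow> r k g \<in> G"
    and rc: "\<And>k g x. k \<in> K \<Longrightarrow> g \<in> G \<Longrightarrow> x \<in> X \<Longrightarrow> act (r k g) x = act g (c k x)"
    and c: "\<And>k x. k \<in> K \<Longrightarrow> x \<in> X \<Longrightarrow> c k x \<in> X"
    and m: "\<And>k. k \<in> K \<Longrightarrow> meet_once (b k) ((`) (c k) ` b k)"
    and cov: "\<And>B. B \<in> T \<Longrightarrow> \<exists>k\<in>K. \<exists>g\<in>G. \<exists>C\<in>b k. B = act g ` C"
  shows "linked_family X (K \<times> G) (\<lambda>(k, g). (`) (act g) ` b k) (\<lambda>(k, g). (k, r k g)) T"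
  unfolding linked_family_def
proof (intro conjI ballI)
  show "finite (K \<times> G)" using fin by simp
  have rG: "r k ` G = G" if "k \<in> K" for k
    using endo_inj_surj[OF fin(3) _ r(1)[OF that]] r(2)[OF that] by blast
  show "bij_betw (\<lambda>(k, g). (k, r k g)) (K \<times> G) (K \<times> G)"
    unfolding bij_betw_def
  proof
    show "inj_on (\<lambda>(k, g). (k, r k g)) (K \<times> G)"
    proof (rule inj_onI, clarsimp)
      fix k g h assume "k \<in> K" "g \<in> G" "h \<in> G" "r k g = r k h"
      then show "g = h" using r(1) by (meson inj_onD)
    qed
    show "(\<lambda>(k, g). (k, r k g)) ` (K \<times> G) = K \<times> G"
    proof
      show "K \<times> G \<subseteq> (\<lambda>(k, g). (k, r k g)) ` (K \<times> G)"
      proof clarify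
        fix k g assume "k \<in> K" "g \<in> G"
        then obtain h where "h \<in> G" "g = r k h" using rG by blast
        then show "(k, g) \<in> (\<lambda>(k, g). (k, r k g)) ` (K \<times> G)" using \<open>k \<in> K\<close> by force
      qed
    qed (use r(2) in auto)
  qed
next
  fix i assume "i \<in> K \<times> G"
  then obtain k g where i: "i = (k, g)" "k \<in> K" "g \<in> G" by blast
  have aX: "act g ` X = X" using endo_inj_surj[OF fin(1) _ act(1)[OF i(3)]] act(2)[OF i(3)] by blast
  show "pclass X ((\<lambda>(k, g). (`) (act g) ` b k) i)"
    using pclass_image[OF act(1)[OF i(3)] aX fin(1) b[OF i(2)]] i by simp
  have bX: "\<Union>(b k) \<subseteq> X" using pclass_Union[OF b[OF i(2)]] .
  then have cX: "\<Union>((`) (c k) ` b k) \<subseteq> X" using c[OF i(2)] by blast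
  have "act (r k g) ` C = act g ` (c k ` C)" if "C \<in> b k" for C
    unfolding image_image using rc[OF i(2,3)] bX that by (intro image_cong) auto
  then have "(`) (act (r k g)) ` b k = (`) (act g) ` ((`) (c k) ` b k)"
    by (simp add: image_image)
  then show "meet_once ((\<lambda>(k, g). (`) (act g) ` b k) i) ((\<lambda>(k, g). (`) (act g) ` b k) ((\<lambda>(k, g). (k, r k g)) i))"
    using meet_once_image[OF act(1)[OF i(3)] bX cX m[OF i(2)]] i by simp
next
  fix B assume "B \<in> T"
  then obtain k g C where "k \<in> K" "g \<in> G" "C \<in> b k" "B = act g ` C" using cov by blast
  then show "\<exists>i\<in>K \<times> G. B \<in> (\<lambda>(k, g). (`) (act g) ` b k) i" by (intro bexI[of _ "(k, g)"]) auto
qed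

text \<open>The list is a certificate. It holds the multipliers that bring the pairs (x, y), (y, z),
  (z, x) to a representative difference, or only the first of them if the other pairs need no entry
  of their own. A block with an empty list contributes no entry.\<close>

type_synonym block = "int \<times> int \<times> int \<times> int list"

fun block_pts :: "block \<Rightarrow> int list" where
  "block_pts (x, y, z, ms) = [x, y, z]"

text \<open>Unordered pairs of points become integers, so two blocks sharing a pair show up as a
  repeated integer.\<close>

definition ecode :: "int \<Rightarrow> int \<Rightarrow> int \<Rightarrow> int" where
  "ecode n x y = (if x < y then x * n + y else y * n + x)"

fun block_edges :: "int \<Rightarrow> (int \<Rightarrow> int) \<Rightarrow> block \<Rightarrow> int list" where
  "block_edges n f (x, y, z, ms) = [ecode n (f x) (f y), ecode n (f y) (f z), ecode n (f z) (f x)]"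

fun powers :: "int \<Rightarrow> int \<Rightarrow> int \<Rightarrow> nat \<Rightarrow> int list" where
  "powers p g m 0 = []"
| "powers p g m (Suc n) = m # powers p g (m * g mod p) n"

lemma set_powers:
  assumes "x \<in> set (powers p g (g ^ i mod p) n)"
  shows "\<exists>j<n. x = g ^ (i + j) mod p"
  using assms
proof (induction n arbitrary: i)
  case (Suc n)
  have e: "g ^ i mod p * g mod p = g ^ Suc i mod p" by (simp add: mod_simps mult.commute)
  from Suc.prems consider "x = g ^ i mod p" | "x \<in> set (powers p g (g ^ Suc i mod p) n)"
    unfolding powers.simps e by auto
  then show ?case
  proof cases
    case 2
    then obtain j where "j < n" "x = g ^ (Suc i + j) mod p" using Suc.IH by blast
    then show ?thesis by (intro exI[of _ "Suc j"]) auto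
  qed (auto intro: exI[of _ 0])
qed simp

lemma set_powers1:
  assumes "x \<in> set (powers p g 1 n)" "p > 1"
  shows "\<exists>j<n. x = g ^ j mod p"
  using set_powers[of x p g 0 n] assms by simp

lemma ecode_commute: "ecode n x y = ecode n y x"
  unfolding ecode_def by auto

lemma pclass_blocks:
  fixes bl :: "block list"
  assumes fX: "finite X" and k: "3 * (card X div 3) = length (concat (map block_pts bl))"
    and sub: "set (concat (map block_pts bl)) \<subseteq> X" and dis: "distinct (concat (map block_pts bl))"
  shows "pclass X ((\<lambda>b. set (block_pts b)) ` set bl)"
proof -
  have len: "length (concat (map block_pts bl)) = 3 * length bl"
  proof -
    have "length (block_pts b) = 3" for b by (cases b) simp
    then show ?thesis by (induction bl) auto
  qed
  have "(\<lambda>b. set (block_pts b)) ` set bl = (\<lambda>j. set (block_pts (bl ! j))) ` {..<length bl}"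
    by (auto simp: set_conv_nth)
  also have "pclass X \<dots>"
  proof (rule pclass_familyI[OF fX])
    show "card {..<length bl} = card X div 3" using k len by simp
    fix j assume "j \<in> {..<length bl}"
    then have "bl ! j \<in> set bl" by simp
    then have "set (block_pts (bl ! j)) \<subseteq> X" using sub by auto
    moreover have "card (set (block_pts (bl ! j))) \<le> 3" by (cases "bl ! j") (auto simp: card_insert_if)
    ultimately show "set (block_pts (bl ! j)) \<subseteq> X \<and> card (set (block_pts (bl ! j))) \<le> 3" by simp
  next
    have "set bl = (\<lambda>j. bl ! j) ` {..<length bl}" by (auto simp: set_conv_nth)
    then have "(\<Union>j\<in>{..<length bl}. set (block_pts (bl ! j))) = set (concat (map block_pts bl))"
      by (simp add: image_image)
    then show "3 * (card X div 3) \<le> card (\<Union>j\<in>{..<length bl}. set (block_pts (bl ! j)))"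
      using k distinct_card[OF dis] by simp
  qed simp
  finally show ?thesis .
qed

text \<open>Blocks that meet in two points share a pair, and its code would occur on both sides of
  the append.\<close>

lemma meet_once_blocks:
  assumes dis: "distinct (concat (map (block_edges n (\<lambda>x. x)) bl) @ concat (map (block_edges n f) bl'))"
  shows "meet_once ((\<lambda>b. set (block_pts b)) ` set bl) ((`) f ` (\<lambda>b. set (block_pts b)) ` set bl')"
proof (rule meet_onceI, rule ccontr)
  fix B C x y
  assume B: "B \<in> (\<lambda>b. set (block_pts b)) ` set bl" and C: "C \<in> (`) f ` (\<lambda>b. set (block_pts b)) ` set bl'"
    and xy: "x \<in> B" "x \<in> C" "y \<in> B" "y \<in> C" "x \<noteq> y"
  obtain b c where b: "b \<in> set bl" "B = set (block_pts b)" and c: "c \<in> set bl'" "C = f ` set (block_pts c)"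
    using B C by blast
  have edge: "ecode n (h u) (h v) \<in> set (block_edges n h d)"
    if "u \<in> set (block_pts d)" "v \<in> set (block_pts d)" "h u \<noteq> h v" for h d u v
    using that by (cases d) (auto simp: ecode_commute)
  obtain u v where "u \<in> set (block_pts c)" "v \<in> set (block_pts c)" "x = f u" "y = f v" using xy c by auto
  then have "ecode n x y \<in> set (block_edges n f c)" using edge[of u c v f] xy by simp
  moreover have "ecode n x y \<in> set (block_edges n (\<lambda>x. x) b)" using edge[of x b y "\<lambda>x. x"] xy b by simp
  ultimately show False using dis b c by auto
qed

section \<open>Two copies of Z_p under affine maps and exchange of the copies\<close>

definition act2 :: "int \<Rightarrow> int \<Rightarrow> nat \<times> int \<times> int \<Rightarrow> int \<Rightarrow> int" where
  "act2 p g = (\<lambda>(j, t, l) x. (g ^ j * x + t) mod p + p * ((x div p + l) mod 2))"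

text \<open>Normal form of a triple with a chosen ordered pair (x, y) inside one copy: x is moved to
  0 and the difference scaled by \<open>m\<close>. The new difference, whether z lies in the other
  copy, and the new position of z are packed into one integer in base \<open>p\<close>.\<close>

definition entry2 :: "int \<Rightarrow> int \<Rightarrow> int \<Rightarrow> int \<Rightarrow> int \<Rightarrow> int" where
  "entry2 p m x y z = (2 * (m * (y - x) mod p) + (if (x < p) = (z < p) then 0 else 1)) * p + m * (z - x) mod p"

text \<open>Only one orientation of a pair can be scaled to a representative. A recorded multiplier
  \<open>-m\<close> means that the reversed pair is the one to be scaled by
  \<open>m\<close>.\<close>

definition entries2_edge :: "int \<Rightarrow> int list \<Rightarrow> int \<Rightarrow> int \<Rightarrow> int \<Rightarrow> int \<Rightarrow> int list" where
  "entries2_edge p pw x y z m = (if (x < p) = (y < p) then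
     (if m \<in> set pw then [entry2 p m x y z] else if - m \<in> set pw then [entry2 p (- m) y x z] else [])
     else [])"

fun entries2 :: "int \<Rightarrow> int list \<Rightarrow> block \<Rightarrow> int list" where
  "entries2 p pw (x, y, z, [m]) = entries2_edge p pw x y z m"
| "entries2 p pw (x, y, z, [m, m', m'']) =
     entries2_edge p pw x y z m @ entries2_edge p pw y z x m' @ entries2_edge p pw z x y m''"
| "entries2 p pw (x, y, z, _) = []"

text \<open>All normal forms over the pairs (0, d): the third point avoids 0 and \<open>d\<close> in
  the same copy and is arbitrary in the other copy. The list is produced in increasing order, ready
  for comparison with a sorted one.\<close>

definition expected2 :: "int \<Rightarrow> int list \<Rightarrow> int list" where
  "expected2 p reps = concat (map (\<lambda>d. map (\<lambda>z. 2 * d * p + z) (filter (\<lambda>z. z \<noteq> 0 \<and> z \<noteq> d) [0..p-1]) @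
     map (\<lambda>z. (2 * d + 1) * p + z) [0..p-1]) reps)"

text \<open>Asking that this list sorts to all nonzero residues forces -1 out of the powers of
  \<open>g\<close>; otherwise entries would repeat. So no map of the group reverses a pair, and
  every pair within a copy reduces to exactly one (0, d) in one of its orientations.\<close>

definition differences :: "int \<Rightarrow> int list \<Rightarrow> int list \<Rightarrow> int list" where
  "differences p pw reps = concat (map (\<lambda>d. concat (map (\<lambda>m. [m * d mod p, (- (m * d)) mod p]) pw)) reps)"

lemma entries2_sound:
  assumes "e \<in> set (entries2 p pw b)"
  obtains m x y z where "m \<in> set pw" "e = entry2 p m x y z" "set (block_pts b) = {x, y, z}" "(x < p) = (y < p)"
  using assms by (cases "(p, pw, b)" rule: entries2.cases) (auto simp: entries2_edge_def split: if_splits)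

lemma two_level:
  fixes p :: int
  assumes "p > 0" "0 \<le> a" "a < p"
  shows "(a + p * b) mod p = a" "(a + p * b) div p = b"
  using assms by auto

lemma choose_three: "6 * (n choose 3) = n * (n - 1) * (n - 2)"
proof -
  have "3 * (n choose 3) = n * ((n - 1) choose 2)" using times_binomial_minus1_eq[of 3 n] by simp
  moreover have "2 * ((n - 1) choose 2) = (n - 1) * ((n - 2) choose 1)"
    using times_binomial_minus1_eq[of 2 "n - 1"] by (simp add: numeral_2_eq_2)
  ultimately have "2 * (3 * (n choose 3)) = n * ((n - 1) * ((n - 2) choose 1))"
    by (metis mult.left_commute)
  then show ?thesis by simp
qed

text \<open>Of three points in two copies of Z_p, two lie in the same copy. Normalising this pair
  gives an entry of \<open>expected2\<close>, so by \<open>cov\<close> some base block has the same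
  normal form; undoing one normalisation after applying the other carries that block to the triple.
  Each base class leaves out the point 0. The group has 2 p r elements, and \<open>cnt\<close> makes
  the number of classes 2 p (p - 1).\<close>

theorem two_level_family:
  fixes p g :: int and r :: nat and cs :: "(block list \<times> int \<times> int) list"
  assumes p: "p > 1" "2 * p mod 3 = 1" and r: "r > 0" "g ^ r mod p = 1"
    and diff: "msort 9 (differences p (powers p g 1 r) reps) = [1..p-1]"
    and pts: "\<And>bl \<nu> l. (bl, \<nu>, l) \<in> set cs \<Longrightarrow> msort 9 (concat (map block_pts bl)) = [1..2*p-1]"
    and edges: "\<And>bl \<nu> l. (bl, \<nu>, l) \<in> set cs \<Longrightarrow>
      increasing (msort 10 (concat (map (block_edges (2*p) (\<lambda>x. x)) bl) @
        concat (map (block_edges (2*p) (act2 p g (0, \<nu>, l))) bl)))"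
    and cov: "msort 10 (concat (map (\<lambda>(bl, _). concat (map (entries2 p (powers p g 1 r)) bl)) cs)) = expected2 p reps"
    and cnt: "length cs * r = nat p - 1"
  shows "resolved (nat (2 * p))"
proof -
  let ?X = "{0..<2*p}"
  let ?pw = "powers p g 1 r"
  define K where "K = {..<length cs}"
  define G where "G = {..<r} \<times> {0..<p} \<times> {0..<2::int}"
  define b where "b k = (\<lambda>b. set (block_pts b)) ` set (fst (cs ! k))" for k
  define nu where "nu k = fst (snd (cs ! k))" for k
  define la where "la k = snd (snd (cs ! k))" for k
  \<comment> \<open>Composition with the translation of the base class on the right: g^j (x + nu) +
    t = g^j x + (t + g^j nu).\<close>
  define R where "R k = (\<lambda>(j, t, l). (j::nat, (t + g ^ j * nu k) mod p, (l + la k) mod 2))" for k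
  have csk: "(fst (cs ! k), nu k, la k) \<in> set cs" if "k \<in> K" for k
    using that unfolding nu_def la_def K_def by simp
  have cop: "coprime p (g ^ j)" for j
  proof -
    have "coprime (g ^ r) p" using coprime_mod_left_iff[of p "g ^ r"] r(2) p by simp
    then have "coprime g p" using r(1) by simp
    then show ?thesis by (simp add: coprime_commute)
  qed
  have lin: "x mod p = y mod p" if "(g ^ j * x + t) mod p = (g ^ j * y + t) mod p" for j x y t
  proof -
    have "p dvd g ^ j * (x - y)" using that by (simp add: mod_eq_dvd_iff algebra_simps)
    then have "p dvd x - y" using cop by (simp add: coprime_dvd_mult_right_iff)
    then show ?thesis by (simp add: mod_eq_dvd_iff)
  qed
  have act_mod: "act2 p g (j, t, l) x mod p = (g ^ j * x + t) mod p" 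
    and act_div: "act2 p g (j, t, l) x div p = (x div p + l) mod 2" for j t l x
    using two_level[of p "(g ^ j * x + t) mod p" "(x div p + l) mod 2"] p unfolding act2_def by auto
  have eqI: "x = y" if "x mod p = y mod p" "x div p = y div p" for x y :: int
    using that by (metis div_mult_mod_eq)
  have m2: "a mod 2 = 0 \<or> a mod 2 = 1" for a :: int by presburger
  have d2: "a = b" if "a = 0 \<or> a = 1" "b = 0 \<or> b = 1" "(a + l) mod 2 = (b + l) mod 2" for a b l :: int
    using that by presburger
  have act_X: "act2 p g h x \<in> ?X" for h x
  proof -
    obtain j t l where h: "h = (j, t, l)" by (cases h)
    have "(x div p + l) mod 2 = 0 \<or> (x div p + l) mod 2 = 1" using m2 .
    moreover have "0 \<le> (g ^ j * x + t) mod p" "(g ^ j * x + t) mod p < p" using p by auto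
    ultimately show ?thesis unfolding h act2_def by (elim disjE) auto
  qed
  have div01: "x div p = 0 \<or> x div p = 1" if "x \<in> ?X" for x
  proof -
    have "x div p = 1" if "\<not> x < p" by (rule int_div_pos_eq[of _ _ _ "x - p"]) (use \<open>x \<in> ?X\<close> that in auto)
    then show ?thesis using that by (cases "x < p") auto
  qed
  have lev: "(x < p) \<longleftrightarrow> x div p = 0" if "x \<in> ?X" for x 
    using that p by (auto simp: zdiv_eq_0_iff)
  have fam: "linked_family ?X (K \<times> G) (\<lambda>(k, h). (`) (act2 p g h) ` b k) (\<lambda>(k, h). (k, R k h)) (triples ?X)"
  proof (rule orbit_linked[where c = "\<lambda>k. act2 p g (0, nu k, la k)"])
    show "finite ?X" "finite K" "finite G" unfolding K_def G_def by auto
    show "inj_on (act2 p g h) ?X" if "h \<in> G" for h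
    proof (rule inj_onI)
      fix x y assume xy: "x \<in> ?X" "y \<in> ?X" "act2 p g h x = act2 p g h y"
      obtain j t l where h: "h = (j, t, l)" by (cases h)
      have "(g ^ j * x + t) mod p = (g ^ j * y + t) mod p" "(x div p + l) mod 2 = (y div p + l) mod 2"
        using arg_cong[OF xy(3), of "\<lambda>a. a mod p"] arg_cong[OF xy(3), of "\<lambda>a. a div p"]
        unfolding h act_mod act_div by auto
      then show "x = y" using lin[of j x t y] d2[OF div01[OF xy(1)] div01[OF xy(2)], of l] eqI by blast
    qed
    show "act2 p g h x \<in> ?X" for h x by (rule act_X)
    show "act2 p g (0, nu k, la k) x \<in> ?X" for k x by (rule act_X)
    fix k assume k: "k \<in> K"
    have ps: "mset (concat (map block_pts (fst (cs ! k)))) = mset [1..2*p-1]"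
      using pts[OF csk[OF k]] mset_msort by metis
    show "pclass ?X (b k)" unfolding b_def
    proof (rule pclass_blocks)
      have "length (concat (map block_pts (fst (cs ! k)))) = nat (2 * p - 1)"
        using arg_cong[OF ps, of size] by simp
      moreover have "nat (2 * p) mod 3 = 1" using nat_mod_distrib[of "2 * p" 3] p by simp
      then have "3 * (nat (2 * p) div 3) = nat (2 * p) - 1" using mult_div_mod_eq[of 3 "nat (2 * p)"] by linarith
      ultimately show "3 * (card ?X div 3) = length (concat (map block_pts (fst (cs ! k))))" using p by simp
      show "set (concat (map block_pts (fst (cs ! k)))) \<subseteq> ?X"
        using arg_cong[OF ps, of set_mset] by (simp only: set_mset_mset) auto
      show "distinct (concat (map block_pts (fst (cs ! k))))"
        using mset_eq_imp_distinct_iff[OF ps] by simp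
    qed simp
    show "meet_once (b k) ((`) (act2 p g (0, nu k, la k)) ` b k)" unfolding b_def
      by (rule meet_once_blocks[OF msort_increasing_distinct[OF edges[OF csk[OF k]]]])
    show "inj_on (R k) G"
    proof (rule inj_onI)
      fix h h' assume h: "h \<in> G" "h' \<in> G" "R k h = R k h'"
      obtain j t l j' t' l' where hh: "h = (j, t, l)" "h' = (j', t', l')" by (cases h, cases h') 
      have "j = j'" "(t + g ^ j * nu k) mod p = (t' + g ^ j * nu k) mod p" "(l + la k) mod 2 = (l' + la k) mod 2"
        using h(3) unfolding hh R_def by auto
      moreover have r: "0 \<le> t" "t < p" "0 \<le> t'" "t' < p" "l = 0 \<or> l = 1" "l' = 0 \<or> l' = 1"
        using h unfolding hh G_def by auto
      moreover have "t mod p = t' mod p" using calculation(2) by (simp add: mod_eq_dvd_iff)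
      moreover have "l mod 2 = l' mod 2" using calculation(3) by (simp add: mod_eq_dvd_iff)
      ultimately show "h = h'" unfolding hh by auto
    qed
    fix h assume h: "h \<in> G"
    show "R k h \<in> G" using h p unfolding R_def G_def by auto
    fix x assume x: "x \<in> ?X"
    obtain j t l where hh: "h = (j, t, l)" by (cases h)
    show "act2 p g (R k h) x = act2 p g h (act2 p g (0, nu k, la k) x)"
    proof (rule eqI)
      have "(g ^ j * act2 p g (0, nu k, la k) x + t) mod p = (g ^ j * (act2 p g (0, nu k, la k) x mod p) + t) mod p"
        by (intro mod_add_cong mod_mult_cong) simp_all
      also have "\<dots> = (g ^ j * ((x + nu k) mod p) + t) mod p" unfolding act_mod by simp
      also have "\<dots> = (g ^ j * (x + nu k) + t) mod p" by (intro mod_add_cong mod_mult_cong) simp_all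
      also have "\<dots> = (g ^ j * x + (t + g ^ j * nu k)) mod p" by (simp add: algebra_simps)
      also have "\<dots> = (g ^ j * x + (t + g ^ j * nu k) mod p) mod p" by (intro mod_add_cong) simp_all
      finally show "act2 p g (R k h) x mod p = act2 p g h (act2 p g (0, nu k, la k) x) mod p"
        unfolding hh R_def by (simp add: act_mod)
      show "act2 p g (R k h) x div p = act2 p g h (act2 p g (0, nu k, la k) x) div p"
        unfolding hh R_def by (simp add: act_div mod_simps algebra_simps)
    qed
  next
    fix B assume "B \<in> triples ?X"
    then have B3: "card B = 3" and BX: "B \<subseteq> ?X" unfolding triples_def by auto
    obtain x y z where xyz: "B = {x, y, z}" "x \<noteq> y" "x \<noteq> z" "y \<noteq> z" using B3 by (auto simp: card_3_iff)
    have inv: "g ^ (r - j) * (g ^ j * v) mod p = v mod p" if "j < r" for j v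
    proof -
      have "g ^ (r - j) * (g ^ j * v) = g ^ r * v" using that
        by (metis le_add_diff_inverse2 less_imp_le mult.assoc power_add)
      then show ?thesis using r(2) by (metis mod_mult_left_eq mult_1)
    qed
    have hit: "\<exists>k\<in>K. \<exists>h\<in>G. \<exists>C\<in>b k. {u, v, w} = act2 p g h ` C"
      if uvw: "u \<in> ?X" "v \<in> ?X" "w \<in> ?X" "u \<noteq> w" "v \<noteq> w" "u div p = v div p" 
        and m: "m \<in> set ?pw" "d \<in> set reps" "(v - u) mod p = m * d mod p" for u v w m d
    proof -
      obtain j where j: "j < r" "m = g ^ j mod p" using set_powers1[OF m(1)] p by blast
      \<comment> \<open>\<open>g ^ (r - j)\<close> inverts \<open>g ^ j\<close> modulo
        \<open>p\<close>, so this is the position of \<open>w\<close> once \<open>u\<close> is moved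
        to 0 and the difference of the pair scaled to \<open>d\<close>.\<close>
      define zz where "zz = g ^ (r - j) * (w - u) mod p"
      define lv where "lv = (if (u < p) = (w < p) then 0 else 1::int)"
      have d: "(v - u) mod p = g ^ j * d mod p" unfolding m(3) j by (rule mod_mult_cong) simp_all
      have gz: "g ^ j * zz mod p = (w - u) mod p"
      proof -
        have "g ^ j * zz mod p = g ^ j * (g ^ (r - j) * (w - u)) mod p" unfolding zz_def by (rule mod_mult_cong) simp_all
        also have "\<dots> = g ^ (r - j) * (g ^ j * (w - u)) mod p" by (simp add: mult.left_commute)
        finally show ?thesis using inv[OF j(1)] by simp
      qed
      have zr: "0 \<le> zz" "zz < p" unfolding zz_def using p by auto
      have same: False if "lv = 0" "w mod p = u mod p \<or> w mod p = v mod p"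
      proof -
        have "(u < p) = (w < p)" using that(1) unfolding lv_def by (simp split: if_splits)
        then have "u div p = w div p" using lev[OF uvw(1)] lev[OF uvw(3)] div01[OF uvw(1)] div01[OF uvw(3)] by auto
        then show False using that(2) uvw(4,5) eqI[of w u] eqI[of w v] uvw(6) by auto
      qed
      have "(2 * d + lv) * p + zz \<in> set (expected2 p reps)"
      proof (cases "lv = 0")
        case True
        have "zz \<noteq> 0"
        proof
          assume "zz = 0"
          then have "(w - u) mod p = 0" using gz by simp
          then have "w mod p = u mod p" by (simp add: mod_eq_dvd_iff mod_eq_0_iff_dvd)
          then show False using same True by blast
        qed
        moreover have "zz \<noteq> d"
        proof
          assume "zz = d"
          then have "(w - u) mod p = (v - u) mod p" using gz d by simp
          then have "w mod p = v mod p" by (simp add: mod_eq_dvd_iff)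
          then show False using same True by blast
        qed
        ultimately show ?thesis using True m(2) zr unfolding expected2_def by (auto simp: image_iff)
      next
        case False
        then have "lv = 1" unfolding lv_def by (auto split: if_splits)
        have "zz \<in> set [0..p-1]" using zr by simp
        then show ?thesis using m(2) unfolding \<open>lv = 1\<close> expected2_def set_concat set_map image_image set_append by blast
      qed
      then have "(2 * d + lv) * p + zz \<in> set (concat (map (\<lambda>(bl, _). concat (map (entries2 p ?pw) bl)) cs))"
        unfolding cov[symmetric] set_msort .
      then obtain c bk where c: "c \<in> set cs" "bk \<in> set (fst c)" "(2 * d + lv) * p + zz \<in> set (entries2 p ?pw bk)"
        by (auto simp: case_prod_unfold)
      obtain m' x y z where e: "m' \<in> set ?pw" "(2 * d + lv) * p + zz = entry2 p m' x y z"
        "set (block_pts bk) = {x, y, z}" "(x < p) = (y < p)" using entries2_sound[OF c(3)] by metis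
      obtain i where i: "i < r" "m' = g ^ i mod p" using set_powers1[OF e(1)] p by blast
      define lv' where "lv' = (if (x < p) = (z < p) then 0 else 1::int)"
      have "((2 * d + lv) * p + zz) mod p = zz" "((2 * d + lv) * p + zz) div p = 2 * d + lv"
        using zr by auto
      moreover have "entry2 p m' x y z mod p = m' * (z - x) mod p"
        "entry2 p m' x y z div p = 2 * (m' * (y - x) mod p) + lv'"
        using p unfolding entry2_def lv'_def by auto
      ultimately have dec: "zz = m' * (z - x) mod p" "2 * d + lv = 2 * (m' * (y - x) mod p) + lv'"
        using e(2) by auto
      have "lv = lv'"
      proof -
        have "lv = 0 \<or> lv = 1" "lv' = 0 \<or> lv' = 1" unfolding lv_def lv'_def by auto
        moreover have "l = l'" if "2 * a + l = 2 * c + l'" "l = 0 \<or> l = 1" "l' = 0 \<or> l' = 1" for a c l l' :: int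
          using that by presburger
        ultimately show ?thesis using dec(2) by blast
      qed
      from this have dd: "d = m' * (y - x) mod p" using dec(2) by simp
      obtain k where k: "k \<in> K" "c = cs ! k" using c(1) unfolding K_def by (metis in_set_conv_nth lessThan_iff)
      have "set (concat (map block_pts (fst c))) = set [1..2*p-1]"
        unfolding k(2) pts[OF csk[OF k(1)], symmetric] set_msort ..
      moreover have "set [1..2*p-1] \<subseteq> ?X" by auto
      ultimately have "set (concat (map block_pts (fst c))) \<subseteq> ?X" by (simp only:)
      then have "set (block_pts bk) \<subseteq> ?X" using c(2) unfolding set_concat set_map by blast
      then have xX: "x \<in> ?X" "y \<in> ?X" "z \<in> ?X" unfolding e(3) by auto
      \<comment> \<open>Multiplication by g^i takes the base block to its normal form and g^j takes
        the normal form to the given triple; \<open>t\<close> and \<open>l\<close> then move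
        \<open>x\<close> to \<open>u\<close>.\<close>
      define J where "J = (i + j) mod r"
      define t where "t = (u - g ^ J * x) mod p"
      define l where "l = (u div p + x div p) mod 2"
      have gr: "g ^ (r * n) mod p = 1" for n
      proof (induction n)
        case (Suc n)
        have "g ^ (r * Suc n) mod p = (g ^ r mod p) * (g ^ (r * n) mod p) mod p"
          by (simp add: power_add mod_mult_eq)
        then show ?case using Suc r(2) p by simp
      qed (use p in simp)
      have gJ: "g ^ J * a mod p = g ^ j * (m' * a mod p) mod p" for a
      proof -
        have "g ^ (i + j) = g ^ (r * ((i + j) div r)) * g ^ J" unfolding J_def 
          by (metis mult_div_mod_eq power_add)
        then have "g ^ (i + j) * a mod p = ((g ^ (r * ((i + j) div r)) mod p) * (g ^ J * a)) mod p"
          by (simp add: mod_mult_left_eq mult.assoc)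
        then have "g ^ (i + j) * a mod p = g ^ J * a mod p" unfolding gr by simp
        moreover have "g ^ j * (m' * a mod p) mod p = g ^ (i + j) * a mod p"
        proof -
          have "g ^ j * (m' * a mod p) mod p = g ^ j * (m' * a) mod p" by (rule mod_mult_cong) simp_all
          also have "\<dots> = (g ^ i mod p) * (g ^ j * a) mod p" unfolding i(2) by (simp add: mult.left_commute)
          also have "\<dots> = g ^ i * (g ^ j * a) mod p" by (rule mod_mult_cong) simp_all
          finally show ?thesis by (simp add: power_add mult.assoc)
        qed
        ultimately show ?thesis by simp
      qed
      have hG: "(J, t, l) \<in> G" unfolding G_def J_def t_def l_def using r p by auto
      have act_a: "act2 p g (J, t, l) a mod p = (u + g ^ J * (a - x)) mod p" for a
      proof -
        have "(g ^ J * a + t) mod p = (g ^ J * a + (u - g ^ J * x)) mod p" unfolding t_def by (rule mod_add_cong) simp_all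
        then show ?thesis unfolding act_mod by (simp add: algebra_simps)
      qed
      have act_x: "act2 p g (J, t, l) x = u"
      proof (rule eqI)
        show "act2 p g (J, t, l) x mod p = u mod p" unfolding act_a by simp
        show "act2 p g (J, t, l) x div p = u div p" unfolding act_div l_def
          using div01[OF uvw(1)] div01[OF xX(1)] by auto
      qed
      have act_y: "act2 p g (J, t, l) y = v"
      proof (rule eqI)
        have "g ^ J * (y - x) mod p = (v - u) mod p" unfolding gJ dd[symmetric] d ..
        then have "(u + g ^ J * (y - x)) mod p = (u + (v - u)) mod p" by (rule mod_add_cong[OF refl])
        then show "act2 p g (J, t, l) y mod p = v mod p" unfolding act_a by simp
        have "y div p = x div p" using e(4) lev[OF xX(1)] lev[OF xX(2)] div01[OF xX(1)] div01[OF xX(2)] by auto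
        then show "act2 p g (J, t, l) y div p = v div p" unfolding act_div l_def
          using div01[OF uvw(1)] div01[OF xX(1)] uvw(6) by auto
      qed
      have act_z: "act2 p g (J, t, l) z = w"
      proof (rule eqI)
        have "g ^ J * (z - x) mod p = (w - u) mod p" unfolding gJ dec(1)[symmetric] gz ..
        then have "(u + g ^ J * (z - x)) mod p = (u + (w - u)) mod p" by (rule mod_add_cong[OF refl])
        then show "act2 p g (J, t, l) z mod p = w mod p" unfolding act_a by simp
        have "(x < p) = (z < p) \<longleftrightarrow> (u < p) = (w < p)" using \<open>lv = lv'\<close> unfolding lv_def lv'_def 
          by (simp split: if_splits)
        then have "(x div p = z div p) \<longleftrightarrow> (u div p = w div p)"
          using lev[OF xX(1)] lev[OF xX(3)] lev[OF uvw(1)] lev[OF uvw(3)]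
            div01[OF xX(1)] div01[OF xX(3)] div01[OF uvw(1)] div01[OF uvw(3)] by auto
        then show "act2 p g (J, t, l) z div p = w div p" unfolding act_div l_def
          using div01[OF uvw(1)] div01[OF uvw(3)] div01[OF xX(1)] div01[OF xX(3)] by auto
      qed
      have "{u, v, w} = act2 p g (J, t, l) ` set (block_pts bk)" unfolding e(3) using act_x act_y act_z by simp
      moreover have "set (block_pts bk) \<in> b k" unfolding b_def using c k by blast
      ultimately show ?thesis using k(1) hG by blast
    qed
    have "\<exists>u v w. B = {u, v, w} \<and> u \<noteq> v \<and> u \<noteq> w \<and> v \<noteq> w \<and> u div p = v div p"
    proof -
      have "x \<in> ?X" "y \<in> ?X" "z \<in> ?X" using BX xyz by auto
      then have "x div p = y div p \<or> y div p = z div p \<or> x div p = z div p"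
        using div01[of x] div01[of y] div01[of z] by auto
      then show ?thesis using xyz by (metis insert_commute)
    qed
    then obtain u v w where uvw: "B = {u, v, w}" "u \<noteq> v" "u \<noteq> w" "v \<noteq> w" "u div p = v div p" by blast
    have "u mod p \<noteq> v mod p" using uvw eqI by blast
    then have "(v - u) mod p \<noteq> 0" by (metis dvd_eq_mod_eq_0 mod_eq_dvd_iff)
    moreover have "0 \<le> (v - u) mod p" "(v - u) mod p < p" using p by auto
    ultimately have "(v - u) mod p \<in> set [1..p-1]" by simp
    then have "(v - u) mod p \<in> set (differences p ?pw reps)" unfolding diff[symmetric] set_msort .
    then obtain m d where md: "m \<in> set ?pw" "d \<in> set reps"
      "(v - u) mod p = m * d mod p \<or> (v - u) mod p = (- (m * d)) mod p" unfolding differences_def by auto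
    have uX: "u \<in> ?X" "v \<in> ?X" "w \<in> ?X" using BX uvw by auto
    from md(3) show "\<exists>k\<in>K. \<exists>h\<in>G. \<exists>C\<in>b k. B = act2 p g h ` C"
    proof
      assume "(v - u) mod p = m * d mod p"
      then show ?thesis unfolding uvw(1) using hit[OF uX uvw(3,4,5) md(1,2)] by blast
    next
      assume "(v - u) mod p = (- (m * d)) mod p"
      then have "(- (v - u)) mod p = (- (- (m * d))) mod p" by (rule mod_minus_cong)
      then have "(u - v) mod p = m * d mod p" by simp
      then have "\<exists>k\<in>K. \<exists>h\<in>G. \<exists>C\<in>b k. {v, u, w} = act2 p g h ` C"
        using hit[OF uX(2,1,3) uvw(4,3) uvw(5)[symmetric] md(1,2)] by blast
      then show ?thesis unfolding uvw(1) by (simp add: insert_commute)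
    qed
  qed
  define P q where "P = nat p" and "q = nat (2 * p) div 3"
  have N: "nat (2 * p) = 2 * P" using p by (simp add: P_def nat_mult_distrib)
  have "nat (2 * p) mod 3 = 1" using nat_mod_distrib[of "2 * p" 3] p by simp
  then have q: "2 * P = 3 * q + 1" unfolding q_def N by presburger
  have P1: "P \<ge> 1" using p unfolding P_def by simp
  have "card (K \<times> G) = (P - 1) * (P * 2)" unfolding K_def G_def using cnt by (simp add: card_cartesian_product P_def)
  moreover have "(P - 1) * (P * 2) * q = 2 * P choose 3"
  proof -
    have "6 * (2 * P choose 3) = 2 * P * (3 * q) * (2 * (P - 1))" 
      unfolding choose_three using q P1 by (simp add: diff_mult_distrib2)
    then show ?thesis by (simp add: mult.commute mult.left_commute)
  qed
  ultimately have "card (K \<times> G) * (nat (2 * p) div 3) = nat (2 * p) choose 3" unfolding q_def N by simp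
  then show ?thesis using linkedI[OF fam refl] by (intro resolvedI[of ?X]) auto
qed

text \<open>Form suited to evaluation: the power list is computed once, its last entry replaces the
  test \<open>g ^ r mod p = 1\<close>, and the map leading to the successor is \<open>act2\<close>
  without its power of \<open>g\<close>.\<close>

definition two_level_check ::
    "int \<Rightarrow> int \<Rightarrow> nat \<Rightarrow> int list \<Rightarrow> (block list \<times> int \<times> int) list \<Rightarrow> bool" where
  "two_level_check p g r reps cs \<longleftrightarrow> p > 1 \<and> 2 * p mod 3 = 1 \<and> r > 0 \<and>
     (let pw = powers p g 1 r in last pw * g mod p = 1 \<and>
       msort 9 (differences p pw reps) = [1..p-1] \<and>
       msort 10 (concat (map (\<lambda>(bl, _). concat (map (entries2 p pw) bl)) cs)) = expected2 p reps) \<and>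
     list_all (\<lambda>(bl, \<nu>, l). msort 9 (concat (map block_pts bl)) = [1..2*p-1] \<and>
       increasing (msort 10 (concat (map (block_edges (2*p) (\<lambda>x. x)) bl) @
         concat (map (block_edges (2*p) (\<lambda>x. (x + \<nu>) mod p + p * ((x div p + l) mod 2))) bl)))) cs \<and>
     int (length cs) * int r = p - 1"

lemma last_powers:
  "n > 0 \<Longrightarrow> last (powers p g (g ^ i mod p) n) = g ^ (i + n - 1) mod p"
proof (induction n arbitrary: i)
  case (Suc n)
  have e: "g ^ i mod p * g mod p = g ^ Suc i mod p" by (simp add: mod_simps mult.commute)
  show ?case
  proof (cases n)
    case (Suc k)
    then have "powers p g (g ^ Suc i mod p) n \<noteq> []" by simp
    then show ?thesis using Suc.IH[of "Suc i"] Suc unfolding powers.simps e by simp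
  qed simp
qed simp

lemma two_level_family_check:
  assumes "two_level_check p g r reps cs"
  shows "resolved (nat (2 * p))"
proof (rule two_level_family)
  note c = assms[unfolded two_level_check_def Let_def]
  show p: "p > 1" and "2 * p mod 3 = 1" and r: "r > 0" using c by auto
  have "last (powers p g 1 r) = g ^ (r - 1) mod p" using last_powers[OF r, of p g 0] p by simp
  then have "g ^ (r - 1) * g mod p = 1" using c by (metis mod_mult_left_eq)
  moreover have "g ^ (r - 1) * g = g ^ r" using r by (metis power_minus_mult)
  ultimately show "g ^ r mod p = 1" by simp
  show "msort 9 (differences p (powers p g 1 r) reps) = [1..p-1]" using c by blast
  show "msort 10 (concat (map (\<lambda>(bl, _). concat (map (entries2 p (powers p g 1 r)) bl)) cs)) = expected2 p reps"
    using c by blast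
  have "int (length cs * r) = int (nat p - 1)" using c p by simp
  then show "length cs * r = nat p - 1" by linarith
  fix bl \<nu> l assume "(bl, \<nu>, l) \<in> set cs"
  then have *: "msort 9 (concat (map block_pts bl)) = [1..2*p-1] \<and>
       increasing (msort 10 (concat (map (block_edges (2*p) (\<lambda>x. x)) bl) @
         concat (map (block_edges (2*p) (\<lambda>x. (x + \<nu>) mod p + p * ((x div p + l) mod 2))) bl)))"
    using c unfolding list_all_iff by blast
  then show "msort 9 (concat (map block_pts bl)) = [1..2*p-1]" by blast
  have "act2 p g (0, \<nu>, l) = (\<lambda>x. (x + \<nu>) mod p + p * ((x div p + l) mod 2))" unfolding act2_def by auto
  then show "increasing (msort 10 (concat (map (block_edges (2*p) (\<lambda>x. x)) bl) @
        concat (map (block_edges (2*p) (act2 p g (0, \<nu>, l))) bl)))" using * by simp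
qed

section \<open>Base classes on 2 p points for p = 5, 11, 17, 23, 29, 47, 59, 131\<close>

definition classes_10 :: "(block list \<times> int \<times> int) list" where
  "classes_10 =
    [([(3, 1, 6, [-1]), (7, 8, 9, [1, 1, -1]), (2, 4, 5, [1])], 2, 0), ([(7, 9, 3, [1]),
    (8, 5, 2, [1]), (1, 4, 6, [-1])], 2, 0), ([(2, 1, 5, [-1]), (6, 7, 4, [1]), (9, 8, 3, [-1])],
    1, 0), ([(1, 2, 7, [1]), (3, 4, 5, [1]), (6, 8, 9, [1, 1, 1])], 1, 0)]"

lemma resolved_10: "resolved 10"
proof -
  have "resolved (nat (2 * 5))"
  proof (rule two_level_family_check)
    show "two_level_check 5 1 1 [1, 2] classes_10" by code_simp
  qed
  then show ?thesis by simp
qed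

text \<open>Each base class comes with the translation and the exchange of copies that lead to its
  successor. The powers of 3 modulo 11 form the subgroup of order five, so (11 - 1) / 5 = 2 base
  classes suffice.\<close>

definition classes_22 :: "(block list \<times> int \<times> int) list" where
  "classes_22 =
    [([(21, 17, 9, [-3]), (20, 15, 11, [-9, -3, 5]), (6, 2, 14, [-3]), (1, 7, 16, [-9]),
    (3, 5, 18, [-5]), (12, 19, 10, [-3]), (8, 4, 13, [-3])], 1, 0), ([(11, 18, 6, [-3]),
    (17, 21, 3, [3]), (13, 14, 9, [1]), (20, 12, 15, [4, 4, 9]), (10, 5, 16, [-9]),
    (8, 7, 19, [-1]), (4, 1, 2, [-4, 1, -5])], 2, 0)]"

lemma resolved_22: "resolved 22"
proof -
  have "resolved (nat (2 * 11))"
  proof (rule two_level_family_check)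
    show "two_level_check 11 3 5 [1] classes_22" by code_simp
  qed
  then show ?thesis by simp
qed

text \<open>Since 16 is a power of two, the only multiplier group of odd order is trivial. All
  sixteen base classes and one representative of each of the eight differences up to sign have to be
  listed.\<close>

definition classes_34 :: "(block list \<times> int \<times> int) list" where
  "classes_34 =
    [([(3, 4, 22, [1]), (31, 29, 11, [-1]), (7, 13, 32, [1]), (20, 24, 2, [1]),
    (25, 28, 17, [1, 1, 1]), (23, 27, 15, [1]), (6, 14, 30, [1]), (21, 26, 9, [1]),
    (16, 8, 12, [-1, 1, 1]), (10, 1, 33, [1]), (18, 19, 5, [1])], 1, 0), ([(7, 11, 16, [1, 1, 1]),
    (15, 14, 19, [-1]), (21, 26, 1, [1]), (28, 24, 12, [-1]), (31, 25, 8, [-1]),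
    (22, 29, 20, [1, 1, 1]), (3, 9, 18, [1]), (27, 33, 5, [1]), (6, 10, 17, [1]),
    (30, 32, 13, [1]), (4, 2, 23, [-1])], 3, 0), ([(10, 7, 33, [-1]), (6, 14, 31, [1]),
    (1, 5, 30, [1]), (3, 11, 32, [1]), (8, 12, 26, [1]), (9, 15, 19, [1]), (13, 2, 29, [1]),
    (28, 21, 16, [-1]), (18, 22, 25, [1, 1, -1]), (20, 27, 4, [1]), (23, 24, 17, [1, -1, 1])],
    5, 0), ([(14, 3, 25, [1]), (15, 1, 13, [1, -1, 1]), (24, 17, 30, [-1, -1, -1]),
    (21, 23, 27, [1, 1, -1]), (32, 22, 6, [1]), (8, 10, 31, [1]), (26, 18, 11, [-1]),
    (28, 29, 9, [1]), (7, 16, 4, [-1, 1, 1]), (12, 5, 20, [-1]), (19, 33, 2, [-1])], 1, 0),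
    ([(16, 8, 23, [-1]), (25, 24, 20, [-1, -1, 1]), (30, 22, 10, [-1]), (32, 27, 2, [-1]),
    (26, 29, 7, [1]), (28, 21, 9, [-1]), (5, 4, 18, [-1]), (19, 33, 3, [-1]), (13, 1, 17, [1]),
    (15, 6, 31, [1]), (12, 11, 14, [-1, 1, -1])], 0, 1), ([(27, 29, 4, [1]), (18, 24, 5, [1]),
    (2, 12, 28, [-1]), (22, 26, 7, [1]), (11, 14, 25, [1]), (3, 1, 15, [-1, -1, 1]),
    (33, 21, 16, [1]), (19, 20, 10, [1]), (8, 9, 32, [1]), (30, 31, 6, [1]), (23, 17, 13, [-1])],
    7, 0), ([(24, 20, 23, [-1, 1, 1]), (32, 30, 10, [-1]), (27, 18, 14, [1]), (17, 21, 4, [1]),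
    (5, 7, 31, [1]), (19, 28, 12, [-1]), (15, 3, 25, [1]), (33, 22, 8, [1]),
    (11, 2, 1, [1, -1, -1]), (26, 29, 9, [1]), (13, 16, 6, [1, 1, 1])], 2, 0),
    ([(12, 16, 11, [1, -1, 1]), (23, 32, 28, [-1, -1, -1]), (14, 8, 3, [-1, -1, -1]),
    (4, 6, 31, [1]), (15, 5, 17, [1]), (24, 26, 10, [1]), (13, 2, 1, [1, -1, -1]),
    (19, 27, 33, [1, 1, 1]), (30, 20, 29, [1, -1, 1]), (21, 18, 9, [-1]), (22, 25, 7, [1])],
    0, 1), ([(23, 32, 12, [-1]), (2, 13, 14, [-1, 1, 1]), (33, 26, 9, [-1]),
    (18, 28, 20, [-1, -1, -1]), (3, 5, 27, [1]), (6, 16, 30, [-1]), (10, 7, 25, [-1]),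
    (17, 29, 22, [-1, -1, -1]), (4, 8, 19, [1]), (1, 11, 31, [-1]), (21, 24, 15, [1])], 7, 0),
    ([(28, 17, 16, [1]), (10, 14, 24, [1]), (5, 11, 23, [1]), (12, 15, 25, [1]), (26, 31, 3, [1]),
    (19, 21, 30, [1, -1, 1]), (18, 29, 32, [-1, 1, 1]), (1, 6, 20, [1]), (7, 9, 8, [1, -1, -1]),
    (2, 4, 27, [1]), (22, 33, 13, [-1])], 1, 1), ([(11, 5, 28, [-1]), (31, 21, 3, [1]),
    (30, 29, 12, [-1]), (26, 33, 1, [1]), (2, 4, 24, [1]), (23, 27, 25, [1, -1, -1]),
    (9, 16, 20, [1]), (17, 19, 13, [1]), (22, 18, 8, [-1]), (15, 10, 7, [-1, -1, 1]),
    (14, 6, 32, [-1])], 4, 0), ([(33, 30, 6, [-1]), (15, 11, 17, [-1]), (16, 3, 19, [1]),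
    (18, 25, 5, [1]), (26, 22, 28, [-1, 1, -1]), (20, 31, 4, [-1]), (8, 13, 24, [1]),
    (23, 21, 2, [-1]), (9, 10, 32, [1]), (27, 29, 12, [1]), (14, 7, 1, [-1, -1, -1])], 3, 1),
    ([(11, 15, 21, [1]), (12, 16, 9, [1, -1, 1]), (6, 13, 30, [1]), (20, 23, 22, [1, -1, -1]),
    (19, 17, 1, [-1]), (3, 4, 31, [1]), (14, 10, 18, [-1]), (8, 5, 28, [-1]), (29, 32, 7, [1]),
    (33, 27, 26, [-1, -1, 1]), (24, 25, 2, [1])], 6, 0), ([(14, 5, 33, [1]), (31, 19, 12, [1]),
    (6, 15, 26, [-1]), (13, 7, 27, [-1]), (28, 18, 4, [1]), (25, 17, 3, [-1]),
    (1, 9, 10, [1, 1, 1]), (30, 24, 22, [-1, -1, 1]), (23, 29, 8, [1]), (20, 32, 11, [-1]),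
    (16, 2, 21, [1])], 6, 0), ([(24, 33, 12, [-1]), (3, 4, 21, [1]), (19, 29, 8, [-1]),
    (7, 2, 25, [-1]), (32, 20, 5, [1]), (17, 30, 13, [-1]), (6, 11, 26, [1]), (15, 16, 18, [1]),
    (9, 14, 27, [1]), (22, 23, 1, [1]), (31, 28, 10, [-1])], 1, 1), ([(16, 14, 26, [-1]),
    (28, 31, 1, [1]), (29, 24, 2, [-1]), (32, 27, 25, [-1, -1, 1]), (6, 7, 22, [1]),
    (15, 3, 5, [1, 1, -1]), (18, 23, 9, [1]), (11, 10, 19, [-1]), (8, 12, 21, [1]),
    (4, 13, 30, [-1]), (17, 33, 20, [-1, 1, -1])], 1, 1)]"

lemma resolved_34: "resolved 34"
proof -
  have "resolved (nat (2 * 17))"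
  proof (rule two_level_family_check)
    show "two_level_check 17 1 1 [1, 2, 3, 4, 5, 6, 7, 8] classes_34" by code_simp
  qed
  then show ?thesis by simp
qed

definition classes_46 :: "(block list \<times> int \<times> int) list" where
  "classes_46 =
    [([(3, 9, 42, [4]), (10, 2, 19, [-3, -4, -18]), (43, 44, 6, [1]), (21, 22, 33, [1]),
    (26, 34, 28, [3, -4, -12]), (29, 41, 13, [2]), (7, 17, 32, [-16]), (20, 5, 30, [3]),
    (38, 40, 18, [12]), (11, 15, 31, [6]), (45, 25, 8, [8]), (12, 16, 35, [6]),
    (24, 39, 14, [-3]), (23, 37, 4, [-18]), (27, 36, 1, [18])], 3, 1), ([(35, 23, 21, [-2]),
    (15, 9, 37, [-4]), (36, 25, 2, [2]), (43, 30, 12, [-16]), (26, 38, 14, [2]), (5, 13, 41, [3]),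
    (32, 42, 27, [-16, 3, -9]), (31, 39, 45, [3, 4, 18]), (22, 7, 24, [3]),
    (33, 28, 34, [9, 4, -1]), (16, 11, 29, [9]), (18, 4, 44, [18]), (6, 8, 10, [12, 12, -6]),
    (1, 3, 17, [12, -18, -13]), (19, 20, 40, [1])], 8, 0)]"

lemma resolved_46: "resolved 46"
proof -
  have "resolved (nat (2 * 23))"
  proof (rule two_level_family_check)
    show "two_level_check 23 2 11 [1] classes_46" by code_simp
  qed
  then show ?thesis by simp
qed

definition classes_58 :: "(block list \<times> int \<times> int) list" where
  "classes_58 =
    [([(29, 31, 26, [1]), (57, 47, 15, [23]), (23, 1, 8, [25, 25, -25]), (10, 20, 34, [-23]),
    (3, 13, 17, [-23, -7, -25]), (6, 14, 25, [-7, 16, -23]), (28, 9, 39, [-23]),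
    (46, 54, 5, [-7]), (24, 7, 33, [-24]), (40, 36, 2, [7]), (51, 43, 53, [7, -23, -1]),
    (12, 27, 56, [-25]), (38, 32, 4, [24]), (41, 45, 55, [-7, -23, -25]),
    (35, 50, 49, [-25, -1, -25]), (44, 42, 21, [-1]), (48, 37, 16, [-16]),
    (19, 11, 18, [7, 25, 1]), (30, 52, 22, [-25])], 5, 1), ([(53, 55, 33, [1, 25, 16]),
    (24, 19, 3, [23, -20, 7]), (46, 57, 14, [16]), (10, 9, 26, [-1, 24, -20]),
    (30, 50, 43, [16, -25, 20]), (6, 25, 42, [23]), (49, 38, 23, [-16]), (37, 44, 27, [25]),
    (56, 45, 15, [-16]), (20, 16, 47, [7]), (34, 39, 2, [-23]), (5, 4, 36, [-1]),
    (1, 7, 35, [-24]), (40, 54, 28, [25]), (11, 12, 32, [1]), (8, 21, 41, [-20]),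
    (31, 48, 52, [24, -7, -7]), (22, 18, 29, [7]), (17, 13, 51, [7])], 4, 0), ([(40, 41, 13, [1]),
    (43, 55, 51, [-24, 7, 7]), (20, 9, 47, [-16]), (19, 15, 45, [7]), (6, 12, 14, [-24, 1, 7]),
    (29, 44, 1, [-25]), (17, 28, 57, [16]), (3, 23, 38, [16]), (5, 11, 48, [-24]),
    (46, 56, 24, [-23]), (39, 32, 25, [-25]), (31, 35, 2, [-7]), (50, 34, 10, [-20]),
    (21, 8, 16, [20, -7, -23]), (37, 36, 42, [-1, -24, 23]), (18, 4, 53, [-25]),
    (30, 54, 7, [23]), (27, 26, 33, [-1]), (49, 52, 22, [20])], 5, 1), ([(57, 56, 24, [-1]),
    (27, 8, 43, [-23]), (34, 54, 23, [16]), (21, 7, 41, [-25]), (42, 52, 18, [-23]),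
    (22, 6, 35, [-20]), (4, 26, 38, [-25]), (30, 32, 25, [1]), (44, 36, 20, [7]),
    (1, 13, 45, [-24]), (29, 53, 51, [23, -1, 25]), (10, 16, 31, [-24]), (50, 46, 11, [7]),
    (12, 15, 47, [20]), (48, 40, 9, [7]), (33, 49, 28, [20]), (14, 17, 37, [20]),
    (39, 55, 2, [20]), (3, 5, 19, [1, 25, -20])], 12, 0)]"

lemma resolved_58: "resolved 58"
proof -
  have "resolved (nat (2 * 29))"
  proof (rule two_level_family_check)
    show "two_level_check 29 7 7 [1, 2] classes_58" by code_simp
  qed
  then show ?thesis by simp
qed

definition classes_94 :: "(block list \<times> int \<times> int) list" where
  "classes_94 =
    [([(40, 28, 60, [-4]), (59, 51, 31, [-6]), (11, 1, 81, [14]), (63, 66, 5, [16]),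
    (37, 15, 56, [32]), (17, 23, 33, [8, -14, -3]), (10, 32, 30, [-32, -24, 7]),
    (77, 83, 18, [8]), (48, 89, 16, [-8]), (78, 72, 50, [-8, 32, 42]), (45, 19, 49, [9]),
    (91, 79, 29, [-4]), (75, 62, 68, [18, 8, 27]), (25, 7, 86, [-34]), (88, 76, 53, [-4, 2, -4]),
    (70, 65, 13, [28]), (71, 84, 21, [-18]), (6, 22, 93, [3]), (54, 90, 64, [17, 9, 14]),
    (12, 26, 92, [37]), (47, 69, 52, [-32, -36, 28]), (24, 35, 58, [-17]), (43, 44, 80, [1]),
    (41, 9, 61, [-25]), (38, 34, 14, [-12, 7, 2]), (2, 27, 74, [32]), (67, 73, 46, [8]),
    (36, 4, 85, [-25]), (8, 42, 82, [18]), (39, 3, 57, [-17]), (55, 87, 20, [25])], 2, 0),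
    ([(18, 22, 12, [12, 14, 8]), (27, 10, 54, [-36]), (53, 73, 1, [-7]), (59, 67, 42, [6]),
    (38, 4, 69, [-18]), (60, 72, 49, [4, 2, -17]), (45, 2, 74, [12]), (84, 55, 28, [34]),
    (13, 31, 6, [34, -32, 27]), (63, 52, 8, [17]), (26, 44, 47, [34]), (64, 93, 62, [-34, 3, 24]),
    (33, 41, 57, [6]), (9, 25, 58, [3]), (40, 30, 71, [14]), (78, 48, 37, [36]),
    (81, 70, 11, [17]), (32, 5, 82, [-7]), (66, 61, 15, [28]), (36, 20, 75, [-3]),
    (68, 77, 79, [21, 24, 17]), (3, 21, 50, [34]), (80, 90, 39, [-14]), (43, 23, 76, [7]),
    (16, 46, 86, [-36]), (88, 83, 51, [28, -25, 14]), (65, 56, 34, [-21]), (85, 87, 19, [24]),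
    (24, 17, 89, [-27]), (14, 29, 35, [-25, 8, -9]), (91, 92, 7, [1])], 2, 1)]"

lemma resolved_94: "resolved 94"
proof -
  have "resolved (nat (2 * 47))"
  proof (rule two_level_family_check)
    show "two_level_check 47 2 23 [1] classes_94" by code_simp
  qed
  then show ?thesis by simp
qed

definition classes_118 :: "(block list \<times> int \<times> int) list" where
  "classes_118 =
    [([(117, 91, 3, [-25]), (79, 104, 50, [26]), (75, 111, 21, [41]), (93, 73, 33, [-3]),
    (62, 61, 115, [-1, -12, -49]), (5, 36, 68, [-19]), (99, 100, 7, [1]),
    (34, 38, 37, [15, -1, -20]), (11, 28, 47, [7, 28, -41]), (15, 56, 1, [36, 15, -21]),
    (89, 66, 76, [41, -53, -9]), (40, 54, 29, [-21, -26, -16]), (116, 86, 112, [57, 25, 15]),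
    (42, 58, 113, [48]), (94, 90, 52, [-15]), (10, 39, 80, [57]), (82, 77, 20, [-12]),
    (23, 25, 6, [-29, -28, 7]), (95, 60, 64, [-27, 15, -19]), (81, 83, 13, [-29]),
    (44, 49, 46, [12, -20, 29]), (53, 22, 96, [19]), (17, 4, 65, [9]), (43, 45, 69, [-29]),
    (92, 59, 31, [25]), (24, 8, 72, [-48]), (102, 97, 9, [-12]), (108, 98, 16, [53]),
    (19, 51, 110, [-35]), (26, 57, 2, [-19, 15, -27]), (35, 27, 114, [22]),
    (105, 107, 109, [-29, -29, -15]), (88, 78, 30, [53]), (32, 12, 101, [-3]), (41, 18, 63, [41]),
    (67, 87, 55, [3]), (74, 103, 48, [57]), (106, 70, 14, [-41]), (71, 85, 84, [-21, -1, 9])],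
    8, 0), ([(18, 22, 116, [15]), (107, 102, 54, [-12]), (1, 14, 65, [-9]), (42, 12, 114, [57]),
    (69, 72, 39, [20]), (100, 59, 37, [-36]), (38, 45, 19, [17, -25, 28]), (53, 31, 97, [-51]),
    (28, 49, 108, [45]), (13, 6, 103, [-17]), (63, 64, 95, [1, -19, 35]), (73, 61, 16, [-5]),
    (106, 104, 62, [29, 7, -4]), (47, 32, 93, [-4]), (68, 112, 33, [-4]), (101, 89, 55, [-5]),
    (60, 76, 58, [48]), (40, 10, 70, [57]), (111, 110, 24, [-1]), (81, 74, 79, [-17, 12, -29]),
    (5, 56, 98, [22]), (96, 78, 43, [36]), (2, 30, 117, [19]), (3, 26, 92, [-41]),
    (91, 66, 25, [-26]), (21, 44, 94, [-41]), (71, 87, 27, [48]), (115, 88, 15, [-35]),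
    (99, 105, 7, [-49]), (8, 4, 52, [-15, 16, 4]), (20, 50, 67, [-57]), (23, 36, 77, [-9]),
    (86, 113, 46, [35]), (83, 80, 51, [-20]), (17, 35, 85, [-36]), (75, 82, 57, [17]),
    (41, 29, 9, [-5, -3, -35]), (11, 48, 109, [-51]), (84, 90, 34, [-49])], 3, 0)]"

lemma resolved_118: "resolved 118"
proof -
  have "resolved (nat (2 * 59))"
  proof (rule two_level_family_check)
    show "two_level_check 59 3 29 [1] classes_118" by code_simp
  qed
  then show ?thesis by simp
qed

text \<open>The largest odd divisor of 130 is 65. With multipliers of that order two base classes
  represent all 2 * 131 * 130 classes.\<close>

definition classes_262 :: "(block list \<times> int \<times> int) list" where
  "classes_262 =
    [([(74, 101, 90, [34, -12, -41]), (148, 257, 119, [125]), (232, 255, 39, [-74]),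
    (62, 84, 144, [-125]), (213, 167, 73, [-94]), (37, 43, 166, [-109]),
    (222, 169, 208, [-89, 84, -28]), (16, 5, 194, [-12]), (158, 182, 8, [-60]),
    (135, 175, 131, [-36, -3, 33]), (88, 36, 223, [-63]), (235, 145, 192, [16, -39, 64]),
    (231, 147, 20, [-39]), (18, 111, 9, [-100, -9, 102]), (116, 14, 179, [-9]),
    (215, 209, 81, [109]), (19, 22, 260, [44]), (55, 93, 247, [100]),
    (203, 237, 220, [27, 77, 77]), (106, 6, 170, [-38]), (72, 129, 171, [-108]),
    (69, 86, 250, [-77]), (102, 122, 207, [59]), (120, 41, 202, [63]), (140, 184, 64, [3]),
    (201, 245, 117, [3]), (168, 195, 226, [34, -38, -61]), (198, 165, 7, [-4]),
    (241, 218, 108, [74]), (200, 161, 44, [-84]), (244, 251, 115, [75]),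
    (193, 216, 177, [-74, -84, 41]), (66, 82, 261, [41]), (67, 78, 238, [12]),
    (83, 50, 63, [-4, 121, 59]), (133, 246, 180, [80, 129, 39]), (61, 49, 153, [-11]),
    (112, 15, 214, [27]), (221, 234, 172, [121, -112, 123]), (29, 125, 239, [-15]),
    (92, 11, 176, [-55]), (181, 224, 126, [64]), (249, 173, 141, [81, 45, 74]),
    (146, 136, 159, [13, -74, -121]), (164, 163, 34, [-1]), (155, 186, 47, [-38]),
    (183, 189, 114, [-109]), (87, 38, 227, [-123]), (17, 28, 230, [12]), (13, 30, 256, [-77]),
    (254, 217, 51, [46]), (54, 48, 138, [109]), (150, 210, 107, [107]), (40, 99, 1, [20, 4, 84]),
    (258, 233, 76, [-21]), (188, 204, 190, [41, 28, 65]), (212, 197, 42, [-35]),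
    (160, 143, 130, [77]), (85, 24, 96, [-58, -20, -12]), (68, 60, 156, [49]),
    (97, 52, 33, [-99, 62, 43]), (21, 109, 206, [-64]), (35, 100, 132, [129]),
    (32, 23, 149, [-102]), (58, 105, 174, [-39]), (236, 199, 10, [46]),
    (243, 137, 211, [21, 108, -45]), (103, 91, 134, [-11]), (77, 2, 94, [-7, -84, 77]),
    (154, 252, 12, [-4]), (80, 3, 253, [-114]), (70, 124, 45, [-114, 63, 21]),
    (123, 65, 240, [-61]), (46, 95, 4, [123, -36, -53]), (157, 185, 89, [117]),
    (71, 25, 178, [-94]), (219, 191, 110, [-117]), (53, 104, 229, [-113]),
    (205, 225, 151, [59, -108, -114]), (79, 75, 98, [-33, -74, 62]), (118, 127, 139, [102]),
    (128, 57, 56, [107, -1, -20]), (187, 152, 113, [-15]), (162, 196, 59, [27]),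
    (26, 121, 259, [-91]), (31, 27, 142, [-33]), (228, 242, 248, [-28, -109, -59])], 1, 0),
    ([(153, 146, 120, [-75]), (157, 156, 110, [-1]), (234, 176, 33, [-61]), (166, 165, 50, [-1]),
    (142, 144, 13, [-65]), (19, 23, 233, [33]), (91, 41, 172, [55]),
    (251, 248, 220, [-44, -117, -38]), (44, 128, 195, [39]), (14, 69, 228, [81]),
    (236, 161, 94, [-7]), (256, 249, 194, [-75, -81, 112]), (7, 58, 149, [-113]),
    (5, 88, 134, [-101]), (26, 20, 230, [109]), (214, 257, 105, [64]), (143, 202, 4, [20]),
    (40, 1, 39, [-84, 100, 1]), (86, 82, 188, [-33]), (45, 84, 115, [84, -38, 58]),
    (97, 18, 187, [63]), (163, 229, 9, [-129]), (239, 216, 159, [74, 108, 113]),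
    (200, 183, 16, [77]), (96, 127, 167, [-38]), (215, 137, 31, [89]), (42, 85, 222, [64]),
    (261, 206, 121, [-81]), (122, 30, 182, [84]), (164, 190, 63, [-5]), (255, 253, 6, [65]),
    (113, 108, 25, [-105, 101, -64]), (140, 135, 76, [-105]), (227, 177, 118, [55]),
    (29, 65, 235, [91]), (250, 217, 112, [-4]), (192, 173, 141, [62, 45, -113]),
    (242, 199, 17, [-64]), (201, 203, 36, [-65]), (51, 24, 64, [-34, -36, -121]),
    (151, 189, 61, [100]), (106, 98, 186, [49]), (211, 178, 54, [-4]),
    (158, 218, 154, [107, -43, 33]), (179, 241, 27, [112]), (125, 72, 67, [-89, -105, 61]),
    (60, 101, 258, [16]), (109, 52, 237, [108]), (90, 78, 160, [-11]),
    (196, 180, 240, [-41, 107, -3]), (129, 99, 259, [48]), (232, 184, 80, [-101]),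
    (71, 59, 123, [-11, 43, -63]), (73, 56, 138, [77]), (126, 81, 175, [-99]),
    (46, 107, 254, [58]), (57, 37, 247, [-59]), (225, 208, 245, [77, -46, -59]),
    (168, 155, 92, [-121]), (169, 243, 102, [108]), (114, 53, 204, [-58]), (49, 95, 207, [94]),
    (22, 74, 132, [63]), (2, 12, 246, [-13]), (103, 11, 170, [84]), (212, 226, 124, [-28]),
    (62, 3, 213, [-20]), (197, 224, 260, [34, 91, -52]), (47, 87, 205, [-36]),
    (32, 77, 152, [99]), (181, 145, 55, [-91]), (133, 139, 83, [-109]), (93, 68, 162, [-21]),
    (100, 117, 136, [-77]), (111, 66, 198, [-99]), (219, 221, 48, [-65]), (223, 244, 70, [25]),
    (231, 191, 209, [36, -80, -125]), (43, 79, 147, [91]), (130, 89, 185, [-16]),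
    (10, 119, 34, [125, 94, 60]), (28, 38, 193, [-13]), (104, 116, 148, [11]),
    (35, 8, 15, [-34, 75, 59]), (171, 252, 150, [55, -9, 25]), (210, 174, 75, [-91]),
    (238, 131, 21, [-60])], 1, 1)]"

lemma resolved_262: "resolved 262"
proof -
  have "resolved (nat (2 * 131))"
  proof (rule two_level_family_check)
    show "two_level_check 131 3 65 [1] classes_262" by code_simp
  qed
  then show ?thesis by simp
qed

section \<open>Z_q with two fixed points\<close>

definition act1 :: "int \<Rightarrow> int \<Rightarrow> nat \<times> int \<Rightarrow> int \<Rightarrow> int" where
  "act1 q g = (\<lambda>(j, t) x. if x < q then (g ^ j * x + t) mod q else x)"

text \<open>As for two copies, with the chosen pair inside Z_q. If the third point is one of the
  fixed points \<open>q\<close>, \<open>q + 1\<close>, it is recorded as 0 or 1 over an odd multiple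
  of \<open>q\<close>.\<close>

definition entry1 :: "int \<Rightarrow> int \<Rightarrow> int \<Rightarrow> int \<Rightarrow> int \<Rightarrow> int" where
  "entry1 q m x y z = (if z < q then 2 * (m * (y - x) mod q) * q + m * (z - x) mod q
     else (2 * (m * (y - x) mod q) + 1) * q + (z - q))"

definition entries1_edge :: "int \<Rightarrow> int list \<Rightarrow> int \<Rightarrow> int \<Rightarrow> int \<Rightarrow> int \<Rightarrow> int list" where
  "entries1_edge q pw x y z m = (if x < q \<and> y < q then
     (if m \<in> set pw then [entry1 q m x y z] else if - m \<in> set pw then [entry1 q (- m) y x z] else [])
     else [])"

fun entries1 :: "int \<Rightarrow> int list \<Rightarrow> block \<Rightarrow> int list" where
  "entries1 q pw (x, y, z, [m]) = entries1_edge q pw x y z m"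
| "entries1 q pw (x, y, z, [m, m', m'']) =
     entries1_edge q pw x y z m @ entries1_edge q pw y z x m' @ entries1_edge q pw z x y m''"
| "entries1 q pw (x, y, z, _) = []"

definition expected1 :: "int \<Rightarrow> int list \<Rightarrow> int list" where
  "expected1 q reps = concat (map (\<lambda>d. map (\<lambda>z. 2 * d * q + z) (filter (\<lambda>z. z \<noteq> 0 \<and> z \<noteq> d) [0..q-1]) @
     [(2 * d + 1) * q, (2 * d + 1) * q + 1]) reps)"

lemma entries1_sound:
  assumes "e \<in> set (entries1 q pw b)"
  obtains m x y z where "m \<in> set pw" "e = entry1 q m x y z" "set (block_pts b) = {x, y, z}" "x < q" "y < q"
  using assms by (cases "(q, pw, b)" rule: entries1.cases) (auto simp: entries1_edge_def split: if_splits)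

text \<open>A triple with both fixed points is fixed by multiplications about its third point, and a
  triple {u, omega u, omega^2 u} with omega a cube root of unity is fixed by omega. Such triples
  cannot lie in a class with a full orbit. The class \<open>P0\<close> is meant for them: it is
  invariant under multiplication by \<open>g\<close>, so it has only \<open>q\<close> images. The
  tests on \<open>hd cs\<close> allow it to stand between the first base class and its
  successor.\<close>

definition one_level_check ::
    "int \<Rightarrow> int \<Rightarrow> nat \<Rightarrow> int list \<Rightarrow> block list \<Rightarrow> (block list \<times> int) list \<Rightarrow> bool" where
  "one_level_check q g r reps P0 cs \<longleftrightarrow> q > 1 \<and> q mod 3 = 1 \<and> r > 0 \<and> cs \<noteq> [] \<and>
     (let pw = powers q g 1 r in last pw * g mod q = 1 \<and>
       msort 9 (differences q pw reps) = [1..q-1] \<and>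
       msort 10 (concat (map (entries1 q pw) P0) @
         concat (map (\<lambda>(bl, _). concat (map (entries1 q pw) bl)) cs)) = expected1 q reps) \<and>
     list_all (\<lambda>(bl, \<nu>). msort 9 (concat (map block_pts bl)) = [0..q+1] \<and>
       increasing (msort 10 (concat (map (block_edges (q+2) (\<lambda>x. x)) bl) @
         concat (map (block_edges (q+2) (\<lambda>x. if x < q then (x + \<nu>) mod q else x)) bl)))) cs \<and>
     msort 9 (concat (map block_pts P0)) = [0..q+1] \<and> (0, q, q + 1, []) \<in> set P0 \<and>
     list_all (\<lambda>(x, y, z, _). list_ex (\<lambda>(x', y', z', _). list_all (\<lambda>u. 
        let v = (if u < q then g * u mod q else u) in v = x' \<or> v = y' \<or> v = z') [x, y, z]) P0) P0 \<and>
     (case hd cs of (bl, \<nu>) \<Rightarrow> 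
       increasing (msort 10 (concat (map (block_edges (q+2) (\<lambda>x. x)) P0) @
         concat (map (block_edges (q+2) (\<lambda>x. x)) bl))) \<and>
       increasing (msort 10 (concat (map (block_edges (q+2) (\<lambda>x. x)) P0) @
         concat (map (block_edges (q+2) (\<lambda>x. if x < q then (x + \<nu>) mod q else x)) bl)))) \<and>
     int (length cs) * int r * 2 = q - 1"

text \<open>A triple other than {w, q, q + 1} has two points in Z_q, and normalising this pair works
  as in \<open>two_level_family\<close>. The triples {w, q, q + 1} are the translates of one block
  of \<open>P0\<close>. The base classes give q (q - 1) / 2 classes and the translates of
  \<open>P0\<close> another \<open>q\<close>, in all q (q + 1) / 2.\<close>

lemma one_level_family:
  assumes chk: "one_level_check q g r reps P0 cs"
  shows "resolved (nat (q + 2))"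
proof -
  note c = chk[unfolded one_level_check_def Let_def]
  let ?X = "{0..<q+2}"
  let ?pw = "powers q g 1 r"
  let ?bs = "\<lambda>bl. (\<lambda>b. set (block_pts b)) ` set bl"
  have q: "q > 1" "q mod 3 = 1" and r: "r > 0" and ne: "cs \<noteq> []" using c by auto
  have diff: "msort 9 (differences q ?pw reps) = [1..q-1]"
    and cov: "msort 10 (concat (map (entries1 q ?pw) P0) @
         concat (map (\<lambda>(bl, _). concat (map (entries1 q ?pw) bl)) cs)) = expected1 q reps"
    and pts0: "msort 9 (concat (map block_pts P0)) = [0..q+1]" 
    and inf0: "(0, q, q + 1, []) \<in> set P0"
    using c by blast+
  have gr1: "g ^ r mod q = 1"
  proof -
    have "last ?pw = g ^ (r - 1) mod q" using last_powers[OF r, of q g 0] q by simp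
    then have "g ^ (r - 1) * g mod q = 1" using c by (metis mod_mult_left_eq)
    moreover have "g ^ (r - 1) * g = g ^ r" using r by (metis power_minus_mult)
    ultimately show ?thesis by simp
  qed
  define K where "K = {..<length cs}"
  define G where "G = {..<r} \<times> {0..<q}"
  define b where "b k = ?bs (fst (cs ! k))" for k
  define nu where "nu k = snd (cs ! k)" for k
  define R where "R k = (\<lambda>(j, t). (j::nat, (t + g ^ j * nu k) mod q))" for k
  have csk: "(fst (cs ! k), nu k) \<in> set cs" if "k \<in> K" for k
    using that unfolding nu_def K_def by simp
  have sh: "act1 q g (0, t) = (\<lambda>x. if x < q then (x + t) mod q else x)" for t unfolding act1_def by auto
  have pts: "msort 9 (concat (map block_pts (fst (cs ! k)))) = [0..q+1]"
    and edges: "increasing (msort 10 (concat (map (block_edges (q+2) (\<lambda>x. x)) (fst (cs ! k))) @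
         concat (map (block_edges (q+2) (act1 q g (0, nu k))) (fst (cs ! k)))))" if "k \<in> K" for k
    using c csk[OF that] unfolding list_all_iff sh by blast+
  have k0: "0 \<in> K" using ne unfolding K_def by auto
  have hd0: "hd cs = (fst (cs ! 0), nu 0)" using ne unfolding nu_def by (simp add: hd_conv_nth)
  have e0: "increasing (msort 10 (concat (map (block_edges (q+2) (\<lambda>x. x)) P0) @
         concat (map (block_edges (q+2) (\<lambda>x. x)) (fst (cs ! 0)))))"
    and e1: "increasing (msort 10 (concat (map (block_edges (q+2) (\<lambda>x. x)) P0) @
         concat (map (block_edges (q+2) (act1 q g (0, nu 0))) (fst (cs ! 0)))))"
    using c unfolding hd0 sh by simp_all
  have cop: "coprime q (g ^ j)" for j
  proof -
    have "coprime (g ^ r) q" using coprime_mod_left_iff[of q "g ^ r"] gr1 q by simp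
    then have "coprime g q" using r by simp
    then show ?thesis by (simp add: coprime_commute)
  qed
  have lin: "x mod q = y mod q" if "(g ^ j * x + t) mod q = (g ^ j * y + t) mod q" for j x y t
  proof -
    have "q dvd g ^ j * (x - y)" using that by (simp add: mod_eq_dvd_iff algebra_simps)
    then have "q dvd x - y" using cop by (simp add: coprime_dvd_mult_right_iff)
    then show ?thesis by (simp add: mod_eq_dvd_iff)
  qed
  have act_fin: "act1 q g (j, t) x = (g ^ j * x + t) mod q" "act1 q g (j, t) x < q" if "x < q" for j t x
    using that q unfolding act1_def by auto
  have act_act: "act1 q g (j, t) (act1 q g (j', t') x) = (g ^ j * ((g ^ j' * x + t') mod q) + t) mod q"
    if "x < q" for j t j' t' x
    using that q unfolding act1_def by simp
  have act_inf: "act1 q g h x = x" if "\<not> x < q" for h x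
    using that unfolding act1_def by (auto simp: case_prod_unfold)
  have act_X: "act1 q g h x \<in> ?X" if "x \<in> ?X" for h x
  proof (cases "x < q")
    case True
    obtain j t where h: "h = (j, t)" by (cases h)
    have "0 \<le> (g ^ j * x + t) mod q" "(g ^ j * x + t) mod q < q" using q by auto
    then show ?thesis unfolding h act_fin(1)[OF True] by auto
  qed (use that act_inf in auto)
  have act_inj: "inj_on (act1 q g h) ?X" for h
  proof (rule inj_onI)
    fix x y assume xy: "x \<in> ?X" "y \<in> ?X" "act1 q g h x = act1 q g h y"
    obtain j t where h: "h = (j, t)" by (cases h)
    show "x = y"
    proof (cases "x < q"; cases "y < q")
      assume a: "x < q" "y < q"
      then have "x mod q = y mod q" using xy(3) lin[of j x t y] unfolding h act_fin(1)[OF a(1)] act_fin(1)[OF a(2)] by blast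
      then show ?thesis using a xy by simp
    next
      assume a: "x < q" "\<not> y < q"
      then show ?thesis using xy(3) act_fin(2)[OF a(1), of j t] act_inf[OF a(2), of h] unfolding h by simp
    next
      assume a: "\<not> x < q" "y < q"
      then show ?thesis using xy(3) act_fin(2)[OF a(2), of j t] act_inf[OF a(1), of h] unfolding h by simp
    next
      assume a: "\<not> x < q" "\<not> y < q"
      then show ?thesis using xy(3) act_inf[of x h] act_inf[of y h] by simp
    qed
  qed
  have n3: "nat (q + 2) mod 3 = 0"
  proof -
    have "(q + 2) mod 3 = 0" using q(2) by presburger
    then show ?thesis using nat_mod_distrib[of "q + 2" 3] q by simp
  qed
  have pc: "pclass ?X (?bs bl)" and bsub: "set (concat (map block_pts bl)) \<subseteq> ?X"
    if bl: "msort 9 (concat (map block_pts bl)) = [0..q+1]" for bl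
  proof -
    have ps: "mset (concat (map block_pts bl)) = mset [0..q+1]" unfolding bl[symmetric] mset_msort ..
    have "set (concat (map block_pts bl)) = set [0..q+1]" unfolding bl[symmetric] set_msort ..
    moreover have "set [0..q+1] \<subseteq> ?X" by auto
    ultimately show sub: "set (concat (map block_pts bl)) \<subseteq> ?X" by (simp only:)
    show "pclass ?X (?bs bl)"
    proof (rule pclass_blocks[OF _ _ sub])
      have "length (concat (map block_pts bl)) = nat (q + 2)" using arg_cong[OF ps, of size] by simp
      moreover have "3 * (nat (q + 2) div 3) = nat (q + 2)" using n3 by auto
      ultimately show "3 * (card ?X div 3) = length (concat (map block_pts bl))" by simp
      show "distinct (concat (map block_pts bl))" using mset_eq_imp_distinct_iff[OF ps] by simp
    qed simp
  qed
  define T1 where "T1 = {B. \<exists>k\<in>K. \<exists>h\<in>G. \<exists>C\<in>b k. B = act1 q g h ` C}"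
  have fam: "linked_family ?X (K \<times> G) (\<lambda>(k, h). (`) (act1 q g h) ` b k) (\<lambda>(k, h). (k, R k h)) T1"
  proof (rule orbit_linked[where c = "\<lambda>k. act1 q g (0, nu k)"])
    show "finite ?X" "finite K" "finite G" unfolding K_def G_def by auto
    show "inj_on (act1 q g h) ?X" for h by (rule act_inj)
    show "act1 q g h x \<in> ?X" if "x \<in> ?X" for h x by (rule act_X[OF that])
    show "act1 q g (0, nu k) x \<in> ?X" if "x \<in> ?X" for k x by (rule act_X[OF that])
    fix k assume k: "k \<in> K"
    show "pclass ?X (b k)" unfolding b_def by (rule pc[OF pts[OF k]])
    show "meet_once (b k) ((`) (act1 q g (0, nu k)) ` b k)" unfolding b_def
      by (rule meet_once_blocks[OF msort_increasing_distinct[OF edges[OF k]]])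
    show "inj_on (R k) G"
    proof (rule inj_onI)
      fix h h' assume h: "h \<in> G" "h' \<in> G" "R k h = R k h'"
      obtain j t j' t' where hh: "h = (j, t)" "h' = (j', t')" by (cases h, cases h') 
      have a: "j = j'" "(t + g ^ j * nu k) mod q = (t' + g ^ j * nu k) mod q"
        using h(3) unfolding hh R_def by auto
      moreover have "0 \<le> t" "t < q" "0 \<le> t'" "t' < q" using h unfolding hh G_def by auto
      moreover have "t mod q = t' mod q" using a(2) by (simp add: mod_eq_dvd_iff)
      ultimately show "h = h'" unfolding hh by auto
    qed
    fix h assume h: "h \<in> G"
    show "R k h \<in> G" using h q unfolding R_def G_def by auto
    fix x assume x: "x \<in> ?X"
    obtain j t where hh: "h = (j, t)" by (cases h)
    show "act1 q g (R k h) x = act1 q g h (act1 q g (0, nu k) x)"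
    proof (cases "x < q")
      case True
      have "act1 q g h (act1 q g (0, nu k) x) = (g ^ j * ((x + nu k) mod q) + t) mod q"
        unfolding hh act_act[OF True] by simp
      also have "\<dots> = (g ^ j * (x + nu k) + t) mod q" by (intro mod_add_cong mod_mult_cong) simp_all
      also have "\<dots> = (g ^ j * x + (t + g ^ j * nu k)) mod q" by (simp add: algebra_simps)
      also have "\<dots> = (g ^ j * x + (t + g ^ j * nu k) mod q) mod q" by (intro mod_add_cong) simp_all
      finally show ?thesis unfolding hh R_def by (simp add: act_fin(1)[OF True])
    qed (simp add: act_inf)
  qed (unfold T1_def, blast)
  \<comment> \<open>Multiplications permute the blocks of \<open>P0\<close>, so its images are
    indexed by the translation alone.\<close>
  define Q where "Q t = (`) (act1 q g (0, t)) ` ?bs P0" for t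
  have P0X: "\<Union>(?bs P0) \<subseteq> ?X" using pclass_Union[OF pc[OF pts0]] .
  have b0X: "\<Union>(b 0) \<subseteq> ?X" unfolding b_def using pclass_Union[OF pc[OF pts[OF k0]]] .
  have fixset: "(`) (\<lambda>x::int. x) ` S = S" for S by auto
  have mm0: "meet_once (?bs P0) (b 0)"
    using meet_once_blocks[OF msort_increasing_distinct[OF e0]] unfolding b_def fixset .
  have mm1: "meet_once (?bs P0) ((`) (act1 q g (0, nu 0)) ` b 0)"
    using meet_once_blocks[OF msort_increasing_distinct[OF e1]] unfolding b_def .
  have "linked ?X (card (K \<times> G) + card {0..<q}) (T1 \<union> (\<Union>t\<in>{0..<q}. Q t))"
  \<comment> \<open>The translate of \<open>P0\<close> by \<open>t\<close> is placed after the
    translate by \<open>t\<close> of the first base class. Both meeting conditions are then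
    translates of the ones checked for \<open>t = 0\<close>.\<close>
  proof (rule linked_insert[OF fam, where h = "\<lambda>t. (0, 0, t)"])
    show "finite {0..<q}" by simp
    show "inj_on (\<lambda>t. (0, 0, t)) {0..<q}" by (simp add: inj_on_def)
    show "(\<lambda>t. (0, 0, t)) ` {0..<q} \<subseteq> K \<times> G" using k0 r unfolding G_def by auto
    fix t assume t: "t \<in> {0..<q}"
    show "pclass ?X (Q t)" unfolding Q_def
    proof (rule pclass_image[OF act_inj _ _ pc[OF pts0]])
      have "act1 q g (0, t) ` ?X \<subseteq> ?X" using act_X by blast
      then show "act1 q g (0, t) ` ?X = ?X" by (rule endo_inj_surj[OF _ _ act_inj, rotated]) simp
    qed simp
    show "meet_once ((\<lambda>(k, h). (`) (act1 q g h) ` b k) (0, 0, t)) (Q t)"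
      unfolding Q_def using meet_once_sym[OF meet_once_image[OF act_inj P0X b0X mm0]] by simp
    have "\<Union>((`) (act1 q g (0, nu 0)) ` b 0) \<subseteq> ?X" using b0X act_X by blast
    then have m: "meet_once (Q t) ((`) (act1 q g (0, t)) ` (`) (act1 q g (0, nu 0)) ` b 0)"
      unfolding Q_def using meet_once_image[OF act_inj P0X _ mm1] by blast
    have "act1 q g (0, (t + nu 0) mod q) x = act1 q g (0, t) (act1 q g (0, nu 0) x)" for x
    proof (cases "x < q")
      case True
      have "act1 q g (0, t) (act1 q g (0, nu 0) x) = ((x + nu 0) mod q + t) mod q"
        unfolding act_act[OF True] by simp
      also have "\<dots> = (x + (t + nu 0) mod q) mod q" by (simp add: mod_simps algebra_simps)
      finally show ?thesis by (simp add: act_fin(1)[OF True])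
    qed (simp add: act_inf)
    then have "(`) (act1 q g (R 0 (0, t))) ` b 0 = (`) (act1 q g (0, t)) ` (`) (act1 q g (0, nu 0)) ` b 0"
      unfolding R_def by (simp add: image_image)
    then show "meet_once (Q t) ((\<lambda>(k, h). (`) (act1 q g h) ` b k) ((\<lambda>(k, h). (k, R k h)) (0, 0, t)))"
      using m by simp
  qed
  moreover have "triples ?X \<subseteq> T1 \<union> (\<Union>t\<in>{0..<q}. Q t)"
  proof
    fix B assume "B \<in> triples ?X"
    then have B3: "card B = 3" and BX: "B \<subseteq> ?X" unfolding triples_def by auto
    have P0card: "card C = 3" if "C \<in> ?bs P0" for C using pc[OF pts0] that unfolding pclass_def triples_def by blast
    have P0fin: "finite C" if "C \<in> ?bs P0" for C using P0card[OF that] by (metis card.infinite zero_neq_numeral)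
    have P0g: "act1 q g (1, 0) ` C \<in> ?bs P0" if C: "C \<in> ?bs P0" for C
    proof -
      obtain bk where bk: "bk \<in> set P0" "C = set (block_pts bk)" using C by blast
      obtain x y z ms where e: "bk = (x, y, z, ms)" by (cases bk)
      have f: "act1 q g (1, 0) u = (if u < q then g * u mod q else u)" for u unfolding act1_def by simp
      have "list_ex (\<lambda>(x', y', z', _). list_all (\<lambda>u. (if u < q then g * u mod q else u) = x' \<or>
          (if u < q then g * u mod q else u) = y' \<or> (if u < q then g * u mod q else u) = z') [x, y, z]) P0"
        using c bk(1) unfolding e list_all_iff by fast
      then obtain bk' where bk': "bk' \<in> set P0" "case bk' of (x', y', z', _) \<Rightarrow>
          list_all (\<lambda>u. act1 q g (1, 0) u = x' \<or> act1 q g (1, 0) u = y' \<or> act1 q g (1, 0) u = z') [x, y, z]"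
        unfolding f[symmetric] list_ex_iff by blast
      obtain x' y' z' ms' where e': "bk' = (x', y', z', ms')" by (cases bk')
      have sub: "act1 q g (1, 0) ` C \<subseteq> set (block_pts bk')" using bk'(2) unfolding e' bk(2) e by simp
      have "card (act1 q g (1, 0) ` C) = 3" using P0card[OF C] card_image[of "act1 q g (1, 0)" C]
          inj_on_subset[OF act_inj] P0X C by (metis Sup_upper subset_trans)
      then have "act1 q g (1, 0) ` C = set (block_pts bk')" 
        using sub bk'(1) P0card[of "set (block_pts bk')"] by (intro card_subset_eq) auto
      then show ?thesis using bk'(1) by blast
    qed
    have P0j: "act1 q g (j, 0) ` C \<in> ?bs P0" if C: "C \<in> ?bs P0" for C j
    proof (induction j)
      case 0
      have "act1 q g (0, 0) ` C = (\<lambda>x. x) ` C" using P0X C q by (intro image_cong refl) (auto simp: act1_def)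
      then show ?case using C by simp
    next
      case (Suc j)
      have "act1 q g (Suc j, 0) x = act1 q g (1, 0) (act1 q g (j, 0) x)" for x
      proof (cases "x < q")
        case True
        show ?thesis unfolding act_act[OF True] unfolding act_fin(1)[OF True]
          by (simp add: mod_mult_right_eq mult.assoc)
      qed (simp add: act_inf)
      then have "act1 q g (Suc j, 0) ` C = act1 q g (1, 0) ` act1 q g (j, 0) ` C" by (simp add: image_image)
      then show ?case using P0g[OF Suc] by simp
    qed
    have P0jt: "act1 q g (j, t) ` C \<in> Q t" if C: "C \<in> ?bs P0" for C j t
    proof -
      have "act1 q g (j, t) x = act1 q g (0, t) (act1 q g (j, 0) x)" for x
      proof (cases "x < q")
        case True
        show ?thesis unfolding act_act[OF True] unfolding act_fin(1)[OF True]
          by (simp add: mod_add_left_eq)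
      qed (simp add: act_inf)
      then have eq: "act1 q g (j, t) ` C = act1 q g (0, t) ` act1 q g (j, 0) ` C"
        unfolding image_image by (intro image_cong refl)
      show ?thesis unfolding Q_def eq by (rule imageI[OF P0j[OF C]])
    qed
    have inv: "g ^ (r - j) * (g ^ j * v) mod q = v mod q" if "j < r" for j v
    proof -
      have "g ^ (r - j) * (g ^ j * v) = g ^ r * v" using that
        by (metis le_add_diff_inverse2 less_imp_le mult.assoc power_add)
      then show ?thesis using gr1 by (metis mod_mult_left_eq mult_1)
    qed
    have hit: "{u, v, w} \<in> T1 \<union> (\<Union>t\<in>{0..<q}. Q t)"
      if uvw: "u \<in> ?X" "v \<in> ?X" "w \<in> ?X" "u \<noteq> w" "v \<noteq> w" "u < q" "v < q"
        and m: "m \<in> set ?pw" "d \<in> set reps" "(v - u) mod q = m * d mod q" for u v w m d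
    proof -
      obtain j where j: "j < r" "m = g ^ j mod q" using set_powers1[OF m(1)] q by blast
      define zz where "zz = (if w < q then g ^ (r - j) * (w - u) mod q else w - q)"
      define lv where "lv = (if w < q then 0 else 1::int)"
      have d: "(v - u) mod q = g ^ j * d mod q" unfolding m(3) j by (rule mod_mult_cong) simp_all
      have gz: "g ^ j * zz mod q = (w - u) mod q" if "w < q"
      proof -
        have "g ^ j * zz mod q = g ^ j * (g ^ (r - j) * (w - u)) mod q" unfolding zz_def using that 
          by (simp add: mod_mult_right_eq)
        also have "\<dots> = g ^ (r - j) * (g ^ j * (w - u)) mod q" by (simp add: mult.left_commute)
        finally show ?thesis using inv[OF j(1)] by simp
      qed
      have zr: "0 \<le> zz" "zz < q" unfolding zz_def using q uvw by auto
      have "(2 * d + lv) * q + zz \<in> set (expected1 q reps)"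
      proof (cases "w < q")
        case True
        have z0: "zz \<noteq> 0"
        proof
          assume "zz = 0"
          then have "(w - u) mod q = 0" using gz[OF True] by simp
          then have "w mod q = u mod q" by (simp add: mod_eq_dvd_iff mod_eq_0_iff_dvd)
          then show False using uvw True by simp
        qed
        have zd: "zz \<noteq> d"
        proof
          assume "zz = d"
          then have "(w - u) mod q = (v - u) mod q" using gz[OF True] d by simp
          then have "w mod q = v mod q" by (simp add: mod_eq_dvd_iff)
          then show False using uvw True by simp
        qed
        have "zz \<in> set (filter (\<lambda>z. z \<noteq> 0 \<and> z \<noteq> d) [0..q-1])" using zr z0 zd by simp
        moreover have "lv = 0" unfolding lv_def using True by simp
        ultimately show ?thesis 
          using m(2) unfolding \<open>lv = 0\<close> add_0_right expected1_def set_concat set_map image_image set_append by blast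
      next
        case False
        then have "lv = 1" "w = q \<or> w = q + 1" using uvw unfolding lv_def by auto
        then have "zz = 0 \<or> zz = 1" unfolding zz_def by auto
        then have "(2 * d + lv) * q + zz \<in> set [(2 * d + 1) * q, (2 * d + 1) * q + 1]" 
          unfolding \<open>lv = 1\<close> by auto
        then show ?thesis 
          using m(2) unfolding expected1_def set_concat set_map image_image set_append by blast
      qed
      then have "(2 * d + lv) * q + zz \<in> set (concat (map (entries1 q ?pw) P0) @
         concat (map (\<lambda>(bl, _). concat (map (entries1 q ?pw) bl)) cs))"
        unfolding cov[symmetric] set_msort .
      then consider bk where "bk \<in> set P0" "(2 * d + lv) * q + zz \<in> set (entries1 q ?pw bk)"
        | c' bk where "c' \<in> set cs" "bk \<in> set (fst c')" "(2 * d + lv) * q + zz \<in> set (entries1 q ?pw bk)"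
        by (auto simp: case_prod_unfold)
      then obtain bk where bk: "(2 * d + lv) * q + zz \<in> set (entries1 q ?pw bk)"
        and src: "bk \<in> set P0 \<or> (\<exists>k\<in>K. bk \<in> set (fst (cs ! k)))" unfolding K_def by (metis in_set_conv_nth lessThan_iff)
      have bkX: "set (block_pts bk) \<subseteq> ?X" using src bsub[OF pts0] bsub[OF pts] unfolding set_concat set_map by blast
      obtain m' x y z where e: "m' \<in> set ?pw" "(2 * d + lv) * q + zz = entry1 q m' x y z"
        "set (block_pts bk) = {x, y, z}" "x < q" "y < q" using entries1_sound[OF bk] by metis
      obtain i where i: "i < r" "m' = g ^ i mod q" using set_powers1[OF e(1)] q by blast
      have zX: "z \<in> ?X" using bkX unfolding e(3) by auto
      define lv' where "lv' = (if z < q then 0 else 1::int)"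
      define ze where "ze = (if z < q then m' * (z - x) mod q else z - q)"
      have zer: "0 \<le> ze" "ze < q" unfolding ze_def using q zX by auto
      have "entry1 q m' x y z = (2 * (m' * (y - x) mod q) + lv') * q + ze"
        unfolding entry1_def lv'_def ze_def by simp
      then have eq: "(2 * d + lv) * q + zz = (2 * (m' * (y - x) mod q) + lv') * q + ze" using e(2) by simp
      have "((2 * d + lv) * q + zz) mod q = zz" "((2 * d + lv) * q + zz) div q = 2 * d + lv"
        using zr by auto
      moreover have "((2 * (m' * (y - x) mod q) + lv') * q + ze) mod q = ze"
        "((2 * (m' * (y - x) mod q) + lv') * q + ze) div q = 2 * (m' * (y - x) mod q) + lv'"
        using zer by auto
      ultimately have dec: "zz = ze" "2 * d + lv = 2 * (m' * (y - x) mod q) + lv'"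
        unfolding eq by auto
      have ll: "lv = lv'"
      proof -
        have "lv = 0 \<or> lv = 1" "lv' = 0 \<or> lv' = 1" unfolding lv_def lv'_def by auto
        moreover have "l = l'" if "2 * a + l = 2 * c + l'" "l = 0 \<or> l = 1" "l' = 0 \<or> l' = 1" for a c l l' :: int
          using that by presburger
        ultimately show ?thesis using dec(2) by blast
      qed
      then have dd: "d = m' * (y - x) mod q" using dec(2) by simp
      define J where "J = (i + j) mod r"
      define t where "t = (u - g ^ J * x) mod q"
      have gr: "g ^ (r * n) mod q = 1" for n
      proof (induction n)
        case (Suc n)
        have "g ^ (r * Suc n) mod q = (g ^ r mod q) * (g ^ (r * n) mod q) mod q"
          by (simp add: power_add mod_mult_eq)
        then show ?case using Suc gr1 q by simp
      qed (use q in simp)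
      have gJ: "g ^ J * a mod q = g ^ j * (m' * a mod q) mod q" for a
      proof -
        have "g ^ (i + j) = g ^ (r * ((i + j) div r)) * g ^ J" unfolding J_def 
          by (metis mult_div_mod_eq power_add)
        then have "g ^ (i + j) * a mod q = ((g ^ (r * ((i + j) div r)) mod q) * (g ^ J * a)) mod q"
          by (simp add: mod_mult_left_eq mult.assoc)
        then have "g ^ (i + j) * a mod q = g ^ J * a mod q" unfolding gr by simp
        moreover have "g ^ j * (m' * a mod q) mod q = g ^ (i + j) * a mod q"
        proof -
          have "g ^ j * (m' * a mod q) mod q = g ^ j * (m' * a) mod q" by (rule mod_mult_cong) simp_all
          also have "\<dots> = (g ^ i mod q) * (g ^ j * a) mod q" unfolding i(2) by (simp add: mult.left_commute)
          also have "\<dots> = g ^ i * (g ^ j * a) mod q" by (rule mod_mult_cong) simp_all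
          finally show ?thesis by (simp add: power_add mult.assoc)
        qed
        ultimately show ?thesis by simp
      qed
      have hG: "(J, t) \<in> G" unfolding G_def J_def t_def using r q by auto
      have act_a: "act1 q g (J, t) a = (u + g ^ J * (a - x)) mod q" if "a < q" for a
      proof -
        have "(g ^ J * a + t) mod q = (g ^ J * a + (u - g ^ J * x)) mod q" unfolding t_def by (rule mod_add_cong) simp_all
        then show ?thesis unfolding act_fin(1)[OF that] by (simp add: algebra_simps)
      qed
      have act_x: "act1 q g (J, t) x = u" unfolding act_a[OF e(4)] using uvw by simp
      have act_y: "act1 q g (J, t) y = v"
      proof -
        have "g ^ J * (y - x) mod q = (v - u) mod q" unfolding gJ dd[symmetric] d ..
        then have "(u + g ^ J * (y - x)) mod q = (u + (v - u)) mod q" by (rule mod_add_cong[OF refl])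
        then show ?thesis unfolding act_a[OF e(5)] using uvw by simp
      qed
      have act_z: "act1 q g (J, t) z = w"
      proof (cases "z < q")
        case True
        then have wq: "w < q" using ll unfolding lv_def lv'_def by (simp split: if_splits)
        have "g ^ J * (z - x) mod q = (w - u) mod q" 
          using gz[OF wq] True unfolding gJ dec(1) ze_def by simp
        then have "(u + g ^ J * (z - x)) mod q = (u + (w - u)) mod q" by (rule mod_add_cong[OF refl])
        then show ?thesis unfolding act_a[OF True] using uvw wq by simp
      next
        case False
        then have "\<not> w < q" using ll unfolding lv_def lv'_def by (simp split: if_splits)
        then have "z = w" using dec(1) False unfolding zz_def ze_def by simp
        then show ?thesis using act_inf[OF False] by simp
      qed
      have img: "{u, v, w} = act1 q g (J, t) ` set (block_pts bk)" unfolding e(3) using act_x act_y act_z by simp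
      from src show ?thesis
      proof
        assume "bk \<in> set P0"
        then have "set (block_pts bk) \<in> ?bs P0" by blast
        then have "{u, v, w} \<in> Q t" unfolding img by (rule P0jt)
        then show ?thesis using hG unfolding G_def by blast
      next
        assume "\<exists>k\<in>K. bk \<in> set (fst (cs ! k))"
        then obtain k where "k \<in> K" "set (block_pts bk) \<in> b k" unfolding b_def by blast
        then show ?thesis unfolding T1_def using hG img by blast
      qed
    qed
    have hit2: "{u, v, w} \<in> T1 \<union> (\<Union>t\<in>{0..<q}. Q t)"
      if uX: "u \<in> ?X" "v \<in> ?X" "w \<in> ?X" and ne: "u \<noteq> v" "u \<noteq> w" "v \<noteq> w" and uq: "u < q" "v < q" for u v w
    proof -
      have "u mod q \<noteq> v mod q" using uX uq ne by simp
      then have "(v - u) mod q \<noteq> 0" by (metis dvd_eq_mod_eq_0 mod_eq_dvd_iff)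
      moreover have "0 \<le> (v - u) mod q" "(v - u) mod q < q" using q by auto
      ultimately have "(v - u) mod q \<in> set [1..q-1]" by simp
      then have "(v - u) mod q \<in> set (differences q ?pw reps)" unfolding diff[symmetric] set_msort .
      then obtain m d where md: "m \<in> set ?pw" "d \<in> set reps"
        "(v - u) mod q = m * d mod q \<or> (v - u) mod q = (- (m * d)) mod q" unfolding differences_def by auto
      from md(3) show ?thesis
      proof
        assume "(v - u) mod q = m * d mod q"
        then show ?thesis by (rule hit[OF uX ne(2,3) uq md(1,2)])
      next
        assume "(v - u) mod q = (- (m * d)) mod q"
        then have "(- (v - u)) mod q = (- (- (m * d))) mod q" by (rule mod_minus_cong)
        then have "(u - v) mod q = m * d mod q" by simp
        then have "{v, u, w} \<in> T1 \<union> (\<Union>t\<in>{0..<q}. Q t)" by (rule hit[OF uX(2,1,3) ne(3,2) uq(2,1) md(1,2)])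
        then show ?thesis by (simp add: insert_commute)
      qed
    qed
    obtain x y z where xyz: "B = {x, y, z}" "x \<noteq> y" "x \<noteq> z" "y \<noteq> z" using B3 by (auto simp: card_3_iff)
    have xX: "x \<in> ?X" "y \<in> ?X" "z \<in> ?X" using BX xyz by auto
    consider "x < q" "y < q" | "x < q" "z < q" | "y < q" "z < q"
      | w where "w \<in> ?X" "w < q" "B = {w, q, q + 1}"
    proof -
      have "x < q \<or> x = q \<or> x = q + 1" "y < q \<or> y = q \<or> y = q + 1" "z < q \<or> z = q \<or> z = q + 1" using xX by auto
      then show thesis using that xyz xX by (elim disjE) (auto simp: insert_commute)
    qed
    then show "B \<in> T1 \<union> (\<Union>t\<in>{0..<q}. Q t)"
    proof cases
      case 1 then show ?thesis unfolding xyz(1) using hit2[of x y z] xX xyz by blast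
    next
      case 2 
      then have "{x, z, y} \<in> T1 \<union> (\<Union>t\<in>{0..<q}. Q t)" using hit2[of x z y] xX xyz by blast
      then show ?thesis unfolding xyz(1) by (simp add: insert_commute)
    next
      case 3
      then have "{y, z, x} \<in> T1 \<union> (\<Union>t\<in>{0..<q}. Q t)" using hit2[of y z x] xX xyz by blast
      then show ?thesis unfolding xyz(1) by (simp add: insert_commute)
    next
      case 4
      have "{0, q, q + 1} \<in> ?bs P0" using inf0 by force
      moreover have "B = act1 q g (0, w) ` {0, q, q + 1}" using 4 q by (auto simp: act1_def)
      ultimately have "B \<in> Q w" unfolding Q_def by blast
      then show ?thesis using 4 by auto
    qed
  qed
  ultimately have L: "linked ?X (card (K \<times> G) + card {0..<q}) (triples ?X)" by (rule linked_mono)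
  define P where "P = nat q"
  have N: "nat (q + 2) = P + 2" using q by (simp add: P_def)
  define a M D where "a = length cs * r" and "M = card (K \<times> G) + P" and "D = nat (q + 2) div 3"
  have "int (a * 2 + 1) = int P" using c q by (simp add: P_def a_def)
  then have a: "P + 1 = a * 2 + 2" by linarith
  have "card (K \<times> G) = a * P" unfolding K_def G_def a_def by (simp add: card_cartesian_product P_def)
  then have "2 * M = P * (a * 2 + 2)" unfolding M_def by (simp add: algebra_simps)
  then have M: "2 * M = P * (P + 1)" unfolding a .
  have D: "3 * D = P + 2" using n3 N unfolding D_def by auto
  have "6 * (M * D) = (2 * M) * (3 * D)" by simp
  also have "\<dots> = 6 * (P + 2 choose 3)" unfolding M D choose_three by (simp add: algebra_simps)
  finally have "M * D = P + 2 choose 3" by simp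
  then have "(card (K \<times> G) + card {0..<q}) * (nat (q + 2) div 3) = nat (q + 2) choose 3" 
    unfolding N M_def D_def P_def by simp
  then show ?thesis by (intro resolvedI[OF L]) auto
qed

section \<open>Base classes on q + 2 points for q = 13, 19, 31, 37, 49, 67, 73\<close>

definition equilateral_15 :: "block list" where
  "equilateral_15 =
    [(0, 13, 14, []), (1, 3, 9, [1]), (2, 6, 5, [-3]), (4, 12, 10, [-3]), (7, 8, 11, [1])]"

definition classes_15 :: "(block list \<times> int) list" where
  "classes_15 =
    [([(10, 8, 0, [-1, 3, -9]), (11, 2, 14, [-3]), (5, 7, 1, [1, -9, -3]),
    (12, 9, 6, [-9, -9, 9]), (3, 4, 13, [1])], 7), ([(6, 11, 13, [3]), (9, 0, 3, [-3, 9, 9]),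
    (1, 8, 4, [-9, 3, -9]), (12, 7, 14, [-3]), (2, 10, 5, [-3, -3, -9])], 6)]"

lemma resolved_15: "resolved 15"
proof -
  have "resolved (nat (13 + 2))"
  proof (rule one_level_family)
    show "one_level_check 13 3 3 [1, 2] equilateral_15 classes_15" by code_simp
  qed
  then show ?thesis by simp
qed

text \<open>The block with the fixed points and the cosets of the cube roots of unity {1, 7, 11}
  modulo 19. The three pairs of a coset are equivalent under the cube roots, so one multiplier is
  enough, and only one coset of each orbit under \<open>g\<close> carries it. The other equilateral
  classes are built alike.\<close>

definition equilateral_21 :: "block list" where
  "equilateral_21 =
    [(0, 19, 20, []), (1, 7, 11, [16]), (2, 14, 3, [-11]), (4, 9, 6, []), (5, 16, 17, []),
    (8, 18, 12, []), (10, 13, 15, [])]"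

definition classes_21 :: "(block list \<times> int) list" where
  "classes_21 =
    [([(8, 0, 15, [7, -5, -11]), (1, 9, 20, [-7]), (2, 10, 7, [-7, 6, -4]), (11, 5, 19, [-16]),
    (18, 6, 16, [11, -17, -9]), (14, 13, 12, [-1, -1, -9]), (17, 4, 3, [16, -1, -4])], 5)]"

lemma resolved_21: "resolved 21"
proof -
  have "resolved (nat (19 + 2))"
  proof (rule one_level_family)
    show "one_level_check 19 4 9 [1] equilateral_21 classes_21" by code_simp
  qed
  then show ?thesis by simp
qed

definition equilateral_33 :: "block list" where
  "equilateral_33 =
    [(0, 31, 32, []), (1, 5, 25, [8]), (2, 10, 19, []), (3, 15, 13, [-18]), (4, 20, 7, []),
    (6, 30, 26, []), (8, 9, 14, []), (11, 24, 27, []), (12, 29, 21, []), (16, 18, 28, []),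
    (17, 23, 22, [])]"

definition classes_33 :: "(block list \<times> int) list" where
  "classes_33 =
    [([(13, 12, 32, [-1]), (19, 17, 31, [-16]), (2, 9, 18, [9, 7, -2]),
    (30, 20, 27, [-28, 9, -10]), (26, 25, 15, [-1, -28, -14]), (7, 29, 8, [-7, 28, -1]),
    (11, 16, 22, [25, -5, 14]), (14, 1, 28, [19, -8, -20]), (24, 3, 10, [28, 9, 20]),
    (5, 4, 6, [-1, 16, -1]), (23, 21, 0, [-16, 28, -4])], 16)]"

lemma resolved_33: "resolved 33"
proof -
  have "resolved (nat (31 + 2))"
  proof (rule one_level_family)
    show "one_level_check 31 7 15 [1] equilateral_33 classes_33" by code_simp
  qed
  then show ?thesis by simp
qed

definition equilateral_39 :: "block list" where
  "equilateral_39 =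
    [(0, 37, 38, []), (1, 10, 26, [33]), (2, 20, 15, [33]), (3, 30, 4, [-26]), (5, 13, 19, [-9]),
    (6, 23, 8, []), (7, 33, 34, []), (9, 16, 12, []), (11, 36, 27, []), (14, 29, 31, []),
    (17, 22, 35, []), (18, 32, 24, []), (21, 25, 28, [])]"

definition classes_39 :: "(block list \<times> int) list" where
  "classes_39 =
    [([(1, 36, 38, [-1]), (27, 30, 37, [-12]), (35, 28, 15, [-16, 34, 26]),
    (7, 20, 13, [-34, -16, 12]), (24, 9, 23, [-10, 16, 1]), (31, 2, 32, [-9, -16, -1]),
    (4, 25, 33, [-7, -9, -9]), (29, 18, 10, [10, 9, -33]), (22, 21, 6, [-1, -10, 7]),
    (3, 5, 17, [1, 34, -16]), (0, 12, 8, [34, 9, 9]), (19, 34, 14, [10, -26, -7]),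
    (11, 26, 16, [10, -26, 7])], 20), ([(8, 34, 38, [10]), (10, 2, 37, [9]),
    (17, 3, 28, [-16, -34, 10]), (15, 29, 36, [16, 16, 7]), (9, 14, 1, [-7, 34, -9]),
    (0, 35, 26, [-1, -33, -10]), (23, 32, 25, [33, -16, -1]), (7, 6, 18, [-1, 34, 10]),
    (20, 27, 16, [16, 10, -9]), (31, 11, 21, [-26, 26, 26]), (22, 5, 30, [26, -34, 9]),
    (19, 12, 4, [-16, 9, 10]), (33, 24, 13, [-33, 10, 26])], 7)]"

lemma resolved_39: "resolved 39"
proof -
  have "resolved (nat (37 + 2))"
  proof (rule one_level_family)
    show "one_level_check 37 7 9 [1, 2] equilateral_39 classes_39" by code_simp
  qed
  then show ?thesis by simp
qed

text \<open>The modulus 49 is not prime, but only \<open>g\<close> has to be invertible. The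
  multipliers are just the cube roots of unity {1, 18, 30}: a multiplier of order seven, such as 8,
  would fix the difference 7.\<close>

definition equilateral_51 :: "block list" where
  "equilateral_51 =
    [(0, 49, 50, []), (1, 18, 30, [18]), (2, 36, 11, [-30]), (3, 5, 41, [1]), (4, 23, 22, [-18]),
    (6, 10, 33, [1]), (7, 28, 14, [-30]), (8, 46, 44, [-18]), (9, 15, 25, [1]),
    (12, 20, 17, [-18]), (13, 38, 47, [18]), (16, 43, 39, [-18]), (19, 48, 31, [-30]),
    (21, 35, 42, [18]), (24, 40, 34, [-18]), (26, 27, 45, [1]), (29, 32, 37, [1])]"

definition classes_51 :: "(block list \<times> int) list" where
  "classes_51 =
    [([(9, 1, 49, [18]), (11, 46, 50, [-18]), (27, 5, 40, [-18, -18, 30]), (10, 2, 8, [18, 1, 1]),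
    (32, 35, 4, [1, 30, 30]), (26, 34, 28, [-18, -1, -1]), (38, 41, 45, [1, 1, -1]),
    (30, 48, 33, [30, -30, -1]), (7, 22, 16, [30, -1, -1]), (19, 15, 17, [-1, 1, 1]),
    (13, 25, 39, [1, 18, 30]), (3, 42, 18, [-30, 18, -30]), (37, 14, 23, [-30, 1, 18]),
    (20, 6, 21, [-18, 30, -1]), (0, 36, 31, [30, -30, 30]), (47, 29, 44, [-30, 30, 1]),
    (43, 12, 24, [30, 1, -18])], 16), ([(38, 22, 50, [18]), (13, 33, 49, [30]),
    (41, 20, 45, [30, 18, -1]), (29, 35, 30, [1, -30, -1]), (37, 39, 32, [1, -1, 30]),
    (3, 21, 15, [30, -1, -1]), (16, 14, 4, [-1, -30, 1]), (6, 23, 8, [18, -30, -1]),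
    (43, 0, 40, [1, -1, 1]), (28, 25, 2, [-1, -30, -30]), (34, 36, 9, [1, 18, 18]),
    (19, 42, 1, [30, -18, 30]), (26, 27, 5, [1, -18, -30]), (24, 11, 10, [30, -1, 18]),
    (17, 12, 31, [-30, -18, -18]), (48, 47, 44, [-1, -1, 1]), (7, 18, 46, [18, 30, 30])], 5),
    ([(9, 17, 50, [-18]), (35, 0, 49, [18]), (23, 26, 47, [1, -30, 18]),
    (7, 29, 43, [18, 18, -30]), (21, 20, 45, [-1, 18, 18]), (11, 30, 39, [-18, 1, -30]),
    (10, 8, 48, [-1, -1, 18]), (28, 27, 16, [-1, -18, 1]), (40, 22, 33, [-30, 18, 1]),
    (6, 5, 1, [-1, -1, 30]), (31, 37, 2, [1, 18, -30]), (3, 15, 24, [1, 1, 30]),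
    (32, 19, 4, [30, -30, 30]), (44, 38, 34, [-1, -1, 30]), (18, 46, 25, [30, 30, -1]),
    (41, 12, 14, [30, 1, -18]), (13, 42, 36, [-30, -1, -30])], 3), ([(23, 36, 49, [-30]),
    (22, 13, 50, [-1]), (14, 16, 10, [1, -1, 1]), (42, 12, 34, [-18, 18, -18]),
    (17, 4, 20, [30, -18, -1]), (45, 47, 27, [1, -30, 30]), (48, 29, 33, [18, 1, 30]),
    (6, 0, 21, [-1, -30, -30]), (39, 37, 2, [-1, 18, -1]), (1, 5, 24, [1, -18, -30]),
    (41, 8, 11, [-18, 1, 18]), (25, 19, 43, [-1, -18, -30]), (31, 9, 18, [-18, 1, -30]),
    (40, 32, 28, [18, -1, 1]), (26, 46, 38, [30, 18, -1]), (15, 7, 35, [18, 30, -30]),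
    (30, 44, 3, [18, -18, -18])], 15), ([(47, 14, 49, [-18]), (12, 13, 50, [1]),
    (15, 1, 27, [-18, -30, -1]), (44, 43, 33, [-1, -30, 18]), (40, 11, 0, [30, -18, -1]),
    (21, 5, 3, [18, -1, 30]), (24, 29, 4, [30, -18, 30]), (9, 34, 42, [18, -18, -18]),
    (41, 18, 19, [-30, 1, 18]), (10, 37, 31, [-18, -1, 30]), (48, 35, 17, [30, -30, -30]),
    (36, 28, 25, [18, -1, 18]), (46, 20, 8, [30, -1, -18]), (39, 2, 30, [1, 30, 1]),
    (16, 45, 22, [-30, -30, -1]), (26, 38, 23, [1, -30, 1]), (6, 7, 32, [1, 18, 30])], 17),
    ([(14, 36, 50, [18]), (11, 45, 49, [-30]), (27, 38, 44, [18, 1, -18]),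
    (28, 47, 10, [-18, 1, 30]), (48, 7, 20, [-18, -30, 30]), (41, 6, 25, [18, -18, -18]),
    (32, 23, 16, [-1, -1, -18]), (12, 29, 3, [18, 30, 1]), (39, 31, 42, [18, 18, -1]),
    (5, 26, 21, [-30, -30, 18]), (30, 8, 9, [-18, 1, -30]), (0, 34, 22, [-30, -1, -18]),
    (2, 4, 37, [1, 18, 18]), (19, 24, 33, [30, 1, -18]), (15, 13, 40, [-1, -18, -18]),
    (35, 18, 43, [-18, 18, 18]), (46, 17, 1, [30, 18, -1])], 5), ([(42, 20, 49, [-18]),
    (1, 48, 50, [-1]), (29, 13, 39, [18, -30, -30]), (23, 8, 21, [-30, -30, 1]),
    (37, 17, 46, [-30, -30, -1]), (35, 10, 16, [-18, 1, -18]), (26, 14, 33, [-1, -18, -1]),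
    (15, 5, 47, [-30, -1, 18]), (12, 43, 0, [-30, 1, 1]), (7, 22, 38, [30, -18, 30]),
    (41, 2, 31, [30, -30, 30]), (25, 28, 18, [1, -30, 1]), (45, 24, 9, [30, -30, 30]),
    (6, 32, 30, [-30, -1, 18]), (4, 3, 40, [-1, -1, -30]), (34, 36, 44, [1, -18, -30]),
    (19, 11, 27, [18, -18, 18])], 6), ([(32, 44, 50, [1]), (35, 36, 49, [1]),
    (4, 46, 17, [-1, 30, 30]), (18, 29, 47, [18, 30, 30]), (9, 30, 3, [-30, 18, 1]),
    (19, 24, 15, [30, -1, 1]), (31, 33, 34, [1, 1, -1]), (41, 12, 13, [30, 1, 30]),
    (11, 7, 48, [-1, 18, 1]), (38, 23, 39, [-30, -18, -1]), (26, 40, 43, [18, 1, -18]),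
    (21, 27, 20, [1, -1, 1]), (10, 0, 22, [-30, 18, -1]), (2, 14, 5, [1, -1, -1]),
    (45, 37, 8, [18, 30, -1]), (28, 25, 1, [-1, 18, -18]), (42, 16, 6, [30, -30, 30])], 7)]"

lemma resolved_51: "resolved 51"
proof -
  have "resolved (nat (49 + 2))"
  proof (rule one_level_family)
    show "one_level_check 49 18 3 [1, 2, 3, 4, 6, 7, 9, 12] equilateral_51 classes_51" by code_simp
  qed
  then show ?thesis by simp
qed

definition equilateral_69 :: "block list" where
  "equilateral_69 =
    [(0, 67, 68, []), (1, 29, 37, [-55]), (2, 58, 7, [6]), (3, 20, 44, []), (4, 49, 14, []),
    (5, 11, 51, []), (6, 40, 21, []), (8, 31, 28, []), (9, 60, 65, []), (10, 22, 35, []),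
    (12, 13, 42, []), (15, 33, 19, []), (16, 62, 56, []), (17, 24, 26, []), (18, 53, 63, []),
    (23, 64, 47, []), (25, 55, 54, []), (27, 46, 61, []), (30, 66, 38, []), (32, 57, 45, []),
    (34, 48, 52, []), (36, 39, 59, []), (41, 50, 43, [])]"

definition classes_69 :: "(block list \<times> int) list" where
  "classes_69 =
    [([(22, 30, 67, [-25]), (52, 53, 68, [1]), (19, 56, 44, [29, 39, -59]),
    (18, 5, 45, [36, 62, 62]), (23, 14, 31, [-15, 4, 25]), (12, 57, 51, [-64, -56, -55]),
    (61, 4, 55, [47, -21, 56]), (2, 3, 9, [1, 56, 19]), (16, 63, 24, [10, -55, 25]),
    (42, 15, 28, [62, -36, 24]), (46, 11, 13, [-23, -33, 65]), (66, 47, 17, [-60, 29, 26]),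
    (25, 34, 60, [15, 49, -23]), (10, 32, 41, [64, 15, 54]), (36, 64, 48, [-55, -21, 39]),
    (26, 54, 6, [-55, 60, -10]), (35, 20, 37, [-9, 4, 33]), (43, 40, 1, [22, -55, -59]),
    (58, 59, 38, [1, -16, -10]), (62, 0, 50, [-40, -4, -39]), (29, 7, 49, [-64, -59, 10]),
    (33, 65, 27, [-23, 37, 56]), (21, 39, 8, [-26, 54, -36])], 51)]"

lemma resolved_69: "resolved 69"
proof -
  have "resolved (nat (67 + 2))"
  proof (rule one_level_family)
    show "one_level_check 67 4 33 [1] equilateral_69 classes_69" by code_simp
  qed
  then show ?thesis by simp
qed

definition equilateral_75 :: "block list" where
  "equilateral_75 =
    [(0, 73, 74, []), (1, 8, 64, [32]), (2, 16, 55, []), (3, 24, 46, [4]), (4, 32, 37, []),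
    (5, 40, 28, [-2]), (6, 48, 19, []), (7, 56, 10, []), (9, 72, 65, [-37]), (11, 15, 47, [55]),
    (12, 23, 38, []), (13, 31, 29, [-4]), (14, 39, 20, []), (17, 63, 66, [8]), (18, 71, 57, []),
    (21, 22, 30, []), (25, 54, 67, [-55]), (26, 62, 58, []), (27, 70, 49, []), (33, 45, 68, []),
    (34, 53, 59, []), (35, 61, 50, []), (36, 69, 41, []), (42, 44, 60, []), (43, 52, 51, [])]"

definition classes_75 :: "(block list \<times> int) list" where
  "classes_75 =
    [([(1, 42, 73, [-16]), (40, 37, 74, [-1]), (36, 44, 30, [64, -16, 37]),
    (23, 48, 65, [-32, -4, -2]), (70, 53, 10, [4, 32, 16]), (18, 67, 63, [-64, -55, 8]),
    (35, 43, 55, [64, 55, -55]), (56, 20, 60, [2, 64, -55]), (2, 64, 31, [-1, 64, 55]),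
    (4, 72, 12, [-1, -16, -64]), (16, 62, 69, [8, 32, 55]), (47, 39, 27, [-64, -55, 55]),
    (22, 33, 25, [1, -64, -1]), (19, 58, 17, [2, 16, 37]), (5, 34, 24, [-55, -37, -4]),
    (3, 14, 59, [1, -8, -4]), (71, 28, 32, [32, 55, 2]), (50, 13, 8, [-2, -1, 2]),
    (51, 7, 0, [-55, -32, -37]), (61, 52, 68, [8, 32, -32]), (9, 66, 15, [-32, 37, -37]),
    (11, 46, 38, [-2, -64, 8]), (54, 26, 57, [-8, -2, -1]), (29, 45, 6, [32, -2, 16]),
    (21, 41, 49, [55, 64, -8])], 53), ([(57, 58, 74, [1]), (62, 67, 73, [1]),
    (60, 12, 15, [-32, 1, -8]), (3, 25, 68, [37, -32, 64]), (22, 18, 47, [-55, -55, 32]),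
    (36, 48, 46, [55, -37, -37]), (8, 9, 38, [1, -55, -32]), (50, 31, 7, [-4, -64, -32]),
    (26, 6, 59, [-55, -55, 64]), (17, 21, 37, [55, 32, -55]), (49, 27, 44, [-37, -4, 1]),
    (34, 40, 13, [37, 8, 4]), (41, 4, 14, [-2, 37, -8]), (61, 20, 16, [16, -55, -8]),
    (1, 70, 53, [-55, 4, 4]), (19, 30, 42, [1, 55, -16]), (0, 55, 24, [4, 2, -64]),
    (10, 35, 43, [-32, 64, 64]), (32, 66, 23, [-2, 32, -8]), (71, 29, 5, [-2, -64, -32]),
    (64, 11, 56, [55, -8, 64]), (65, 39, 63, [8, 64, 37]), (69, 51, 54, [4, 1, 64]),
    (52, 33, 28, [-4, -1, 64]), (72, 45, 2, [8, 32, -1])], 3), ([(28, 38, 74, [37]),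
    (57, 9, 73, [-32]), (4, 62, 37, [-64, 32, 64]), (14, 63, 70, [-64, 32, -4]),
    (26, 15, 6, [-1, 8, 55]), (68, 47, 2, [-4, 8, -32]), (64, 25, 56, [-2, -2, 64]),
    (31, 33, 46, [37, -16, -64]), (24, 60, 36, [-2, -64, -55]), (67, 8, 19, [16, 1, 32]),
    (5, 42, 71, [2, -55, 32]), (18, 20, 61, [37, -16, 32]), (72, 55, 32, [4, -16, 64]),
    (39, 16, 29, [-16, -16, 37]), (27, 43, 59, [32, 32, -16]), (1, 22, 49, [4, -8, -32]),
    (17, 35, 54, [-4, 4, -2]), (13, 10, 12, [-1, 37, 1]), (30, 51, 3, [4, -32, -8]),
    (23, 52, 48, [-55, -55, 32]), (34, 40, 58, [37, -4, -64]), (53, 66, 69, [-16, 1, -32]),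
    (7, 45, 41, [2, -55, 2]), (21, 11, 0, [-37, -1, 4]), (65, 50, 44, [-64, -37, 4])], 4),
    ([(69, 58, 74, [-1]), (71, 27, 73, [-55]), (3, 37, 6, [-2, 2, -1]),
    (32, 65, 39, [-64, 8, -32]), (62, 29, 67, [64, 2, -1]), (28, 24, 19, [-55, -1, -8]),
    (30, 45, 41, [64, -55, -1]), (44, 53, 4, [-8, 64, 64]), (12, 43, 7, [-2, 2, 1]),
    (56, 35, 21, [-4, -16, -2]), (14, 11, 10, [-1, -1, 55]), (59, 55, 66, [-55, 1, -32]),
    (0, 36, 49, [-2, -16, 64]), (42, 26, 57, [-32, -2, -64]), (61, 20, 63, [16, -32, -37]),
    (22, 48, 2, [-8, -8, 55]), (8, 18, 46, [37, 8, -2]), (68, 25, 38, [32, -16, 32]),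
    (33, 5, 72, [-8, -37, -2]), (1, 47, 70, [8, 16, 55]), (50, 23, 54, [8, -2, -55]),
    (31, 34, 60, [1, -8, 55]), (9, 52, 51, [-32, -1, -2]), (17, 16, 13, [-1, -1, 55]),
    (64, 15, 40, [64, -32, 64])], 19)]"

lemma resolved_75: "resolved 75"
proof -
  have "resolved (nat (73 + 2))"
  proof (rule one_level_family)
    show "one_level_check 73 2 9 [1, 3, 5, 11] equilateral_75 classes_75" by code_simp
  qed
  then show ?thesis by simp
qed

section \<open>Tripling\<close>

lemma pclass_cover:
  assumes "finite X" "pclass X P" "card X mod 3 = 0"
  shows "\<Union>P = X"
proof (rule card_subset_eq[OF assms(1) pclass_Union[OF assms(2)]])
  have "card (\<Union>P) = sum card P"
    using assms(2) unfolding pclass_def triples_def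
    by (intro card_Union_disjoint) (auto intro: finite_subset[OF _ assms(1)])
  also have "\<dots> = sum (\<lambda>_. 3) P" using assms(2) unfolding pclass_def triples_def by (intro sum.cong) auto
  also have "\<dots> = 3 * (card X div 3)" using assms(2) unfolding pclass_def by simp
  also have "\<dots> = card X" using assms(3) by auto
  finally show "card (\<Union>P) = card X" .
qed

text \<open>Heights of a lifted block relative to its least point: \<open>a\<close> at the middle
  point and \<open>b\<close> at the greatest. Together with the height \<open>j\<close> of the least
  point they parametrise all 27 lifts of a block.\<close>

definition offset :: "nat \<Rightarrow> nat \<Rightarrow> nat set \<Rightarrow> nat \<Rightarrow> nat" where
  "offset a b B u = (if u = Min B then 0 else if u = Max B then b else a)"

definition lift :: "nat \<Rightarrow> nat \<Rightarrow> nat set \<Rightarrow> nat \<Rightarrow> (nat \<times> nat) set" where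
  "lift a b B j = (\<lambda>u. (u, (j + offset a b B u) mod 3)) ` B"

lemma lift_fst: "(u, c) \<in> lift a b B j \<Longrightarrow> u \<in> B \<and> c = (j + offset a b B u) mod 3"
  unfolding lift_def by auto

lemma lift_surj:
  assumes B: "card B = 3" and T: "T = (\<lambda>u. (u, f u)) ` B" and f: "\<And>u. u \<in> B \<Longrightarrow> f u < (3::nat)"
  shows "\<exists>a<3. \<exists>b<3. \<exists>j<3. T = lift a b B j"
proof -
  have fin: "finite B" "B \<noteq> {}" using B by (auto intro: card_ge_0_finite)
  let ?x = "Min B" and ?z = "Max B"
  have xz: "?x \<in> B" "?z \<in> B" using fin by auto
  have "?x \<noteq> ?z"
  proof
    assume e: "?x = ?z"
    have "u = ?x" if "u \<in> B" for u using Min_le[OF fin(1) that] Max_ge[OF fin(1) that] e by simp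
    then have "B \<subseteq> {?x}" by blast
    then have "card B \<le> 1" using card_mono[of "{?x}" B] by simp
    then show False using B by simp
  qed
  then have "card (B - {?x, ?z}) = 1" using B xz fin by simp
  then obtain y where y: "B - {?x, ?z} = {y}" by (auto simp: card_1_singleton_iff)
  define j where "j = f ?x"
  \<comment> \<open>The factor 2 stands for -1 modulo three, which avoids subtraction of
    naturals.\<close>
  define a where "a = (f y + 2 * f ?x) mod 3"
  define b where "b = (f ?z + 2 * f ?x) mod 3"
  have key: "(k + (c + 2 * k) mod 3) mod 3 = c" if "c < 3" for c k :: nat
  proof -
    have "(k + (c + 2 * k) mod 3) mod 3 = (c + 3 * k) mod 3" by (simp add: mod_simps algebra_simps)
    then show ?thesis using that by simp
  qed
  have "(j + offset a b B u) mod 3 = f u" if u: "u \<in> B" for u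
  proof -
    consider "u = ?x" | "u = ?z" | "u = y" using u y by blast
    then show ?thesis
    proof cases
      case 1 then show ?thesis using f[OF xz(1)] by (simp add: offset_def j_def)
    next
      case 2 then show ?thesis using key[OF f[OF xz(2)]] \<open>?x \<noteq> ?z\<close> by (simp add: offset_def j_def b_def)
    next
      case 3
      then have "u \<noteq> ?x" "u \<noteq> ?z" using y by auto
      then show ?thesis using key[OF f[OF u], of "f ?x"] 3 by (simp add: offset_def j_def a_def)
    qed
  qed
  then have "T = lift a b B j" unfolding T lift_def by (intro image_cong refl) simp
  moreover have "a < 3" "b < 3" "j < 3" using f[OF xz(1)] unfolding a_def b_def j_def by auto
  ultimately show ?thesis by blast
qed

text \<open>A proper 3-colouring of the circulant graph with connection set \<open>\<plusminus>d\<close>, \<open>2 d < n\<close>: alternate along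
  runs of length \<open>d\<close> and give the last run the third colour.\<close>

definition circ_col :: "nat \<Rightarrow> nat \<Rightarrow> nat \<Rightarrow> nat" where
  "circ_col n d x = (if x \<ge> n - d then 2 else (x div d) mod 2)"

lemma circ_col_proper:
  assumes "0 < d" "2 * d < n" "x < n"
  shows "circ_col n d x \<noteq> circ_col n d ((x + d) mod n)"
proof (cases "x \<ge> n - d")
  case True
  then have "(x + d) mod n = x + d - n" using assms by (simp add: mod_if)
  moreover have "x + d - n < d" using assms by simp
  ultimately show ?thesis using True assms by (simp add: circ_col_def)
next
  case False
  then have e: "(x + d) mod n = x + d" using assms by simp
  have "(x + d) div d = Suc (x div d)" using assms div_add_self2[of d x] by simp
  moreover have "Suc k mod 2 \<noteq> k mod 2" for k :: nat by presburger
  moreover have "k mod 2 \<noteq> 2" "2 \<noteq> k mod 2" for k :: nat by presburger+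
  ultimately show ?thesis using False unfolding e circ_col_def by (metis)
qed

text \<open>The differences \<open>d\<close> and \<open>n - d\<close> define the same circulant
  graph, and for odd \<open>n\<close> one of them is below n / 2.\<close>

definition derange_col :: "nat \<Rightarrow> nat \<Rightarrow> nat \<Rightarrow> nat" where
  "derange_col n d = (if 2 * d < n then circ_col n d else circ_col n (n - d))"

lemma derange_col_lt: "derange_col n d x < 3"
proof -
  have "k mod 2 < 3" for k :: nat by (rule less_trans[of _ 2]) auto
  then show ?thesis unfolding derange_col_def circ_col_def by auto
qed

lemma derange_col_proper:
  assumes "0 < d" "d < n" "odd n" "x < n"
  shows "derange_col n d x \<noteq> derange_col n d ((x + d) mod n)"
proof (cases "2 * d < n")
  case True
  then show ?thesis using circ_col_proper[of d n x] assms by (simp add: derange_col_def)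
next
  case False
  then have "2 * (n - d) < n" using assms by presburger
  moreover have "((x + d) mod n + (n - d)) mod n = x"
  proof -
    have "((x + d) mod n + (n - d)) mod n = (x + d + (n - d)) mod n" by (simp add: mod_simps)
    then show ?thesis using assms by simp
  qed
  ultimately show ?thesis using circ_col_proper[of "n - d" n "(x + d) mod n"] assms False
    by (simp add: derange_col_def)
qed

text \<open>Interpolation by a linear polynomial over the field of three elements at two different
  arguments.\<close>

lemma solve_mod3:
  assumes "cx < 3" "cy < 3" "k < 3" "e < 3" "cx \<noteq> (cy::nat)"
  shows "\<exists>u<3. \<exists>v<3. (u + v * cx) mod 3 = k \<and> (u + v * cy) mod 3 = e"
proof -
  have "list_all (\<lambda>cx. list_all (\<lambda>cy. list_all (\<lambda>k. list_all (\<lambda>e. cx = cy \<or>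
     list_ex (\<lambda>u. list_ex (\<lambda>v. (u + v * cx) mod 3 = k \<and> (u + v * cy) mod 3 = e) [0,1,2]) [0,1,2])
     [0,1,2]) [0,1,2]) [0,1,2]) [0,1,2::nat]" by code_simp
  moreover have "z = 0 \<or> z = 1 \<or> z = 2" if "z < 3" for z :: nat using that by auto
  then have "cx \<in> set [0,1,2]" "cy \<in> set [0,1,2]" "k \<in> set [0,1,2]" "e \<in> set [0,1,2]" using assms by auto
  ultimately have "list_ex (\<lambda>u. list_ex (\<lambda>v. (u + v * cx) mod 3 = k \<and> (u + v * cy) mod 3 = e) [0,1,2]) [0,1,2]"
    using assms(5) unfolding list_all_iff by blast
  then obtain u v where "u \<in> set [0,1,2]" "v \<in> set [0,1,2]" "(u + v * cx) mod 3 = k \<and> (u + v * cy) mod 3 = e"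
    unfolding list_ex_iff by blast
  moreover have "z < 3" if "z \<in> set [0,1,2]" for z :: nat using that by auto
  ultimately show ?thesis by blast
qed

text \<open>Triples of \<open>{..<n} \<times> {..<3}\<close> are sorted by the number of columns
  they meet. Three columns: the lifts of the given blocks, linked as the blocks are. One column: a
  single class. Two columns: classes \<open>R (d, u, v)\<close> with \<open>d\<close> the difference
  of the columns. From M classes on \<open>n\<close> points this makes 9 M + 1 + 9 (n - 1)
  classes.\<close>

theorem resolved_triple:
  assumes res: "resolved n" and n: "odd n" "n mod 3 = 0" "n \<ge> 3"
  shows "resolved (3 * n)"
proof -
  let ?V = "{..<n}" and ?X = "{..<n} \<times> {..<3::nat}"
  have cX: "card ?X = 3 * n" and fX: "finite ?X" by (auto simp: card_cartesian_product)
  obtain I :: "nat set" and P s where L: "linked_family ?V I P s (triples ?V)"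
    and cI: "card I * (n div 3) = n choose 3"
    using res unfolding resolved_def linked_def by blast
  have fI: "finite I" and pc: "\<And>i. i \<in> I \<Longrightarrow> pclass ?V (P i)" and bij: "bij_betw s I I"
    and mo: "\<And>i. i \<in> I \<Longrightarrow> meet_once (P i) (P (s i))"
    and cov: "\<And>B. B \<in> triples ?V \<Longrightarrow> \<exists>i\<in>I. B \<in> P i"
    using L unfolding linked_family_def by auto
  have PT: "B \<subseteq> ?V" "card B = 3" if "i \<in> I" "B \<in> P i" for i B
    using pc[OF that(1)] that unfolding pclass_def triples_def by auto
  define Q where "Q = (\<lambda>(i, a, b). (\<lambda>(B, j). lift a b B j) ` (P i \<times> {..<3}))"
  have lifts: "linked_family ?X (I \<times> {..<3} \<times> {..<3}) Q (\<lambda>(i, a, b). (s i, a, b)) {T. T \<in> triples ?X \<and> inj_on fst T}"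
    unfolding linked_family_def
  proof (intro conjI ballI)
    show "finite (I \<times> {..<3::nat} \<times> {..<3::nat})" using fI by simp
    have eq: "(\<lambda>(i, a, b). (s i, a, b)) = map_prod s id" by (auto simp: fun_eq_iff)
    show "bij_betw (\<lambda>(i, a, b). (s i, a, b)) (I \<times> {..<3::nat} \<times> {..<3::nat}) (I \<times> {..<3} \<times> {..<3})"
      unfolding eq by (rule bij_betw_map_prod[OF bij bij_betw_id])
  next
    fix k assume "k \<in> I \<times> {..<3::nat} \<times> {..<3::nat}"
    then obtain i a b where k: "k = (i, a, b)" "i \<in> I" "a < 3" "b < 3" by auto
    have fP: "finite (P i)" "card (P i) = n div 3"
      using pclass_finite[OF _ pc[OF k(2)]] pc[OF k(2)] unfolding pclass_def by auto
    have "pclass ?X ((\<lambda>(B, j). lift a b B j) ` (P i \<times> {..<3}))"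
    proof (rule pclass_familyI[OF fX])
      show "finite (P i \<times> {..<3::nat})" using fP by simp
      show "card (P i \<times> {..<3::nat}) = card ?X div 3" using fP n cX by (auto simp: card_cartesian_product)
      fix p assume "p \<in> P i \<times> {..<3::nat}"
      then obtain B j where p: "p = (B, j)" "B \<in> P i" by auto
      have "card (lift a b B j) \<le> card B" unfolding lift_def using PT(1)[OF k(2) p(2)]
        by (intro card_image_le) (auto intro: finite_subset)
      then show "(case p of (B, j) \<Rightarrow> lift a b B j) \<subseteq> ?X \<and> card (case p of (B, j) \<Rightarrow> lift a b B j) \<le> 3"
        using PT[OF k(2) p(2)] unfolding p lift_def by auto
    next
      have "?X \<subseteq> (\<Union>p\<in>P i \<times> {..<3}. case p of (B, j) \<Rightarrow> lift a b B j)"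
      proof clarify
        fix u c assume u: "u < n" "c < (3::nat)"
        have "\<Union>(P i) = ?V" using pclass_cover[OF _ pc[OF k(2)]] n by simp
        then obtain B where B: "B \<in> P i" "u \<in> B" using u by blast
        define j where "j = (c + 2 * offset a b B u) mod 3"
        have "(j + offset a b B u) mod 3 = (c + 3 * offset a b B u) mod 3" unfolding j_def by (simp add: mod_simps)
        then have "(u, c) \<in> lift a b B j" unfolding lift_def using B u by force
        moreover have "j < 3" unfolding j_def by simp
        ultimately show "(u, c) \<in> (\<Union>p\<in>P i \<times> {..<3}. case p of (B, j) \<Rightarrow> lift a b B j)" using B by force
      qed
      moreover have "finite (\<Union>p\<in>P i \<times> {..<3}. case p of (B, j) \<Rightarrow> lift a b B j)"
        using fP PT(1)[OF k(2)] unfolding lift_def by (auto intro: finite_subset)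
      ultimately show "3 * (card ?X div 3) \<le> card (\<Union>p\<in>P i \<times> {..<3}. case p of (B, j) \<Rightarrow> lift a b B j)"
        using card_mono[of "(\<Union>p\<in>P i \<times> {..<3}. case p of (B, j) \<Rightarrow> lift a b B j)" ?X] cX by simp
    qed
    then show "pclass ?X (Q k)" unfolding Q_def k by simp
    show "meet_once (Q k) (Q (case k of (i, a, b) \<Rightarrow> (s i, a, b)))"
    proof (rule meet_onceI)
      fix S T x y assume "S \<in> Q k" "T \<in> Q (case k of (i, a, b) \<Rightarrow> (s i, a, b))"
        and xy: "x \<in> S" "x \<in> T" "y \<in> S" "y \<in> T"
      then obtain B C j j' where BC: "B \<in> P i" "S = lift a b B j" "C \<in> P (s i)" "T = lift a b C j'"
        unfolding Q_def k by auto
      obtain u c v d where e: "x = (u, c)" "y = (v, d)" by (cases x, cases y)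
      have "u \<in> B" "u \<in> C" "v \<in> B" "v \<in> C" "c = (j + offset a b B u) mod 3" "d = (j + offset a b B v) mod 3"
        using xy lift_fst unfolding e BC by blast+
      moreover from this have "u = v" using meet_onceD[OF mo[OF k(2)] BC(1,3)] by blast
      ultimately show "x = y" unfolding e by simp
    qed
  next
    fix T assume "T \<in> {T. T \<in> triples ?X \<and> inj_on fst T}"
    then have T: "T \<subseteq> ?X" "card T = 3" "inj_on fst T" unfolding triples_def by auto
    define f where "f u = snd (the_inv_into T fst u)" for u
    have Tf: "T = (\<lambda>u. (u, f u)) ` (fst ` T)"
      unfolding f_def image_image using the_inv_into_f_f[OF T(3)] by auto
    have cB: "card (fst ` T) = 3" using T card_image by metis
    have "fst ` T \<in> triples ?V" unfolding triples_def using cB T(1) by auto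
    then obtain i where i: "i \<in> I" "fst ` T \<in> P i" using cov by blast
    have "f u < 3" if "u \<in> fst ` T" for u using Tf T(1) that by blast
    then obtain a b j where "a < 3" "b < 3" "j < 3" "T = lift a b (fst ` T) j" using lift_surj[OF cB Tf] by blast
    then show "\<exists>k\<in>I \<times> {..<3} \<times> {..<3}. T \<in> Q k" using i unfolding Q_def 
      by (intro bexI[of _ "(i, a, b)"]) (auto intro!: image_eqI[of _ _ "(fst ` T, j)"])
  qed
  define P0 where "P0 = (\<lambda>x. {x} \<times> {..<3::nat}) ` ?V"
  have pcP0: "pclass ?X P0" unfolding P0_def
  proof (rule pclass_familyI[OF fX])
    have "(\<Union>x\<in>?V. {x} \<times> {..<3::nat}) = ?X" by auto
    then show "3 * (card ?X div 3) \<le> card (\<Union>x\<in>?V. {x} \<times> {..<3::nat})" using cX by simp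
  qed (use cX in \<open>auto simp: card_cartesian_product\<close>)
  have "triples ?V \<noteq> {}" using card_triples[of ?V] n by (auto simp: binomial_eq_0_iff)
  then obtain i0 where i0: "i0 \<in> I" using cov by blast
  \<comment> \<open>A lift has one point in each column it meets, so the class of whole columns fits
    after any lifted class.\<close>
  have mP0: "meet_once (Q k) P0" for k
  proof (rule meet_onceI)
    fix S T x y assume "S \<in> Q k" "T \<in> P0" and xy: "x \<in> S" "x \<in> T" "y \<in> S" "y \<in> T"
    then obtain a b B j where S: "S = lift a b B j" unfolding Q_def by (auto simp: case_prod_unfold)
    have "fst x = fst y" using xy \<open>T \<in> P0\<close> unfolding P0_def by auto
    then show "x = y" using xy(1,3) lift_fst unfolding S by (metis prod.collapse)
  qed
  have part1: "linked ?X (card (I \<times> {..<3::nat} \<times> {..<3::nat}) + card {()})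
      ({T. T \<in> triples ?X \<and> inj_on fst T} \<union> (\<Union>j\<in>{()}. P0))"
    by (rule linked_insert[OF lifts, where h = "\<lambda>_. (i0, 0, 0)"])
       (use i0 pcP0 mP0 meet_once_sym[OF mP0] in auto)
  \<comment> \<open>In the class (d, u, v) the column of \<open>x\<close> gives its point of height
    \<open>m d u v x\<close> to the block based at the column x - d and keeps the other two. Because
    the height is affine in a colouring that separates x from x + d, the heights at these two
    columns can be prescribed independently.\<close>
  define m where "m d u v x = (u + v * derange_col n d x) mod 3" for d u v x :: nat
  define F where "F d u v x = Pair x ` ({..<3} - {m d u v x}) \<union> {((x + d) mod n, m d u v ((x + d) mod n))}" for d u v x
  define R where "R = (\<lambda>(d, u, v). F d u v ` ?V)"
  have m3: "m d u v x < 3" for d u v x unfolding m_def by simp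
  have F_iff: "(a, c) \<in> F d u v x \<longleftrightarrow> a = x \<and> c < 3 \<and> c \<noteq> m d u v x \<or> a = (x + d) mod n \<and> c = m d u v a" for a c d u v x
    unfolding F_def by auto
  have shift_ne: "(x + d) mod n \<noteq> x" if "x < n" "0 < d" "d < n" for x d
    using that by (cases "x + d < n") (auto simp: mod_if)
  have sback: "((x + (n - d)) mod n + d) mod n = x" if "x < n" "d < n" for x d
  proof -
    have "((x + (n - d)) mod n + d) mod n = (x + (n - d) + d) mod n" by (simp add: mod_simps)
    then show ?thesis using that by simp
  qed
  have part2: "linked ?X (card ({1..<n} \<times> {..<3::nat} \<times> {..<3::nat}))
     {T \<in> triples ?X. \<exists>x y c c' e. x \<noteq> y \<and> c \<noteq> c' \<and> T = {(x, c), (x, c'), (y, e)}}"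
  proof (rule linkedI[OF _ refl])
    show "linked_family ?X ({1..<n} \<times> {..<3} \<times> {..<3}) R (\<lambda>(d, u, v). (d, (u + 1) mod 3, v))
       {T \<in> triples ?X. \<exists>x y c c' e. x \<noteq> y \<and> c \<noteq> c' \<and> T = {(x, c), (x, c'), (y, e)}}"
      unfolding linked_family_def
    proof (intro conjI ballI)
      show "finite ({1..<n} \<times> {..<3::nat} \<times> {..<3::nat})" by simp
      let ?I = "{1..<n} \<times> {..<3::nat} \<times> {..<3::nat}" and ?s = "\<lambda>(d, u, v). (d, (u + 1) mod 3, v)"
      have "inj_on ?s ?I"
      proof (rule inj_onI, clarsimp)
        fix u u' :: nat assume "u < 3" "u' < 3" "Suc u mod 3 = Suc u' mod 3"
        then show "u = u'" by presburger
      qed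
      moreover have "?s ` ?I \<subseteq> ?I" by auto
      ultimately show "bij_betw ?s ?I ?I" unfolding bij_betw_def using endo_inj_surj[of ?I ?s] by blast
    next
      fix k assume "k \<in> {1..<n} \<times> {..<3::nat} \<times> {..<3::nat}"
      then obtain d u v where k: "k = (d, u, v)" "0 < d" "d < n" "u < 3" "v < 3" by auto
      have "pclass ?X (F d u v ` ?V)"
      proof (rule pclass_familyI[OF fX])
        show "card ?V = card ?X div 3" using cX by simp
        fix x assume x: "x \<in> ?V"
        have "card (F d u v x) \<le> card (Pair x ` ({..<3} - {m d u v x})) + card {((x + d) mod n, m d u v ((x + d) mod n))}"
          unfolding F_def by (rule card_Un_le)
        also have "\<dots> \<le> 3" using m3[of d u v x] by (simp add: card_image inj_on_def)
        finally show "F d u v x \<subseteq> ?X \<and> card (F d u v x) \<le> 3" using x m3 unfolding F_def by auto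
      next
        have sub: "?X \<subseteq> (\<Union>x\<in>?V. F d u v x)"
        proof clarify
          fix x c assume xc: "x < n" "c < (3::nat)"
          show "(x, c) \<in> (\<Union>x\<in>?V. F d u v x)"
          proof (cases "c = m d u v x")
            case True
            then have "(x, c) \<in> F d u v ((x + (n - d)) mod n)" using sback[OF xc(1) k(3)] unfolding F_iff by auto
            moreover have "(x + (n - d)) mod n \<in> ?V" using n by simp
            ultimately show ?thesis by blast
          next
            case False
            then have "(x, c) \<in> F d u v x" using xc unfolding F_iff by auto
            then show ?thesis using xc by blast
          qed
        qed
        have "finite (\<Union>x\<in>?V. F d u v x)" unfolding F_def by auto
        then show "3 * (card ?X div 3) \<le> card (\<Union>x\<in>?V. F d u v x)" using card_mono[OF _ sub] cX by simp
      qed simp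
      then show "pclass ?X (R k)" unfolding R_def k by simp
      have m': "m d ((u + 1) mod 3) v x \<noteq> m d u v x" for x
      proof -
        have "m d ((u + 1) mod 3) v x = (m d u v x + 1) mod 3" unfolding m_def by (simp add: mod_simps)
        moreover have "(z + 1) mod 3 \<noteq> z" if "z < 3" for z :: nat using that by presburger
        ultimately show ?thesis using m3 by simp
      qed
      \<comment> \<open>As \<open>n\<close> is odd, two columns at difference \<open>d\<close> occur
        in one order only, so blocks with the same two columns have the same base column.\<close>
      have no2: "(((x + d) mod n) + d) mod n \<noteq> x" if "x < n" for x
      proof
        assume "((x + d) mod n + d) mod n = x"
        then have "(x + 2 * d) mod n = x mod n" using that by (simp add: mod_simps mult_2 add.assoc)
        then have "n dvd 2 * d" by (metis add_diff_cancel_left' le_add1 mod_eq_dvd_iff_nat)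
        then have "n dvd d" using n(1) by (simp add: coprime_dvd_mult_right_iff)
        then show False using k(2,3) by (auto dest: dvd_imp_le)
      qed
      have "meet_once (F d u v ` ?V) (F d ((u + 1) mod 3) v ` ?V)"
      proof (rule meet_onceI)
        fix S T p p' assume "S \<in> F d u v ` ?V" "T \<in> F d ((u + 1) mod 3) v ` ?V"
          and pp: "p \<in> S" "p \<in> T" "p' \<in> S" "p' \<in> T"
        then obtain x z where S: "S = F d u v x" "x < n" and T: "T = F d ((u + 1) mod 3) v z" "z < n" by auto
        obtain a c a' c' where e: "p = (a, c)" "p' = (a', c')" by (cases p, cases p')
        let ?m = "m d u v" and ?m' = "m d ((u + 1) mod 3) v"
        let ?f = "\<lambda>x. (x + d) mod n"
        have A: "a = x \<and> c < 3 \<and> c \<noteq> ?m x \<or> a = ?f x \<and> c = ?m a"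
          "a = z \<and> c < 3 \<and> c \<noteq> ?m' z \<or> a = ?f z \<and> c = ?m' a"
          "a' = x \<and> c' < 3 \<and> c' \<noteq> ?m x \<or> a' = ?f x \<and> c' = ?m a'"
          "a' = z \<and> c' < 3 \<and> c' \<noteq> ?m' z \<or> a' = ?f z \<and> c' = ?m' a'"
          using pp unfolding e S(1) T(1) F_iff by auto
        \<comment> \<open>Over a common base column consecutive classes omit different heights, so
          their blocks share exactly one point there; in the other column their points have
          different heights.\<close>
        have third: "c = c'" if "c < 3" "c' < 3" "c \<noteq> i" "c' \<noteq> i" "c \<noteq> j" "c' \<noteq> j" "i < 3" "j < 3" "i \<noteq> j" for i j
          using that by presburger
        have nex: "?f x \<noteq> x" "?f z \<noteq> z" "?f (?f x) \<noteq> x" "?f (?f z) \<noteq> z" 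
          using shift_ne no2 S T k by auto
        show "p = p'"
        proof (cases "a = a'")
          case True
          have "c = c'"
          proof (cases "a = x \<and> a = z")
            case t: True
            then show ?thesis using A nex m'[of x] third[of "?m x" "?m' x"] m3 True by auto
          qed (use A nex True in auto)
          then show ?thesis unfolding e using True by simp
        next
          case False
          then have f: "a = x \<and> a' = ?f x \<or> a = ?f x \<and> a' = x" "a = z \<and> a' = ?f z \<or> a = ?f z \<and> a' = z" using A by auto
          then have "x = z" using nex by metis
          then have "c = ?m a \<and> c = ?m' a \<or> c' = ?m a' \<and> c' = ?m' a'" using A f nex by metis
          then show ?thesis using m' by metis
        qed
      qed
      then show "meet_once (R k) (R (case k of (d, u, v) \<Rightarrow> (d, (u + 1) mod 3, v)))" unfolding R_def k by simp
    next
      fix T assume "T \<in> {T \<in> triples ?X. \<exists>x y c c' e. x \<noteq> y \<and> c \<noteq> c' \<and> T = {(x, c), (x, c'), (y, e)}}"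
      then obtain x y c c' e where T: "x \<noteq> y" "c \<noteq> c'" "T = {(x, c), (x, c'), (y, e)}" and TX: "T \<subseteq> ?X" 
        unfolding triples_def by blast
      have r: "x < n" "y < n" "c < 3" "c' < 3" "e < 3" using TX unfolding T by auto
      define d where "d = (y + (n - x)) mod n"
      have d: "(x + d) mod n = y"
      proof -
        have "(x + d) mod n = (x + (y + (n - x))) mod n" unfolding d_def by (simp add: mod_simps)
        also have "x + (y + (n - x)) = y + n" using r by simp
        finally show ?thesis using r by simp
      qed
      have d0: "0 < d" "d < n" using d T(1) r unfolding d_def by (auto intro: gr0I)
      \<comment> \<open>The heights 0, 1, 2 sum to 3, so this is the height omitted in the column of
        \<open>x\<close>.\<close>
      define k where "k = 3 - c - c'"
      have k: "k < 3" "{..<3} - {k} = {c, c'}" using r T(2) unfolding k_def by (auto, presburger+)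
      obtain u v where uv: "u < 3" "v < 3" "(u + v * derange_col n d x) mod 3 = k" "(u + v * derange_col n d y) mod 3 = e"
        using solve_mod3[OF derange_col_lt derange_col_lt k(1) r(5)] derange_col_proper[OF d0 n(1) r(1)] d by metis
      have "T = F d u v x" unfolding F_def d T using uv k(2) by (auto simp: m_def)
      then show "\<exists>k\<in>{1..<n} \<times> {..<3} \<times> {..<3}. T \<in> R k"
        using uv d0 r unfolding R_def by (intro bexI[of _ "(d, u, v)"]) auto
    qed
  qed
  have "triples ?X \<subseteq> ({T. T \<in> triples ?X \<and> inj_on fst T} \<union> (\<Union>j\<in>{()}. P0)) \<union>
     {T \<in> triples ?X. \<exists>x y c c' e. x \<noteq> y \<and> c \<noteq> c' \<and> T = {(x, c), (x, c'), (y, e)}}"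
  proof
    fix T assume T: "T \<in> triples ?X"
    then have "card T = 3" "T \<subseteq> ?X" unfolding triples_def by auto
    then obtain p q r where pqr: "T = {p, q, r}" "p \<noteq> q" "p \<noteq> r" "q \<noteq> r" by (auto simp: card_3_iff)
    obtain x c y d z e where e: "p = (x, c)" "q = (y, d)" "r = (z, e)" by (cases p, cases q, cases r)
    have bnd: "x < n" "c < 3" "d < 3" "e < 3" using \<open>T \<subseteq> ?X\<close> unfolding pqr e by auto
    consider "x \<noteq> y" "x \<noteq> z" "y \<noteq> z" | "x = y" "y = z" | "x = y" "x \<noteq> z" | "x = z" "x \<noteq> y" | "y = z" "x \<noteq> y" by blast
    then show "T \<in> ({T. T \<in> triples ?X \<and> inj_on fst T} \<union> (\<Union>j\<in>{()}. P0)) \<union>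
     {T \<in> triples ?X. \<exists>x y c c' e. x \<noteq> y \<and> c \<noteq> c' \<and> T = {(x, c), (x, c'), (y, e)}}"
    proof cases
      case 1
      then have "inj_on fst T" unfolding pqr e by auto
      then show ?thesis using T by blast
    next
      case 2
      have "{c, d, e} = {..<3}" 
        by (rule card_subset_eq) (use bnd pqr 2 in \<open>auto simp: e\<close>)
      then have "T = {x} \<times> {..<3}" unfolding pqr e using 2 by auto
      then show ?thesis using bnd unfolding P0_def by auto
    next
      case 3
      then have "x \<noteq> z \<and> c \<noteq> d \<and> T = {(x, c), (x, d), (z, e)}" using pqr e by auto
      then show ?thesis using T by blast
    next
      case 4
      then have "x \<noteq> y \<and> c \<noteq> e \<and> T = {(x, c), (x, e), (y, d)}" using pqr e by auto
      then show ?thesis using T by blast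
    next
      case 5
      then have "y \<noteq> x \<and> d \<noteq> e \<and> T = {(y, d), (y, e), (x, c)}" using pqr e by auto
      then show ?thesis using T by blast
    qed
  qed
  then have L': "linked ?X (card (I \<times> {..<3::nat} \<times> {..<3::nat}) + card {()} + card ({1..<n} \<times> {..<3::nat} \<times> {..<3::nat})) (triples ?X)"
    using linked_mono[OF linked_Un[OF part1 part2]] by blast
  define M k where "M = card I" and "k = n div 3"
  have nk: "n = 3 * k" "k > 0" using n unfolding k_def by auto
  define l where "l = n - 2"
  have l: "n = Suc (Suc l)" using n(3) by (simp add: l_def)
  have "6 * (M * k) = n * (n - 1) * (n - 2)" using cI choose_three[of n] unfolding M_def k_def by simp
  also have "\<dots> = 3 * k * ((n - 1) * (n - 2))" using nk by simp
  finally have "3 * k * (2 * M) = 3 * k * ((n - 1) * (n - 2))" by simp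
  then have M2: "2 * M = (l + 1) * l" using nk(2) l by simp
  have "card (I \<times> {..<3::nat} \<times> {..<3::nat}) + card {()} + card ({1..<n} \<times> {..<3::nat} \<times> {..<3::nat}) = 9 * M + 1 + 9 * (l + 1)"
    unfolding M_def using l by (simp add: card_cartesian_product)
  moreover have "(9 * M + 1 + 9 * (l + 1)) * n = 3 * n choose 3"
  proof -
    have "2 * (9 * M + 1 + 9 * (l + 1)) = 9 * (2 * M) + 18 * l + 20" by simp
    also have "\<dots> = (3 * l + 5) * (3 * l + 4)" unfolding M2 by (simp add: algebra_simps)
    finally have "2 * (9 * M + 1 + 9 * (l + 1)) = (3 * n - 1) * (3 * n - 2)" unfolding l by (simp add: add.commute)
    then have "6 * ((9 * M + 1 + 9 * (l + 1)) * n) = 3 * n * ((3 * n - 1) * (3 * n - 2))" by simp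
    also have "\<dots> = 6 * (3 * n choose 3)" unfolding choose_three by simp
    finally show ?thesis by simp
  qed
  ultimately show ?thesis using L' fX cX by (intro resolvedI[OF L']) auto
qed

section \<open>The nine-fold construction\<close>

text \<open>Near parallel classes \<open>{\<infinity>, a, b}, B, C\<close> on the affine plane of order three with an extra point
  \<open>\<infinity>\<close>, each missing \<open>x\<close>, listed as \<open>(x, a, b, B, C)\<close>: an overlarge set of Kirkman triple systems,
  without the classes of lines, which miss \<open>\<infinity>\<close>.\<close>

definition near_classes :: "(nat \<times> nat \<times> nat \<times> (nat \<times> nat \<times> nat) \<times> (nat \<times> nat \<times> nat)) list" where
  "near_classes =
    [(0, 1, 2, (3, 4, 6), (5, 7, 8)), (1, 2, 0, (4, 5, 7), (3, 6, 8)),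
    (2, 0, 1, (3, 5, 8), (4, 6, 7)), (3, 4, 5, (0, 6, 7), (1, 2, 8)),
    (4, 5, 3, (1, 7, 8), (0, 2, 6)), (5, 3, 4, (2, 6, 8), (0, 1, 7)),
    (6, 7, 8, (0, 1, 3), (2, 4, 5)), (7, 8, 6, (1, 2, 4), (0, 3, 5)),
    (8, 6, 7, (0, 2, 5), (1, 3, 4)), (0, 3, 6, (1, 2, 5), (4, 7, 8)),
    (1, 4, 7, (0, 2, 3), (5, 6, 8)), (2, 5, 8, (0, 1, 4), (3, 6, 7)),
    (3, 6, 0, (4, 5, 8), (1, 2, 7)), (4, 7, 1, (3, 5, 6), (0, 2, 8)),
    (5, 8, 2, (3, 4, 7), (0, 1, 6)), (6, 0, 3, (2, 7, 8), (1, 4, 5)),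
    (7, 1, 4, (0, 6, 8), (2, 3, 5)), (8, 2, 5, (1, 6, 7), (0, 3, 4)),
    (0, 4, 8, (1, 2, 3), (5, 6, 7)), (1, 5, 6, (0, 2, 4), (3, 7, 8)),
    (2, 3, 7, (0, 1, 5), (4, 6, 8)), (3, 7, 2, (4, 5, 6), (0, 1, 8)),
    (4, 8, 0, (3, 5, 7), (1, 2, 6)), (5, 6, 1, (3, 4, 8), (0, 2, 7)),
    (6, 1, 5, (0, 7, 8), (2, 3, 4)), (7, 2, 3, (1, 6, 8), (0, 4, 5)),
    (8, 0, 4, (2, 6, 7), (1, 3, 5)), (0, 5, 7, (1, 3, 6), (2, 4, 8)),
    (1, 3, 8, (2, 4, 7), (0, 5, 6)), (2, 4, 6, (0, 5, 8), (1, 3, 7)),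
    (3, 8, 1, (0, 4, 6), (2, 5, 7)), (4, 6, 2, (1, 5, 7), (0, 3, 8)),
    (5, 7, 0, (2, 3, 8), (1, 4, 6)), (6, 2, 4, (0, 3, 7), (1, 5, 8)),
    (7, 0, 5, (1, 4, 8), (2, 3, 6)), (8, 1, 3, (2, 5, 6), (0, 4, 7))]"

text \<open>The twelve lines in their four directions. Together with the 36 near classes these are
  40 classes of three blocks, as many blocks as there are triples of ten points.\<close>

definition line_classes :: "(nat \<times> nat \<times> nat) list list" where
  "line_classes =
    [[(0, 3, 6), (1, 4, 7), (2, 5, 8)],
     [(0, 1, 2), (3, 4, 5), (6, 7, 8)],
     [(0, 4, 8), (1, 5, 6), (2, 3, 7)],
     [(0, 5, 7), (1, 3, 8), (2, 4, 6)]]"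

lemma near_classes_distinct:
  "(x, a, b, (u1, u2, u3), (v1, v2, v3)) \<in> set near_classes \<Longrightarrow>
     distinct [x, a, b, u1, u2, u3, v1, v2, v3] \<and> set [x, a, b, u1, u2, u3, v1, v2, v3] = {..<9}"
proof -
  have "list_all (\<lambda>(x, a, b, (u1, u2, u3), (v1, v2, v3)).
    distinct [x, a, b, u1, u2, u3, v1, v2, v3] \<and> list_all (\<lambda>y. y < 9) [x, a, b, u1, u2, u3, v1, v2, v3]) near_classes"
    by code_simp
  moreover assume "(x, a, b, (u1, u2, u3), (v1, v2, v3)) \<in> set near_classes"
  ultimately have d: "distinct [x, a, b, u1, u2, u3, v1, v2, v3]"
    and s: "set [x, a, b, u1, u2, u3, v1, v2, v3] \<subseteq> {..<9}" unfolding list_all_iff by fastforce+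
  have "card (set [x, a, b, u1, u2, u3, v1, v2, v3]) = card {..<9::nat}" unfolding distinct_card[OF d] by simp
  then have "set [x, a, b, u1, u2, u3, v1, v2, v3] = {..<9}" using s by (intro card_subset_eq) auto
  then show ?thesis using d by blast
qed

lemma nine_cases: "(z::nat) < 9 \<Longrightarrow> z \<in> set [0,1,2,3,4,5,6,7,8]"
  by auto

lemma near_classes_pair:
  assumes "a < 9" "b < 9" "a \<noteq> b"
  shows "\<exists>x B C. (x, a, b, B, C) \<in> set near_classes \<or> (x, b, a, B, C) \<in> set near_classes"
proof -
  have "list_all (\<lambda>a. list_all (\<lambda>b. a = b \<or> list_ex (\<lambda>(x, a', b', _). a' = a \<and> b' = b \<or> a' = b \<and> b' = a) near_classes)
     [0,1,2,3,4,5,6,7,8]) [0,1,2,3,4,5,6,7,8]" by code_simp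
  then have "list_ex (\<lambda>(x, a', b', _). a' = a \<and> b' = b \<or> a' = b \<and> b' = a) near_classes"
    using nine_cases[OF assms(1)] nine_cases[OF assms(2)] assms(3) unfolding list_all_iff by blast
  then show ?thesis unfolding list_ex_iff by fastforce
qed

lemma near_classes_missing:
  assumes "a < 9" "x < 9" "a \<noteq> x"
  shows "\<exists>b B C. (x, a, b, B, C) \<in> set near_classes \<or> (x, b, a, B, C) \<in> set near_classes"
proof -
  have "list_all (\<lambda>a. list_all (\<lambda>x. a = x \<or> list_ex (\<lambda>(x', a', b', _). x' = x \<and> (a' = a \<or> b' = a)) near_classes)
     [0,1,2,3,4,5,6,7,8]) [0,1,2,3,4,5,6,7,8]" by code_simp
  then have "list_ex (\<lambda>(x', a', b', _). x' = x \<and> (a' = a \<or> b' = a)) near_classes"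
    using nine_cases[OF assms(1)] nine_cases[OF assms(2)] assms(3) unfolding list_all_iff by blast
  then show ?thesis unfolding list_ex_iff by fastforce
qed

lemma near_classes_triple:
  assumes "x < y" "y < z" "z < 9"
  shows "(x, y, z) \<in> set (concat line_classes) \<or>
    (\<exists>p a b B. (p, a, b, (x, y, z), B) \<in> set near_classes \<or> (p, a, b, B, (x, y, z)) \<in> set near_classes)"
proof -
  have "list_all (\<lambda>x. list_all (\<lambda>y. list_all (\<lambda>z. \<not> x < y \<or> \<not> y < z \<or>
     list_ex (\<lambda>L. L = (x, y, z)) (concat line_classes) \<or>
     list_ex (\<lambda>(_, _, _, B, C). B = (x, y, z) \<or> C = (x, y, z)) near_classes)
     [0,1,2,3,4,5,6,7,8]) [0,1,2,3,4,5,6,7,8]) [0,1,2,3,4,5,6,7,8]" by code_simp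
  moreover have "x < 9" "y < 9" using assms by auto
  ultimately have "list_ex (\<lambda>L. L = (x, y, z)) (concat line_classes) \<or>
     list_ex (\<lambda>(_, _, _, B, C). B = (x, y, z) \<or> C = (x, y, z)) near_classes"
    using nine_cases[of x] nine_cases[of y] nine_cases[OF assms(3)] assms(1,2) unfolding list_all_iff by blast
  then show ?thesis unfolding list_ex_iff by fastforce
qed

text \<open>The points are \<open>(c, i)\<close> with \<open>c < 9\<close> and \<open>0 \<le> i < w\<close>, and the extra point \<open>(9, 0)\<close>.\<close>

definition nine_points :: "int \<Rightarrow> (nat \<times> int) set" where
  "nine_points w = {..<9} \<times> {0..<w} \<union> {(9, 0)}"

lemma nine_points_finite: "finite (nine_points w)"
  unfolding nine_points_def by simp

lemma nine_points_card: "card (nine_points w) = 9 * nat w + 1"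
proof -
  have "card (nine_points w) = card ({..<9::nat} \<times> {0..<w}) + card {(9::nat, 0::int)}"
    unfolding nine_points_def by (rule card_Un_disjoint) auto
  then show ?thesis by (simp add: card_cartesian_product)
qed

lemma nine_pclassI:
  assumes w: "w > 0" and J: "finite J" "card J = 3 * nat w"
    and F: "\<And>j. j \<in> J \<Longrightarrow> F j \<subseteq> nine_points w \<and> card (F j) \<le> 3"
    and cov: "nine_points w - {p} \<subseteq> (\<Union>j\<in>J. F j)"
  shows "pclass (nine_points w) (F ` J)"
proof (rule pclass_familyI[OF nine_points_finite J(1)])
  have e: "card (nine_points w) div 3 = 3 * nat w" unfolding nine_points_card by simp
  then show "card J = card (nine_points w) div 3" using J by simp
  show "F j \<subseteq> nine_points w \<and> card (F j) \<le> 3" if "j \<in> J" for j using F[OF that] .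
  have "finite (\<Union>j\<in>J. F j)" using J(1) F finite_subset[OF _ nine_points_finite] by blast
  then have "card (nine_points w - {p}) \<le> card (\<Union>j\<in>J. F j)" using cov by (rule card_mono)
  moreover have "card (nine_points w) - 1 \<le> card (nine_points w - {p})" by (simp add: card_Diff_singleton_if)
  ultimately show "3 * (card (nine_points w) div 3) \<le> card (\<Union>j\<in>J. F j)"
    unfolding e using nine_points_card[of w] by linarith
qed

section \<open>Near classes with every point of the plane replaced by a column of w points\<close>

lemma half_difference:
  fixes w :: int
  assumes "odd w" "0 \<le> i" "i < w" "0 \<le> s" "s < w" "i \<noteq> s"
  shows "\<exists>d\<in>{1..(w-1) div 2}. i = (s + d) mod w \<or> i = (s - d) mod w"
proof -
  define e where "e = (i - s) mod w"
  have e: "(s + e) mod w = i" unfolding e_def using assms by (simp add: mod_simps)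
  have "e \<noteq> 0" using e assms by auto
  moreover have "0 \<le> e" "e < w" unfolding e_def using assms by auto
  ultimately have er: "1 \<le> e" "e < w" by auto
  show ?thesis
  proof (cases "e \<le> (w - 1) div 2")
    case True
    then show ?thesis using er e by (intro bexI[of _ e]) auto
  next
    case False
    have "(s - (w - e)) mod w = (s + e - w) mod w" by (simp add: algebra_simps)
    then have "(s - (w - e)) mod w = i" using e by simp
    moreover have "w - e \<in> {1..(w-1) div 2}" using False er assms(1) by (auto, presburger)
    ultimately show ?thesis by (intro bexI[of _ "w - e"]) auto
  qed
qed

text \<open>Going round the cycle of odd length \<open>w\<close>, exactly one of the two distances
  between \<open>p\<close> and \<open>q\<close> is even; \<open>s\<close> is the middle of that
  arc.\<close>

lemma midpoint:
  fixes w :: int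
  assumes w: "odd w" and p: "0 \<le> p" "p < w" and q: "0 \<le> q" "q < w" and ne: "p \<noteq> q"
  shows "\<exists>s\<in>{0..<w}. \<exists>d\<in>{1..(w-1) div 2}. {p, q} = {(s + d) mod w, (s - d) mod w}"
proof -
  have aux: "\<exists>s\<in>{0..<w}. \<exists>d\<in>{1..(w-1) div 2}. {p, q} = {(s + d) mod w, (s - d) mod w}"
    if "0 \<le> p" "p < q" "q < w" for p q
  proof (cases "even (q - p)")
    case True
    then obtain d where d: "q - p = 2 * d" by blast
    then have "p = p + d - d" "q = p + d + d" "p + d < w" "1 \<le> d" "d \<le> (w - 1) div 2" using that by auto
    then show ?thesis using that by (intro bexI[of _ "p + d"] bexI[of _ d]) auto
  next
    case False
    then have "even (w - (q - p))" using w by simp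
    then obtain d where d: "w - (q - p) = 2 * d" by blast
    define s where "s = (q + d) mod w"
    have "(s - d) mod w = q" unfolding s_def using that by (simp add: mod_simps)
    moreover have "(s + d) mod w = (p + w) mod w"
    proof -
      have "(s + d) mod w = (q + d + d) mod w" unfolding s_def by (simp add: mod_simps)
      moreover have "q + d + d = p + w" using d by simp
      ultimately show ?thesis by simp
    qed
    moreover have "1 \<le> d" "d \<le> (w - 1) div 2" using d that by auto
    ultimately show ?thesis using that by (intro bexI[of _ s] bexI[of _ d]) (auto simp: s_def)
  qed
  show ?thesis
  proof (cases "p < q")
    case False
    then have "\<exists>s\<in>{0..<w}. \<exists>d\<in>{1..(w-1) div 2}. {q, p} = {(s + d) mod w, (s - d) mod w}" using aux[of q p] p q ne by auto
    then show ?thesis by (simp add: insert_commute)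
  qed (use aux p q in auto)
qed

text \<open>The block {infinity, a, b} becomes one triple through infinity and two families of
  stars, symmetric pairs about \<open>s\<close> in column \<open>a\<close> and about
  \<open>t\<close> in column \<open>b\<close>, each completed by a point of column \<open>x\<close>.
  The other two blocks become transversals. Their third shift is \<open>- t\<close>: with
  \<open>+ t\<close> the difference between the second and third point would not change when
  \<open>s\<close> and \<open>t\<close> both grow by 2, and consecutive classes would share
  pairs.\<close>

fun near_block :: "int \<Rightarrow> nat \<times> nat \<times> nat \<times> (nat \<times> nat \<times> nat) \<times> (nat \<times> nat \<times> nat) \<Rightarrow>
    int \<Rightarrow> int \<Rightarrow> nat \<times> int \<Rightarrow> (nat \<times> int) set" where
  "near_block w (x, a, b, (u1, u2, u3), (v1, v2, v3)) s t (k, i) =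
     (if k = 0 then {(9, 0), (a, s), (b, t)}
      else if k = 1 then {(a, (s + i) mod w), (a, (s - i) mod w), (x, (s + t + i) mod w)}
      else if k = 2 then {(b, (t + i) mod w), (b, (t - i) mod w), (x, (s + t - i) mod w)}
      else if k = 3 then {(u1, i), (u2, (i + s) mod w), (u3, (i - t) mod w)}
      else {(v1, i), (v2, (i + s) mod w), (v3, (i - t) mod w)})"

definition near_index :: "int \<Rightarrow> (nat \<times> int) set" where
  "near_index w = {(0, 0)} \<union> {1, 2} \<times> {1..(w-1) div 2} \<union> {3, 4} \<times> {0..<w}"

lemma card_near_index:
  assumes "odd w" "w > 0"
  shows "finite (near_index w)" "card (near_index w) = 3 * nat w"
proof -
  show "finite (near_index w)" unfolding near_index_def by simp
  have "card (near_index w) = card ({(0::nat, 0::int)} \<union> {1, 2} \<times> {1..(w-1) div 2}) + card ({3, 4::nat} \<times> {0..<w})"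
    unfolding near_index_def by (rule card_Un_disjoint) auto
  also have "card ({(0::nat, 0::int)} \<union> {1, 2} \<times> {1..(w-1) div 2}) = 1 + card ({1, 2::nat} \<times> {1..(w-1) div 2})"
    by (subst card_Un_disjoint) auto
  finally have "card (near_index w) = 1 + 2 * nat ((w - 1) div 2) + 2 * nat w" by (simp add: card_cartesian_product)
  moreover have "1 + 2 * nat ((w - 1) div 2) = nat w" using assms by (auto elim!: oddE)
  ultimately show "card (near_index w) = 3 * nat w" by simp
qed

text \<open>This is where \<open>w \<ge> 9\<close> is used: coincidences between consecutive classes
  make \<open>w\<close> divide a small nonzero constant such as 2, 4 or 6.\<close>

lemma nine_not_dvd:
  fixes w c :: int
  assumes "w \<ge> 9" "0 < \<bar>c\<bar>" "\<bar>c\<bar> < 9"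
  shows "\<not> w dvd c"
  using assms zdvd_not_zless[of "\<bar>c\<bar>" w] by auto

lemma near_pclass:
  assumes w: "odd w" "w \<ge> 9" and e: "e \<in> set near_classes" and st: "s \<in> {0..<w}" "t \<in> {0..<w}"
  shows "pclass (nine_points w) (near_block w e s t ` near_index w)"
proof -
  obtain x a b u1 u2 u3 v1 v2 v3 where ee: "e = (x, a, b, (u1, u2, u3), (v1, v2, v3))" by (metis prod.exhaust)
  have ds: "set [x, a, b, u1, u2, u3, v1, v2, v3] = {..<9}" using near_classes_distinct[OF e[unfolded ee]] by blast
  have lt: "x < 9" "a < 9" "b < 9" "u1 < 9" "u2 < 9" "u3 < 9" "v1 < 9" "v2 < 9" "v3 < 9" using ds by auto
  have m: "0 \<le> z mod w" "z mod w < w" for z using w by auto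
  show ?thesis
  \<comment> \<open>In column \<open>x\<close> the stars about \<open>a\<close> take the positions s
    + t + i and those about \<open>b\<close> the positions s + t - i, for i from 1 to (w - 1) / 2.
    Only the position s + t is left over.\<close>
  proof (rule nine_pclassI[where p = "(x, (s + t) mod w)"])
    show "w > 0" using w by simp
    show "finite (near_index w)" "card (near_index w) = 3 * nat w" using card_near_index w by auto
    fix j assume j: "j \<in> near_index w"
    obtain k i where ki: "j = (k, i)" by (cases j)
    have "k \<ge> 3 \<Longrightarrow> 0 \<le> i \<and> i < w" using j unfolding ki near_index_def by auto
    then have "near_block w e s t j \<subseteq> nine_points w" using lt m st unfolding ki ee nine_points_def by auto
    moreover have "card {p, q, r} \<le> 3" for p q r :: "nat \<times> int" by (simp add: card_insert_if)
    then have "card (near_block w e s t j) \<le> 3" unfolding ki ee near_block.simps by (simp only: split: if_split) blast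
    ultimately show "near_block w e s t j \<subseteq> nine_points w \<and> card (near_block w e s t j) \<le> 3" by blast
  next
    let ?U = "\<Union>j\<in>near_index w. near_block w e s t j"
    have inU: "q \<in> ?U" if "j \<in> near_index w" "q \<in> near_block w e s t j" for q j using that by blast
    show "nine_points w - {(x, (s + t) mod w)} \<subseteq> ?U"
    proof
      fix q assume q: "q \<in> nine_points w - {(x, (s + t) mod w)}"
      show "q \<in> ?U"
      proof (cases "q = (9, 0)")
        case True
        then show ?thesis by (intro inU[of "(0, 0)"]) (auto simp: near_index_def ee)
      next
        case False
        then obtain c i where ci: "q = (c, i)" "c < 9" "0 \<le> i" "i < w" using q unfolding nine_points_def by auto
        then have "c \<in> set [x, a, b, u1, u2, u3, v1, v2, v3]" using ds by blast
        then consider "c = x" | "c = a" | "c = b" | "c = u1" | "c = u2" | "c = u3" | "c = v1" | "c = v2" | "c = v3" by auto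
        then show ?thesis
        proof cases
          case 1
          then have "i \<noteq> (s + t) mod w" using q ci by auto
          then obtain d where d: "d \<in> {1..(w-1) div 2}" "i = ((s + t) mod w + d) mod w \<or> i = ((s + t) mod w - d) mod w"
            using half_difference[OF w(1) ci(3,4) m, of "s + t"] by blast
          then have "i = (s + t + d) mod w \<or> i = (s + t - d) mod w" by (simp add: mod_simps)
          then show ?thesis
          proof
            assume "i = (s + t + d) mod w"
            then show ?thesis using d 1 by (intro inU[of "(1, d)"]) (auto simp: near_index_def ee ci)
          next
            assume "i = (s + t - d) mod w"
            then show ?thesis using d 1 by (intro inU[of "(2, d)"]) (auto simp: near_index_def ee ci)
          qed
        next
          case 2
          show ?thesis
          proof (cases "i = s")
            case True
            then show ?thesis using 2 by (intro inU[of "(0, 0)"]) (auto simp: near_index_def ee ci)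
          next
            case False
            then obtain d where d: "d \<in> {1..(w-1) div 2}" "i = (s + d) mod w \<or> i = (s - d) mod w"
              using half_difference[OF w(1) ci(3,4), of s] st by auto
            then show ?thesis using 2 by (intro inU[of "(1, d)"]) (auto simp: near_index_def ee ci)
          qed
        next
          case 3
          show ?thesis
          proof (cases "i = t")
            case True
            then show ?thesis using 3 by (intro inU[of "(0, 0)"]) (auto simp: near_index_def ee ci)
          next
            case False
            then obtain d where d: "d \<in> {1..(w-1) div 2}" "i = (t + d) mod w \<or> i = (t - d) mod w"
              using half_difference[OF w(1) ci(3,4), of t] st by auto
            then show ?thesis using 3 by (intro inU[of "(2, d)"]) (auto simp: near_index_def ee ci)
          qed
        next
          case 4 then show ?thesis using ci by (intro inU[of "(3, i)"]) (auto simp: near_index_def ee)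
        next
          case 5 then show ?thesis using ci m
            by (intro inU[of "(3, (i - s) mod w)"]) (auto simp: near_index_def ee mod_simps)
        next
          case 6 then show ?thesis using ci m
            by (intro inU[of "(3, (i + t) mod w)"]) (auto simp: near_index_def ee mod_simps)
        next
          case 7 then show ?thesis using ci by (intro inU[of "(4, i)"]) (auto simp: near_index_def ee)
        next
          case 8 then show ?thesis using ci m
            by (intro inU[of "(4, (i - s) mod w)"]) (auto simp: near_index_def ee mod_simps)
        next
          case 9 then show ?thesis using ci m
            by (intro inU[of "(4, (i + t) mod w)"]) (auto simp: near_index_def ee mod_simps)
        qed
      qed
    qed
  qed
qed

text \<open>Two common points in column \<open>c\<close> would have both sums 2 s and 2 s + 4. One
  common point in each column gives i - j = 4, and then either \<open>w\<close> divides 2 or 6, or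
  one of the two solutions j = -1, i = 3 and j = -3, i = 1 occurs, which \<open>ex\<close> rules
  out.\<close>

lemma star_meet:
  fixes w :: int
  assumes w: "odd w" "w \<ge> 9" and cy: "c \<noteq> y"
    and B: "B = {(c, (s + i) mod w), (c, (s - i) mod w), (y, (s + t + i) mod w)}"
    and C: "C = {(c, (s + 2 + j) mod w), (c, (s + 2 - j) mod w), (y, (s + 2 + (t + 2) + j) mod w)}"
    and ex: "\<not> (w dvd j + 1 \<and> w dvd i - 3)" "\<not> (w dvd j + 3 \<and> w dvd i - 1)"
    and pq: "p \<in> B" "p \<in> C" "q \<in> B" "q \<in> C"
  shows "p = q"
proof (rule ccontr)
  assume ne: "p \<noteq> q"
  have nd: "\<not> w dvd z" if "0 < \<bar>z\<bar>" "\<bar>z\<bar> < 9" for z using nine_not_dvd[OF w(2) that] .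
  have odd2: "w dvd z" if "w dvd 2 * z" for z
    using that w(1) by (metis coprime_dvd_mult_right_iff coprime_right_2_iff_odd)
  have D: "w dvd y - z" if "y mod w = z mod w" for y z using that by (simp add: mod_eq_dvd_iff)
  have mix: False if cp: "p' = (c, P)" and yq: "q' = (y, Q)" and in4: "p' \<in> B" "p' \<in> C" "q' \<in> B" "q' \<in> C" for p' q' P Q
  proof -
    have P1: "P = (s + i) mod w \<or> P = (s - i) mod w" and P2: "P = (s + 2 + j) mod w \<or> P = (s + 2 - j) mod w"
      and Q: "Q = (s + t + i) mod w" "Q = (s + 2 + (t + 2) + j) mod w"
      using in4 cy unfolding cp yq B C by auto
    have ij: "w dvd i - j - 4"
    proof -
      have "w dvd (s + t + i) - (s + 2 + (t + 2) + j)" using Q by (intro D) simp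
      then show ?thesis by (simp add: algebra_simps)
    qed
    from P1 P2 show False
    proof (elim disjE)
      assume "P = (s + i) mod w" "P = (s + 2 + j) mod w"
      then have "w dvd (s + i) - (s + 2 + j)" by (intro D) simp
      then have "w dvd (i - j - 4) - ((s + i) - (s + 2 + j))" using ij by (rule dvd_diff[rotated])
      moreover have "(i - j - 4) - ((s + i) - (s + 2 + j)) = -2" by simp
      ultimately show False using nd[of "-2"] by simp
    next
      assume "P = (s - i) mod w" "P = (s + 2 - j) mod w"
      then have "w dvd (s - i) - (s + 2 - j)" by (intro D) simp
      then have "w dvd (i - j - 4) + ((s - i) - (s + 2 - j))" using ij by (rule dvd_add[rotated])
      moreover have "(i - j - 4) + ((s - i) - (s + 2 - j)) = -6" by simp
      ultimately show False using nd[of "-6"] by simp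
    next
      assume "P = (s + i) mod w" "P = (s + 2 - j) mod w"
      then have 1: "w dvd (s + i) - (s + 2 - j)" by (intro D) simp
      then have "w dvd ((s + i) - (s + 2 - j)) - (i - j - 4)" using ij by (rule dvd_diff)
      moreover have "((s + i) - (s + 2 - j)) - (i - j - 4) = 2 * (j + 1)" by simp
      ultimately have "w dvd 2 * (j + 1)" by (simp only:)
      then have j: "w dvd j + 1" by (rule odd2)
      have "w dvd (i - j - 4) + (j + 1)" using ij j by (rule dvd_add)
      then show False using ex(1) j by simp
    next
      assume "P = (s - i) mod w" "P = (s + 2 + j) mod w"
      then have 1: "w dvd (s - i) - (s + 2 + j)" by (intro D) simp
      then have "w dvd ((s - i) - (s + 2 + j)) + (i - j - 4)" using ij by (rule dvd_add)
      moreover have "((s - i) - (s + 2 + j)) + (i - j - 4) = 2 * (- (j + 3))" by simp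
      ultimately have "w dvd 2 * (- (j + 3))" by (simp only:)
      then have "w dvd - (j + 3)" by (rule odd2)
      then have j: "w dvd j + 3" by (simp only: dvd_minus_iff)
      have "w dvd (i - j - 4) + (j + 3)" using ij j by (rule dvd_add)
      then show False using ex(2) j by simp
    qed
  qed
  have "fst p = c \<or> fst p = y" "fst q = c \<or> fst q = y" using pq unfolding B by auto
  then consider "fst p = c" "fst q = c" | "fst p = y" "fst q = y" | "fst p = c" "fst q = y" | "fst p = y" "fst q = c" by blast
  then show False
  proof cases
    case 1
    then obtain P Q where e: "p = (c, P)" "q = (c, Q)" by (cases p, cases q) auto
    then have PQ: "P \<noteq> Q" using ne by simp
    have PB: "P = (s + i) mod w \<and> Q = (s - i) mod w \<or> Q = (s + i) mod w \<and> P = (s - i) mod w"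
      using pq(1,3) cy PQ unfolding B e by auto
    have PC: "P = (s + 2 + j) mod w \<and> Q = (s + 2 - j) mod w \<or> Q = (s + 2 + j) mod w \<and> P = (s + 2 - j) mod w"
      using pq(2,4) cy PQ unfolding C e by auto
    have "(P + Q) mod w = (2 * s) mod w" using PB
    proof (elim disjE conjE)
      assume "P = (s + i) mod w" "Q = (s - i) mod w"
      then have "(P + Q) mod w = ((s + i) + (s - i)) mod w" by (simp only: mod_add_eq)
      then show ?thesis by simp
    next
      assume "Q = (s + i) mod w" "P = (s - i) mod w"
      then have "(P + Q) mod w = ((s - i) + (s + i)) mod w" by (simp only: mod_add_eq)
      then show ?thesis by simp
    qed
    moreover have "(P + Q) mod w = (2 * s + 4) mod w" using PC
    proof (elim disjE conjE)
      assume "P = (s + 2 + j) mod w" "Q = (s + 2 - j) mod w"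
      then have "(P + Q) mod w = ((s + 2 + j) + (s + 2 - j)) mod w" by (simp only: mod_add_eq)
      then show ?thesis by simp
    next
      assume "Q = (s + 2 + j) mod w" "P = (s + 2 - j) mod w"
      then have "(P + Q) mod w = ((s + 2 - j) + (s + 2 + j)) mod w" by (simp only: mod_add_eq)
      then show ?thesis by simp
    qed
    ultimately have "w dvd 2 * s - (2 * s + 4)" by (intro D) simp
    then show False using nd[of "-4"] by simp
  next
    case 2
    then show False using pq(1,3) ne cy unfolding B by auto
  next
    case 3
    then show False using mix[of p "snd p" q "snd q"] pq by (metis prod.collapse)
  next
    case 4
    then show False using mix[of q "snd q" p "snd p"] pq by (metis prod.collapse)
  qed
qed

text \<open>Two common points fix the difference between their two columns, and \<open>nd\<close>
  says that all three such differences have changed.\<close>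

lemma tri_meet:
  fixes w :: int
  assumes w: "w > 0" and c: "c1 \<noteq> c2" "c1 \<noteq> c3" "c2 \<noteq> c3"
    and ij: "i \<in> {0..<w}" "j \<in> {0..<w}"
    and B: "B = {(c1, i), (c2, (i + s) mod w), (c3, (i + t) mod w)}"
    and C: "C = {(c1, j), (c2, (j + s') mod w), (c3, (j + t') mod w)}"
    and nd: "\<not> w dvd s - s'" "\<not> w dvd t - t'" "\<not> w dvd (t - s) - (t' - s')"
    and pq: "p \<in> B" "p \<in> C" "q \<in> B" "q \<in> C"
  shows "p = q"
proof (rule ccontr)
  assume ne: "p \<noteq> q"
  have D: "w dvd y - z" if "y mod w = z mod w" for y z using that by (simp add: mod_eq_dvd_iff)
  have 12: "\<not> ((c1, a) \<in> B \<and> (c1, a) \<in> C \<and> (c2, b) \<in> B \<and> (c2, b) \<in> C)" for a b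
  proof
    assume "(c1, a) \<in> B \<and> (c1, a) \<in> C \<and> (c2, b) \<in> B \<and> (c2, b) \<in> C"
    then have "i = j" "(i + s) mod w = (j + s') mod w" using c unfolding B C by auto
    then have "w dvd (i + s) - (i + s')" by (intro D) simp
    then show False using nd(1) by simp
  qed
  have 13: "\<not> ((c1, a) \<in> B \<and> (c1, a) \<in> C \<and> (c3, b) \<in> B \<and> (c3, b) \<in> C)" for a b
  proof
    assume "(c1, a) \<in> B \<and> (c1, a) \<in> C \<and> (c3, b) \<in> B \<and> (c3, b) \<in> C"
    then have "i = j" "(i + t) mod w = (j + t') mod w" using c unfolding B C by auto
    then have "w dvd (i + t) - (i + t')" by (intro D) simp
    then show False using nd(2) by simp
  qed
  have 23: "\<not> ((c2, a) \<in> B \<and> (c2, a) \<in> C \<and> (c3, b) \<in> B \<and> (c3, b) \<in> C)" for a b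
  proof
    assume "(c2, a) \<in> B \<and> (c2, a) \<in> C \<and> (c3, b) \<in> B \<and> (c3, b) \<in> C"
    then have "(i + s) mod w = (j + s') mod w" "(i + t) mod w = (j + t') mod w" using c unfolding B C by auto
    then have "w dvd ((i + t) - (j + t')) - ((i + s) - (j + s'))" by (intro dvd_diff D)
    then show False using nd(3) by (simp add: algebra_simps)
  qed
  have fq: "fst p = c1 \<or> fst p = c2 \<or> fst p = c3" "fst q = c1 \<or> fst q = c2 \<or> fst q = c3" using pq unfolding B by auto
  have "fst p \<noteq> fst q" using pq(1,3) ne c unfolding B by auto
  then show False using fq 12[of "snd p" "snd q"] 12[of "snd q" "snd p"] 13[of "snd p" "snd q"] 13[of "snd q" "snd p"]
      23[of "snd p" "snd q"] 23[of "snd q" "snd p"] pq by (metis prod.collapse)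
qed

lemma near_meet_once:
  assumes w: "odd w" "w \<ge> 9" and e: "e \<in> set near_classes"
  shows "meet_once (near_block w e s t ` near_index w)
    (near_block w e ((s + 2) mod w) ((t + 2) mod w) ` near_index w)"
proof (rule meet_onceI, rule ccontr)
  obtain x a b u1 u2 u3 v1 v2 v3 where ee: "e = (x, a, b, (u1, u2, u3), (v1, v2, v3))" by (metis prod.exhaust)
  have dd: "distinct [x, a, b, u1, u2, u3, v1, v2, v3]" and ds: "set [x, a, b, u1, u2, u3, v1, v2, v3] = {..<9}"
    using near_classes_distinct[OF e[unfolded ee]] by blast+
  have ne9: "9 \<notin> set [x, a, b, u1, u2, u3, v1, v2, v3]" unfolding ds by simp
  fix B C p q assume "B \<in> near_block w e s t ` near_index w"
    "C \<in> near_block w e ((s + 2) mod w) ((t + 2) mod w) ` near_index w"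
    and pq: "p \<in> B" "p \<in> C" "q \<in> B" "q \<in> C" "p \<noteq> q"
  then obtain k i l j where B: "B = near_block w e s t (k, i)" "(k, i) \<in> near_index w"
    and C: "C = near_block w e ((s + 2) mod w) ((t + 2) mod w) (l, j)" "(l, j) \<in> near_index w" by auto
  have nd: "\<not> w dvd c" if "0 < \<bar>c\<bar>" "\<bar>c\<bar> < 9" for c using nine_not_dvd[OF w(2) that] .
  \<comment> \<open>The columns met by a block of kind \<open>k\<close>. Different kinds have at
    most one column in common, and there at least one of the two blocks has a single point, so only
    blocks of the same kind need a closer look.\<close>
  define lab where "lab k = (if k = 0 then {9, a, b} else if k = 1 then {a, x} else if k = 2 then {b, x}
     else if k = 3 then {u1, u2, u3} else {v1, v2, v3})" for k :: nat
  have lp: "fst r \<in> lab k" if "r \<in> near_block w e s t (k, i)" for r s t k i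
    using that unfolding ee near_block.simps lab_def by (simp split: if_splits) (auto)
  have uni: "r = r'" if "r \<in> near_block w e s t (k, i)" "r' \<in> near_block w e s t (k, i)" "fst r = fst r'"
    "k = 0 \<or> fst r = x" for r r' s t k i
    using that dd ne9 unfolding ee near_block.simps by (auto split: if_splits)
  have kl: "k = 0 \<or> k = 1 \<or> k = 2 \<or> k = 3 \<or> k = 4" "l = 0 \<or> l = 1 \<or> l = 2 \<or> l = 3 \<or> l = 4"
    using B(2) C(2) unfolding near_index_def by auto
  have kleq: "k = l"
  proof (rule ccontr)
    assume "k \<noteq> l"
    moreover have "fst p \<in> lab k" "fst p \<in> lab l" "fst q \<in> lab k" "fst q \<in> lab l"
      using pq lp unfolding B(1) C(1) by blast+
    ultimately have "fst p = fst q \<and> (fst p = x \<or> k = 0 \<or> l = 0)"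
      using kl dd ne9 unfolding lab_def by (elim disjE) auto
    then show False using uni pq unfolding B(1) C(1) by metis
  qed
  have rng: "1 \<le> i \<and> i \<le> (w - 1) div 2 \<and> 1 \<le> j \<and> j \<le> (w - 1) div 2" if "k = 1 \<or> k = 2"
    using that B(2) C(2) unfolding near_index_def kleq by auto
  have half: "\<not> w dvd i + 1 \<and> \<not> w dvd i + 3 \<and> \<not> w dvd j + 1 \<and> \<not> w dvd j + 3" if "k = 1 \<or> k = 2"
  proof -
    have "(w - 1) div 2 + 3 < w" using w(2) by linarith
    then have "i + 3 < w" "j + 3 < w" using rng[OF that] by linarith+
    then show ?thesis using rng[OF that] zdvd_not_zless[of "i + 1" w] zdvd_not_zless[of "i + 3" w]
        zdvd_not_zless[of "j + 1" w] zdvd_not_zless[of "j + 3" w] by linarith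
  qed
  have rng3: "i \<in> {0..<w}" "j \<in> {0..<w}" if "k = 3 \<or> k = 4"
    using that B(2) C(2) unfolding near_index_def kleq by auto
  have w0: "w > 0" using w by simp
  have c1: "((s + 2) mod w + (t + 2) mod w + z) mod w = (s + 2 + (t + 2) + z) mod w" for z
    by (intro mod_add_cong mod_add_eq refl)
  have c2: "((s + 2) mod w + (t + 2) mod w - z) mod w = (t + 2 + (s + 2) + - z) mod w" for z
    using c1[of "- z"] by (simp add: algebra_simps)
  note cs = c1 c2 mod_add_left_eq mod_add_right_eq mod_diff_left_eq mod_diff_right_eq
  from kl(1) show False
  proof (elim disjE)
    assume k: "k = 0"
    have ne: "y \<noteq> (y + 2) mod w" for y
    proof
      assume "y = (y + 2) mod w"
      then have "y mod w = (y + 2) mod w" by (metis mod_mod_trivial)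
      then have "w dvd y - (y + 2)" by (simp add: mod_eq_dvd_iff)
      then show False using nd[of "-2"] by simp
    qed
    have "r = (9, 0)" if "r \<in> B" "r \<in> C" for r
      using that ne[of s] ne[of t] dd ne9 unfolding B(1) C(1) ee kleq[symmetric] k by auto
    then show False using pq by blast
  next
    assume k: "k = 1"
    have BC: "B = {(a, (s + i) mod w), (a, (s - i) mod w), (x, (s + t + i) mod w)}"
      "C = {(a, (s + 2 + j) mod w), (a, (s + 2 - j) mod w), (x, (s + 2 + (t + 2) + j) mod w)}"
      unfolding B(1) C(1) ee kleq[symmetric] k near_block.simps cs by simp_all
    have ax: "a \<noteq> x" using dd by auto
    show False using star_meet[OF w ax BC _ _ pq(1-4)] half k pq(5) by blast
  next
    assume k: "k = 2"
    \<comment> \<open>A star about \<open>b\<close> has the shape of a star about \<open>a\<close>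
      after exchanging \<open>s\<close> with \<open>t\<close> and negating \<open>i\<close>, so
      \<open>star_meet\<close> applies again.\<close>
    have BC: "B = {(b, (t + - i) mod w), (b, (t - - i) mod w), (x, (t + s + - i) mod w)}"
      "C = {(b, (t + 2 + - j) mod w), (b, (t + 2 - - j) mod w), (x, (t + 2 + (s + 2) + - j) mod w)}"
      unfolding B(1) C(1) ee kleq[symmetric] k near_block.simps cs
      by (simp_all add: insert_commute add.commute[of s t])
    have bx: "b \<noteq> x" using dd by auto
    have "- i - 3 = - (i + 3)" "- i - 1 = - (i + 1)" by simp_all
    then have "\<not> w dvd - i - 3" "\<not> w dvd - i - 1"
      using half k by (simp_all only: dvd_minus_iff) blast+
    then show False using star_meet[OF w bx BC _ _ pq(1-4)] pq(5) by blast
  next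
    assume k: "k = 3"
    have BC: "B = {(u1, i), (u2, (i + s) mod w), (u3, (i + - t) mod w)}"
      "C = {(u1, j), (u2, (j + (s + 2)) mod w), (u3, (j + - (t + 2)) mod w)}"
      unfolding B(1) C(1) ee kleq[symmetric] k near_block.simps cs by (simp_all add: algebra_simps)
    have "p = q"
    proof (rule tri_meet[OF w0 _ _ _ _ _ BC])
      show "u1 \<noteq> u2" "u1 \<noteq> u3" "u2 \<noteq> u3" using dd by auto
      show "\<not> w dvd s - (s + 2)" "\<not> w dvd - t - - (t + 2)" "\<not> w dvd (- t - s) - (- (t + 2) - (s + 2))"
        using nd[of "-2"] nd[of 2] nd[of 4] by auto
    qed (use rng3 k pq in auto)
    then show False using pq by blast
  next
    assume k: "k = 4"
    have BC: "B = {(v1, i), (v2, (i + s) mod w), (v3, (i + - t) mod w)}"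
      "C = {(v1, j), (v2, (j + (s + 2)) mod w), (v3, (j + - (t + 2)) mod w)}"
      unfolding B(1) C(1) ee kleq[symmetric] k near_block.simps cs by (simp_all add: algebra_simps)
    have "p = q"
    proof (rule tri_meet[OF w0 _ _ _ _ _ BC])
      show "v1 \<noteq> v2" "v1 \<noteq> v3" "v2 \<noteq> v3" using dd by auto
      show "\<not> w dvd s - (s + 2)" "\<not> w dvd - t - - (t + 2)" "\<not> w dvd (- t - s) - (- (t + 2) - (s + 2))"
        using nd[of "-2"] nd[of 2] nd[of 4] by auto
    qed (use rng3 k pq in auto)
    then show False using pq by blast
  qed
qed

lemma near_classes_card: "card (set near_classes) = 36"
proof -
  have "distinct near_classes \<and> length near_classes = 36" by code_simp
  then show ?thesis using distinct_card by metis
qed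

lemma near_linked:
  assumes w: "odd w" "w \<ge> 9"
  shows "linked (nine_points w) (36 * (nat w * nat w))
    ({T. \<exists>a<9. \<exists>b<9. \<exists>i\<in>{0..<w}. \<exists>j\<in>{0..<w}. a \<noteq> b \<and> T = {(9, 0), (a, i), (b, j)}} \<union>
     {T. \<exists>a<9. \<exists>x<9. \<exists>p\<in>{0..<w}. \<exists>q\<in>{0..<w}. \<exists>j\<in>{0..<w}. a \<noteq> x \<and> p \<noteq> q \<and> T = {(a, p), (a, q), (x, j)}} \<union>
     {T. \<exists>x y z. \<exists>i\<in>{0..<w}. \<exists>j\<in>{0..<w}. \<exists>k\<in>{0..<w}. x < y \<and> y < z \<and> z < 9 \<and>
        (x, y, z) \<notin> set (concat line_classes) \<and> T = {(x, i), (y, j), (z, k)}})"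
    (is "linked _ _ (?T0 \<union> ?T1 \<union> ?T2)")
proof (rule linkedI)
  let ?W = "{0..<w}"
  let ?I = "set near_classes \<times> ?W \<times> ?W"
  let ?P = "\<lambda>(e, s, t). near_block w e s t ` near_index w"
  let ?s = "\<lambda>(e, s, t). (e, (s + 2) mod w, (t + 2) mod w)"
  have m: "0 \<le> z mod w" "z mod w < w" for z using w by auto
  show "card ?I = 36 * (nat w * nat w)" by (simp add: card_cartesian_product near_classes_card)
  have inP: "\<exists>i\<in>?I. T \<in> ?P i" if "e \<in> set near_classes" "s \<in> ?W" "t \<in> ?W" "k \<in> near_index w" "T = near_block w e s t k"
    for e s t k T
    using that by (intro bexI[of _ "(e, s, t)"]) auto
  show "linked_family (nine_points w) ?I ?P ?s (?T0 \<union> ?T1 \<union> ?T2)"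
    unfolding linked_family_def
  proof (intro conjI ballI)
    show "finite ?I" by simp
    have inj2: "s = s'" if "s \<in> ?W" "s' \<in> ?W" "(s + 2) mod w = (s' + 2) mod w" for s s'
    proof -
      have "s mod w = s' mod w" using that(3) by (simp add: mod_eq_dvd_iff)
      then show ?thesis using that by simp
    qed
    have "inj_on ?s ?I"
    proof (rule inj_onI)
      fix p q assume pq: "p \<in> ?I" "q \<in> ?I" "?s p = ?s q"
      obtain e s t e' s' t' where e: "p = (e, s, t)" "q = (e', s', t')" by (cases p, cases q)
      have "e = e'" "(s + 2) mod w = (s' + 2) mod w" "(t + 2) mod w = (t' + 2) mod w"
        using pq(3) unfolding e by simp_all
      moreover have "s \<in> ?W" "s' \<in> ?W" "t \<in> ?W" "t' \<in> ?W" using pq(1,2) unfolding e by blast+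
      ultimately show "p = q" unfolding e using inj2[of s s'] inj2[of t t'] by blast
    qed
    moreover have "?s ` ?I \<subseteq> ?I" using m by auto
    ultimately show "bij_betw ?s ?I ?I" unfolding bij_betw_def using endo_inj_surj[of ?I ?s] by simp
  next
    fix i assume "i \<in> ?I"
    then obtain e s t where i: "i = (e, s, t)" "e \<in> set near_classes" "s \<in> ?W" "t \<in> ?W" by blast
    show "pclass (nine_points w) (?P i)" using near_pclass[OF w i(2-4)] unfolding i by simp
    show "meet_once (?P i) (?P (?s i))" using near_meet_once[OF w i(2), of s t] unfolding i by simp
  next
    fix T assume "T \<in> ?T0 \<union> ?T1 \<union> ?T2"
    then consider "T \<in> ?T0" | "T \<in> ?T1" | "T \<in> ?T2" by blast
    then show "\<exists>i\<in>?I. T \<in> ?P i"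
    proof cases
      case 1
      then obtain a b i j where ab: "a < 9" "b < 9" "a \<noteq> b" and ij: "i \<in> ?W" "j \<in> ?W" and T: "T = {(9, 0), (a, i), (b, j)}" by blast
      have k: "(0, 0) \<in> near_index w" unfolding near_index_def by simp
      obtain x u1 u2 u3 v1 v2 v3 where "(x, a, b, (u1, u2, u3), (v1, v2, v3)) \<in> set near_classes \<or>
          (x, b, a, (u1, u2, u3), (v1, v2, v3)) \<in> set near_classes"
        using near_classes_pair[OF ab] by (metis prod.exhaust)
      then show ?thesis
      proof
        assume "(x, a, b, (u1, u2, u3), (v1, v2, v3)) \<in> set near_classes"
        then show ?thesis using ij k by (rule inP) (simp add: T)
      next
        assume "(x, b, a, (u1, u2, u3), (v1, v2, v3)) \<in> set near_classes"
        then show ?thesis using ij(2,1) k by (rule inP) (simp add: T insert_commute)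
      qed
    next
      case 2
      then obtain a x p q j where ax: "a < 9" "x < 9" "a \<noteq> x" and pq: "p \<in> ?W" "q \<in> ?W" "j \<in> ?W" "p \<noteq> q"
        and T: "T = {(a, p), (a, q), (x, j)}" by blast
      \<comment> \<open>The parameter of the column holding two points is their midpoint. The other
        parameter is then solved from the third point, since the star in column \<open>x\<close>
        contains the sum s + t.\<close>
      obtain s d where s: "s \<in> ?W" and d: "d \<in> {1..(w-1) div 2}" and eq: "{p, q} = {(s + d) mod w, (s - d) mod w}"
        using midpoint[OF w(1), of p q] pq by auto
      have "T = Pair a ` {p, q} \<union> {(x, j)}" unfolding T by auto
      then have T': "T = {(a, (s + d) mod w), (a, (s - d) mod w), (x, j)}" unfolding eq by auto
      obtain b u1 u2 u3 v1 v2 v3 where "(x, a, b, (u1, u2, u3), (v1, v2, v3)) \<in> set near_classes \<or>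
          (x, b, a, (u1, u2, u3), (v1, v2, v3)) \<in> set near_classes"
        using near_classes_missing[OF ax] by (metis prod.exhaust)
      then show ?thesis
      proof
        assume e: "(x, a, b, (u1, u2, u3), (v1, v2, v3)) \<in> set near_classes"
        have k: "(1, d) \<in> near_index w" unfolding near_index_def using d by simp
        have "(s + (j - s - d) mod w + d) mod w = (s + (j - s - d) + d) mod w"
          by (intro mod_add_cong) simp_all
        then have "(s + (j - s - d) mod w + d) mod w = j" using pq by simp
        then show ?thesis using m by (intro inP[OF e s _ k, of "(j - s - d) mod w"]) (simp_all add: T')
      next
        assume e: "(x, b, a, (u1, u2, u3), (v1, v2, v3)) \<in> set near_classes"
        have k: "(2, d) \<in> near_index w" unfolding near_index_def using d by simp
        have "((j - s + d) mod w + s - d) mod w = ((j - s + d) + s - d) mod w"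
          by (intro mod_add_cong mod_diff_cong) simp_all
        then have "((j - s + d) mod w + s - d) mod w = j" using pq by simp
        then show ?thesis using m by (intro inP[OF e _ s k, of "(j - s + d) mod w"]) (simp_all add: T')
      qed
    next
      case 3
      then obtain x y z i j k where xyz: "x < y" "y < z" "z < 9" "(x, y, z) \<notin> set (concat line_classes)"
        and ijk: "i \<in> ?W" "j \<in> ?W" "k \<in> ?W" and T: "T = {(x, i), (y, j), (z, k)}" by blast
      obtain p a b u1 u2 u3 where "(p, a, b, (x, y, z), (u1, u2, u3)) \<in> set near_classes \<or>
          (p, a, b, (u1, u2, u3), (x, y, z)) \<in> set near_classes"
        using near_classes_triple[OF xyz(1-3)] xyz(4) by (metis prod.exhaust)
      moreover have s: "(j - i) mod w \<in> ?W" "(i - k) mod w \<in> ?W" using m by auto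
      moreover have "(i + (j - i) mod w) mod w = j" "(i - (i - k) mod w) mod w = k"
        using ijk by (simp_all add: mod_add_right_eq mod_diff_right_eq)
      moreover have "(3, i) \<in> near_index w" "(4, i) \<in> near_index w" using ijk unfolding near_index_def by auto
      ultimately show ?thesis
        using inP[of "(p, a, b, (x, y, z), (u1, u2, u3))" "(j - i) mod w" "(i - k) mod w" "(3, i)" T]
          inP[of "(p, a, b, (u1, u2, u3), (x, y, z))" "(j - i) mod w" "(i - k) mod w" "(4, i)" T]
        by (auto simp: T)
    qed
  qed
qed

section \<open>Triples over a line in arithmetic progression\<close>

definition tri :: "int \<Rightarrow> nat \<times> nat \<times> nat \<Rightarrow> int \<Rightarrow> int \<Rightarrow> int \<Rightarrow> (nat \<times> int) set" where
  "tri w = (\<lambda>(c1, c2, c3) i s t. {(c1, i), (c2, (i + s) mod w), (c3, (i + t) mod w)})"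

lemma lines_ordered:
  assumes "(a, b, c) \<in> set (concat line_classes)"
  shows "a < b" "b < c" "c < 9"
proof -
  have "list_all (\<lambda>(a, b, c). a < b \<and> b < c \<and> c < 9) (concat line_classes)" by code_simp
  then show "a < b" "b < c" "c < 9" using assms unfolding list_all_iff by auto
qed

lemma lines_meet:
  assumes "L \<in> set (concat line_classes)" "L' \<in> set (concat line_classes)"
    and "L = (a, b, c)" "L' = (a', b', c')"
    and "x \<in> {a, b, c}" "x \<in> {a', b', c'}" "y \<in> {a, b, c}" "y \<in> {a', b', c'}" "x \<noteq> y"
  shows "L = L'"
proof -
  have "list_all (\<lambda>(a, b, c). list_all (\<lambda>(a', b', c').
     list_all (\<lambda>x. list_all (\<lambda>y. x = y \<or> a = a' \<and> b = b' \<and> c = c' \<or> x \<noteq> a' \<and> x \<noteq> b' \<and> x \<noteq> c' \<or> y \<noteq> a' \<and> y \<noteq> b' \<and> y \<noteq> c')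
       [a, b, c]) [a, b, c]) (concat line_classes)) (concat line_classes)" by code_simp
  then have "list_all (\<lambda>x. list_all (\<lambda>y. x = y \<or> a = a' \<and> b = b' \<and> c = c' \<or> x \<noteq> a' \<and> x \<noteq> b' \<and> x \<noteq> c' \<or> y \<noteq> a' \<and> y \<noteq> b' \<and> y \<noteq> c')
       [a, b, c]) [a, b, c]" using assms(1,2) unfolding assms(3,4) list_all_iff[of _ "concat line_classes"] by fast
  moreover have "x \<in> set [a, b, c]" "y \<in> set [a, b, c]" using assms(5,7) by auto
  ultimately show ?thesis using assms(6,8,9) unfolding assms(3,4) list_all_iff by blast
qed

lemma line_classes_cover:
  assumes "k < 4" "c < 9"
  shows "\<exists>m<3. \<exists>a b d. line_classes ! k ! m = (a, b, d) \<and> (c = a \<or> c = b \<or> c = d)"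
proof -
  have "list_all (\<lambda>k. list_all (\<lambda>c. list_ex (\<lambda>m. case line_classes ! k ! m of (a, b, d) \<Rightarrow> c = a \<or> c = b \<or> c = d) [0,1,2])
     [0,1,2,3,4,5,6,7,8]) [0,1,2,3]" by code_simp
  moreover have "k \<in> set [0,1,2,3]" using assms(1) by auto
  ultimately have "list_ex (\<lambda>m. case line_classes ! k ! m of (a, b, d) \<Rightarrow> c = a \<or> c = b \<or> c = d) [0,1,2]"
    using nine_cases[OF assms(2)] unfolding list_all_iff by blast
  then have "\<exists>m\<in>set [0,1,2]. case line_classes ! k ! m of (a, b, d) \<Rightarrow> c = a \<or> c = b \<or> c = d"
    unfolding list_ex_iff .
  then obtain m where m: "m \<in> set [0,1,2]" "case line_classes ! k ! m of (a, b, d) \<Rightarrow> c = a \<or> c = b \<or> c = d" by (rule bexE)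
  obtain a b d where "line_classes ! k ! m = (a, b, d)" by (cases "line_classes ! k ! m")
  moreover from this have "c = a \<or> c = b \<or> c = d" using m(2) by simp
  moreover have "m < 3" using m(1) by auto
  ultimately show ?thesis by blast
qed

lemma line_classes_mem:
  assumes "k < 4" "m < 3"
  shows "line_classes ! k ! m \<in> set (concat line_classes)"
proof -
  have l: "length line_classes = 4 \<and> list_all (\<lambda>l. length l = 3) line_classes" by code_simp
  then have k: "line_classes ! k \<in> set line_classes" using assms by simp
  then have "line_classes ! k ! m \<in> set (line_classes ! k)" using l assms unfolding list_all_iff by auto
  then show ?thesis using k by auto
qed

lemma line_classes_find:
  assumes "L \<in> set (concat line_classes)"
  shows "\<exists>k<4. \<exists>m<3. line_classes ! k ! m = L"
proof -
  have l: "length line_classes = 4 \<and> list_all (\<lambda>l. length l = 3) line_classes" by code_simp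
  obtain l where l': "l \<in> set line_classes" "L \<in> set l" using assms by auto
  then show ?thesis using l unfolding list_all_iff by (metis in_set_conv_nth)
qed

lemma list_all3:
  assumes "list_all (\<lambda>x. list_all (\<lambda>y. list_all (\<lambda>z. Q x y z) zs) ys) xs" "x \<in> set xs" "y \<in> set ys" "z \<in> set zs"
  shows "Q x y z"
  using assms by (simp add: list_all_iff)

lemma line_classes_disjoint:
  assumes "k < 4" "m < 3" "m' < 3" "line_classes ! k ! m = (a, b, c)" "line_classes ! k ! m' = (a', b', c')"
    "x \<in> {a, b, c}" "x \<in> {a', b', c'}"
  shows "m = m'"
proof -
  have "list_all (\<lambda>k. list_all (\<lambda>m. list_all (\<lambda>m'. m = m' \<or>
     (case line_classes ! k ! m of (a, b, c) \<Rightarrow> case line_classes ! k ! m' of (a', b', c') \<Rightarrow>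
       list_all (\<lambda>x. x \<noteq> a' \<and> x \<noteq> b' \<and> x \<noteq> c') [a, b, c])) [0,1,2]) [0,1,2]) [0,1,2,3]" by code_simp
  then have "m = m' \<or> (case line_classes ! k ! m of (a, b, c) \<Rightarrow> case line_classes ! k ! m' of (a', b', c') \<Rightarrow>
       list_all (\<lambda>x. x \<noteq> a' \<and> x \<noteq> b' \<and> x \<noteq> c') [a, b, c])" by (rule list_all3) (use assms in auto)
  then show ?thesis using assms(6,7) unfolding assms(4,5) by auto
qed

lemma tri_subset:
  assumes "L \<in> set (concat line_classes)" "i \<in> {0..<w}"
  shows "tri w L i s t \<subseteq> nine_points w \<and> card (tri w L i s t) \<le> 3"
proof -
  obtain a b c where L: "L = (a, b, c)" by (cases L)
  have "a < 9" "b < 9" "c < 9" using lines_ordered[OF assms(1)[unfolded L]] by auto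
  moreover have "0 \<le> z mod w" "z mod w < w" for z using assms(2) by auto
  moreover have "card {p, q, r} \<le> 3" for p q r :: "nat \<times> int" by (simp add: card_insert_if)
  ultimately show ?thesis using assms(2) unfolding L tri_def nine_points_def by auto
qed

text \<open>Within one parallel class of lines different lines have no column in common. Over the
  same line, raising \<open>s\<close> by one changes the three column differences by 1, 2 and 1,
  none divisible by \<open>w\<close>. All these classes miss the point (9, 0), which later leaves
  room to insert classes that stay within columns.\<close>

lemma line_family:
  assumes w: "odd w" "w \<ge> 9"
  shows "linked_family (nine_points w) ({..<4} \<times> {0..<w})
    (\<lambda>(k, s). (\<lambda>(m, i). tri w (line_classes ! k ! m) i s (2 * s)) ` ({..<3} \<times> {0..<w}))
    (\<lambda>(k, s). (k, (s + 1) mod w))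
    {T. \<exists>L\<in>set (concat line_classes). \<exists>i\<in>{0..<w}. \<exists>s\<in>{0..<w}. T = tri w L i s (2 * s)}"
proof -
  let ?W = "{0..<w}"
  let ?P = "\<lambda>(k::nat, s). (\<lambda>(m, i). tri w (line_classes ! k ! m) i s (2 * s)) ` ({..<3::nat} \<times> ?W)"
  have m: "0 \<le> z mod w" "z mod w < w" for z using w by auto
  show ?thesis unfolding linked_family_def
  proof (intro conjI ballI)
    show "finite ({..<4::nat} \<times> ?W)" by simp
    have "inj_on (\<lambda>(k::nat, s). (k, (s + 1) mod w)) ({..<4} \<times> ?W)"
    proof (rule inj_onI, clarsimp)
      fix s s' assume r: "0 \<le> s" "s < w" "0 \<le> s'" "s' < w" and e: "(s + 1) mod w = (s' + 1) mod w"
      have "s mod w = s' mod w" using e by (simp add: mod_eq_dvd_iff)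
      then show "s = s'" using r by simp
    qed
    moreover have "(\<lambda>(k::nat, s). (k, (s + 1) mod w)) ` ({..<4} \<times> ?W) \<subseteq> {..<4} \<times> ?W" using m by auto
    ultimately show "bij_betw (\<lambda>(k::nat, s). (k, (s + 1) mod w)) ({..<4} \<times> ?W) ({..<4} \<times> ?W)"
      unfolding bij_betw_def using endo_inj_surj[of "{..<4} \<times> ?W" "\<lambda>(k::nat, s). (k, (s + 1) mod w)"] by simp
  next
    fix ks assume "ks \<in> {..<4::nat} \<times> ?W"
    then obtain k s where ks: "ks = (k, s)" "k < 4" "s \<in> ?W" by auto
    have "pclass (nine_points w) ((\<lambda>(m, i). tri w (line_classes ! k ! m) i s (2 * s)) ` ({..<3::nat} \<times> ?W))"
    proof (rule nine_pclassI[where p = "(9, 0)"])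
      show "w > 0" using w by simp
      show "card ({..<3::nat} \<times> ?W) = 3 * nat w" by (simp add: card_cartesian_product)
      show "(case j of (m, i) \<Rightarrow> tri w (line_classes ! k ! m) i s (2 * s)) \<subseteq> nine_points w \<and>
         card (case j of (m, i) \<Rightarrow> tri w (line_classes ! k ! m) i s (2 * s)) \<le> 3" if jm: "j \<in> {..<3::nat} \<times> ?W" for j
      proof -
        obtain n i where j: "j = (n, i)" "n < 3" "i \<in> ?W" using jm by auto
        show ?thesis unfolding j(1) using tri_subset[OF line_classes_mem[OF ks(2) j(2)] j(3)] by simp
      qed
      show "nine_points w - {(9, 0)} \<subseteq> (\<Union>j\<in>{..<3::nat} \<times> ?W. case j of (m, i) \<Rightarrow> tri w (line_classes ! k ! m) i s (2 * s))"
      proof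
        fix p assume "p \<in> nine_points w - {(9, 0)}"
        then obtain c i where p: "p = (c, i)" "c < 9" "i \<in> ?W" unfolding nine_points_def by auto
        obtain n a b d where n: "n < 3" "line_classes ! k ! n = (a, b, d)" "c = a \<or> c = b \<or> c = d"
          using line_classes_cover[OF ks(2) p(2)] by blast
        have e: "((i - z) mod w + z) mod w = i" for z using p(3) by (simp add: mod_add_left_eq)
        have "\<exists>i'\<in>?W. p \<in> tri w (a, b, d) i' s (2 * s)" using n(3)
        proof (elim disjE)
          assume "c = a" then show ?thesis using p by (intro bexI[of _ i]) (auto simp: tri_def)
        next
          assume "c = b" then show ?thesis using p m e by (intro bexI[of _ "(i - s) mod w"]) (auto simp: tri_def)
        next
          assume "c = d" then show ?thesis using p m e by (intro bexI[of _ "(i - 2 * s) mod w"]) (auto simp: tri_def)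
        qed
        then show "p \<in> (\<Union>j\<in>{..<3::nat} \<times> ?W. case j of (m, i) \<Rightarrow> tri w (line_classes ! k ! m) i s (2 * s))"
          using n by force
      qed
    qed simp
    then show "pclass (nine_points w) (?P ks)" unfolding ks by simp
    show "meet_once (?P ks) (?P (case ks of (k, s) \<Rightarrow> (k, (s + 1) mod w)))"
    proof (rule meet_onceI)
      fix B C p q assume "B \<in> ?P ks" "C \<in> ?P (case ks of (k, s) \<Rightarrow> (k, (s + 1) mod w))"
        and pq: "p \<in> B" "p \<in> C" "q \<in> B" "q \<in> C"
      then obtain n i n' j where n: "n < 3" "n' < 3" "i \<in> ?W" "j \<in> ?W"
        and B: "B = tri w (line_classes ! k ! n) i s (2 * s)"
        and C: "C = tri w (line_classes ! k ! n') j ((s + 1) mod w) (2 * ((s + 1) mod w))" unfolding ks by auto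
      obtain a b c a' b' c' where L: "line_classes ! k ! n = (a, b, c)" "line_classes ! k ! n' = (a', b', c')"
        by (metis prod.exhaust)
      have "fst p \<in> {a, b, c}" "fst p \<in> {a', b', c'}" using pq unfolding B C L tri_def by auto
      then have nn: "n = n'" by (rule line_classes_disjoint[OF ks(2) n(1,2) L])
      have ord: "a < b" "b < c" using lines_ordered line_classes_mem[OF ks(2) n(1)] unfolding L(1) by blast+
      have "2 * ((s + 1) mod w) mod w = (2 * (s + 1)) mod w" by (rule mod_mult_right_eq)
      then have c2: "(j + 2 * ((s + 1) mod w)) mod w = (j + 2 * (s + 1)) mod w" by (intro mod_add_cong refl)
      have nd: "\<not> w dvd -1" "\<not> w dvd -2" using nine_not_dvd[OF w(2), of "-1"] nine_not_dvd[OF w(2), of "-2"] by auto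
      show "p = q"
      proof (rule tri_meet[of w a b c i j B s "2 * s" C "s + 1" "2 * (s + 1)"])
        show "B = {(a, i), (b, (i + s) mod w), (c, (i + 2 * s) mod w)}" unfolding B L tri_def by simp
        show "C = {(a, j), (b, (j + (s + 1)) mod w), (c, (j + 2 * (s + 1)) mod w)}"
          unfolding C nn[symmetric] L tri_def using c2 by (simp add: mod_add_right_eq)
      qed (use w ord n pq nd in auto)
    qed
  next
    fix T assume "T \<in> {T. \<exists>L\<in>set (concat line_classes). \<exists>i\<in>?W. \<exists>s\<in>?W. T = tri w L i s (2 * s)}"
    then obtain L i s where T: "L \<in> set (concat line_classes)" "i \<in> ?W" "s \<in> ?W" "T = tri w L i s (2 * s)" by blast
    obtain k n where "k < 4" "n < 3" "line_classes ! k ! n = L" using line_classes_find[OF T(1)] by blast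
    then show "\<exists>ks\<in>{..<4} \<times> ?W. T \<in> ?P ks" using T by (intro bexI[of _ "(k, s)"]) (auto intro!: image_eqI[of _ _ "(n, i)"])
  qed
qed

text \<open>An entry \<open>(x, L, r, o)\<close> assigns residues mod 3 to the points of a line \<open>L\<close> missing \<open>x\<close>. At every
  point other than \<open>x\<close> the three lines missing \<open>x\<close> receive the three residues. For a fixed line the
  residue vectors run, up to constants, once through all that are not arithmetic progressions in
  the first table, and once through all progressions with a sign \<open>o\<close> in the second.\<close>

definition residues_generic :: "(nat \<times> (nat \<times> nat \<times> nat) \<times> (int \<times> int \<times> int) \<times> int) list" where
  "residues_generic =
    [(0, (1, 4, 7), (0, 0, 1), 0), (0, (2, 5, 8), (0, 0, 2), 0), (0, (3, 4, 5), (0, 1, 1), 0),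
    (0, (6, 7, 8), (1, 0, 0), 0), (0, (1, 5, 6), (1, 2, 2), 0), (0, (2, 3, 7), (1, 1, 2), 0),
    (0, (1, 3, 8), (2, 2, 1), 0), (0, (2, 4, 6), (2, 2, 0), 0), (1, (0, 3, 6), (0, 0, 2), 0),
    (1, (2, 5, 8), (0, 0, 1), 0), (1, (3, 4, 5), (1, 0, 1), 0), (1, (6, 7, 8), (0, 1, 0), 0),
    (1, (0, 4, 8), (1, 1, 2), 0), (1, (2, 3, 7), (1, 2, 2), 0), (1, (0, 5, 7), (2, 2, 0), 0),
    (1, (2, 4, 6), (2, 2, 1), 0), (2, (0, 3, 6), (0, 0, 1), 0), (2, (1, 4, 7), (0, 0, 2), 0),
    (2, (3, 4, 5), (1, 1, 0), 0), (2, (6, 7, 8), (0, 0, 1), 0), (2, (0, 4, 8), (1, 2, 2), 0),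
    (2, (1, 5, 6), (1, 1, 2), 0), (2, (0, 5, 7), (2, 2, 1), 0), (2, (1, 3, 8), (2, 2, 0), 0),
    (3, (1, 4, 7), (1, 0, 0), 0), (3, (2, 5, 8), (2, 0, 0), 0), (3, (0, 1, 2), (1, 0, 0), 0),
    (3, (6, 7, 8), (0, 1, 1), 0), (3, (0, 4, 8), (2, 1, 2), 0), (3, (1, 5, 6), (2, 1, 1), 0),
    (3, (0, 5, 7), (0, 2, 2), 0), (3, (2, 4, 6), (1, 2, 2), 0), (4, (0, 3, 6), (2, 0, 0), 0),
    (4, (2, 5, 8), (1, 0, 0), 0), (4, (0, 1, 2), (0, 1, 0), 0), (4, (6, 7, 8), (1, 0, 1), 0),
    (4, (1, 5, 6), (2, 1, 2), 0), (4, (2, 3, 7), (2, 1, 1), 0), (4, (0, 5, 7), (1, 2, 2), 0),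
    (4, (1, 3, 8), (0, 2, 2), 0), (5, (0, 3, 6), (1, 0, 0), 0), (5, (1, 4, 7), (2, 0, 0), 0),
    (5, (0, 1, 2), (0, 0, 1), 0), (5, (6, 7, 8), (1, 1, 0), 0), (5, (0, 4, 8), (2, 1, 1), 0),
    (5, (2, 3, 7), (2, 1, 2), 0), (5, (1, 3, 8), (1, 2, 2), 0), (5, (2, 4, 6), (0, 2, 2), 0),
    (6, (1, 4, 7), (0, 1, 0), 0), (6, (2, 5, 8), (0, 2, 0), 0), (6, (0, 1, 2), (0, 1, 1), 0),
    (6, (3, 4, 5), (1, 0, 0), 0), (6, (0, 4, 8), (1, 2, 1), 0), (6, (2, 3, 7), (2, 2, 1), 0),
    (6, (0, 5, 7), (2, 1, 2), 0), (6, (1, 3, 8), (2, 0, 2), 0), (7, (0, 3, 6), (0, 2, 0), 0),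
    (7, (2, 5, 8), (0, 1, 0), 0), (7, (0, 1, 2), (1, 0, 1), 0), (7, (3, 4, 5), (0, 1, 0), 0),
    (7, (0, 4, 8), (2, 2, 1), 0), (7, (1, 5, 6), (1, 2, 1), 0), (7, (1, 3, 8), (2, 1, 2), 0),
    (7, (2, 4, 6), (2, 0, 2), 0), (8, (0, 3, 6), (0, 1, 0), 0), (8, (1, 4, 7), (0, 2, 0), 0),
    (8, (0, 1, 2), (1, 1, 0), 0), (8, (3, 4, 5), (0, 0, 1), 0), (8, (1, 5, 6), (2, 2, 1), 0),
    (8, (2, 3, 7), (1, 2, 1), 0), (8, (0, 5, 7), (2, 0, 2), 0), (8, (2, 4, 6), (2, 1, 2), 0)]"

definition residues_progression :: "(nat \<times> (nat \<times> nat \<times> nat) \<times> (int \<times> int \<times> int) \<times> int) list" where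
  "residues_progression =
    [(0, (1, 4, 7), (1, 2, 0), 1), (0, (2, 5, 8), (1, 2, 0), 1), (0, (3, 4, 5), (0, 0, 0), 1),
    (0, (6, 7, 8), (1, 1, 1), 1), (0, (1, 5, 6), (2, 1, 0), 1), (0, (2, 3, 7), (2, 2, 2), 1),
    (0, (1, 3, 8), (0, 1, 2), 1), (0, (2, 4, 6), (0, 1, 2), 1), (1, (0, 3, 6), (0, 1, 2), 1),
    (1, (2, 5, 8), (2, 2, 2), 1), (1, (3, 4, 5), (2, 0, 1), 1), (1, (6, 7, 8), (0, 2, 1), 1),
    (1, (0, 4, 8), (1, 2, 0), 1), (1, (2, 3, 7), (0, 0, 0), -1), (1, (0, 5, 7), (2, 0, 1), 1),
    (1, (2, 4, 6), (1, 1, 1), 1), (2, (0, 3, 6), (2, 0, 1), -1), (2, (1, 4, 7), (2, 2, 2), 1),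
    (2, (3, 4, 5), (1, 1, 1), -1), (2, (6, 7, 8), (0, 1, 2), 1), (2, (0, 4, 8), (0, 0, 0), 1),
    (2, (1, 5, 6), (1, 0, 2), -1), (2, (0, 5, 7), (1, 2, 0), -1), (2, (1, 3, 8), (0, 2, 1), 1),
    (3, (1, 4, 7), (2, 1, 0), 1), (3, (2, 5, 8), (1, 0, 2), 1), (3, (0, 1, 2), (1, 0, 2), 1),
    (3, (6, 7, 8), (2, 1, 0), -1), (3, (0, 4, 8), (0, 2, 1), 1), (3, (1, 5, 6), (1, 1, 1), 1),
    (3, (0, 5, 7), (2, 2, 2), 1), (3, (2, 4, 6), (0, 0, 0), -1), (4, (0, 3, 6), (2, 1, 0), 1),
    (4, (2, 5, 8), (0, 2, 1), -1), (4, (0, 1, 2), (0, 1, 2), 1), (4, (6, 7, 8), (2, 2, 2), -1),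
    (4, (1, 5, 6), (2, 0, 1), 1), (4, (2, 3, 7), (1, 2, 0), 1), (4, (0, 5, 7), (1, 1, 1), -1),
    (4, (1, 3, 8), (0, 0, 0), 1), (5, (0, 3, 6), (2, 1, 0), -1), (5, (1, 4, 7), (2, 1, 0), -1),
    (5, (0, 1, 2), (1, 0, 2), -1), (5, (6, 7, 8), (1, 2, 0), -1), (5, (0, 4, 8), (0, 2, 1), -1),
    (5, (2, 3, 7), (0, 2, 1), 1), (5, (1, 3, 8), (1, 0, 2), -1), (5, (2, 4, 6), (1, 0, 2), 1),
    (6, (1, 4, 7), (0, 1, 2), -1), (6, (2, 5, 8), (0, 0, 0), -1), (6, (0, 1, 2), (1, 1, 1), 1),
    (6, (3, 4, 5), (0, 2, 1), 1), (6, (0, 4, 8), (2, 0, 1), -1), (6, (2, 3, 7), (2, 1, 0), -1),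
    (6, (0, 5, 7), (0, 2, 1), 1), (6, (1, 3, 8), (2, 2, 2), -1), (7, (0, 3, 6), (0, 0, 0), 1),
    (7, (2, 5, 8), (0, 1, 2), -1), (7, (0, 1, 2), (2, 0, 1), -1), (7, (3, 4, 5), (1, 2, 0), -1),
    (7, (0, 4, 8), (1, 1, 1), -1), (7, (1, 5, 6), (2, 2, 2), -1), (7, (1, 3, 8), (1, 2, 0), -1),
    (7, (2, 4, 6), (2, 0, 1), -1), (8, (0, 3, 6), (0, 0, 0), -1), (8, (1, 4, 7), (1, 1, 1), -1),
    (8, (0, 1, 2), (2, 2, 2), -1), (8, (3, 4, 5), (1, 0, 2), -1), (8, (1, 5, 6), (0, 1, 2), -1),
    (8, (2, 3, 7), (1, 2, 0), -1), (8, (0, 5, 7), (1, 0, 2), -1), (8, (2, 4, 6), (0, 2, 1), -1)]"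

definition residue_table :: "nat \<Rightarrow> (nat \<times> (nat \<times> nat \<times> nat) \<times> (int \<times> int \<times> int) \<times> int) list" where
  "residue_table k = (if k = 0 then residues_generic else residues_progression)"

definition residue_row :: "nat \<Rightarrow> nat \<Rightarrow> (nat \<times> (nat \<times> nat \<times> nat) \<times> (int \<times> int \<times> int) \<times> int) list" where
  "residue_row k x = filter (\<lambda>e. fst e = x) (residue_table k)"

lemma residue_table_cases:
  assumes "Q residues_generic" "Q residues_progression"
  shows "Q (residue_table k)"
  using assms unfolding residue_table_def by simp

lemma residue_row_length: "x < 9 \<Longrightarrow> length (residue_row k x) = 8"
proof -
  have "(\<lambda>T. list_all (\<lambda>x. length (filter (\<lambda>e. fst e = x) T) = 8) [0,1,2,3,4,5,6,7,8]) (residue_table k)"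
    by (rule residue_table_cases) code_simp+
  then show "x < 9 \<Longrightarrow> length (residue_row k x) = 8"
    using nine_cases[of x] unfolding residue_row_def list_all_iff by blast
qed

lemma residue_table_entry:
  assumes "(x, (a, b, c), (r1, r2, r3), o1) \<in> set (residue_table k)"
  shows "x < 9" "(a, b, c) \<in> set (concat line_classes)" "x \<notin> {a, b, c}" "{r1, r2, r3} \<subseteq> {0..<3}"
proof -
  have "(\<lambda>T. list_all (\<lambda>(x, (a, b, c), (r1, r2, r3), o1). x < 9 \<and> (a, b, c) \<in> set (concat line_classes) \<and>
     x \<noteq> a \<and> x \<noteq> b \<and> x \<noteq> c \<and> list_all (\<lambda>r. 0 \<le> r \<and> r < 3) [r1, r2, r3]) T) (residue_table k)"
    by (rule residue_table_cases) code_simp+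
  then have "x < 9 \<and> (a, b, c) \<in> set (concat line_classes) \<and>
     x \<noteq> a \<and> x \<noteq> b \<and> x \<noteq> c \<and> list_all (\<lambda>r. 0 \<le> r \<and> r < 3) [r1, r2, r3]"
    using assms unfolding list_all_iff[of _ "residue_table k"] by fast
  then show "x < 9" "(a, b, c) \<in> set (concat line_classes)" "x \<notin> {a, b, c}" "{r1, r2, r3} \<subseteq> {0..<3}" by auto
qed

lemma residue_table_progression:
  assumes "(x, L, (r1, r2, r3), o1) \<in> set (residue_table k)" "k \<noteq> 0"
  shows "(2 * (r2 - r1)) mod 3 = (r3 - r1) mod 3"
proof -
  have "list_all (\<lambda>(x, L, (r1, r2, r3), o1). (2 * (r2 - r1)) mod 3 = (r3 - r1) mod 3) residues_progression"
    by code_simp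
  then show ?thesis using assms unfolding residue_table_def list_all_iff by fastforce
qed

text \<open>The eight lines missing \<open>x\<close> have 24 incidences, and there are 24 pairs of a
  point other than \<open>x\<close> and a residue; each pair is taken.\<close>

lemma residue_table_point:
  assumes "x < 9" "y < 9" "y \<noteq> x" "0 \<le> r" "r < 3"
  shows "\<exists>a b c r1 r2 r3 o1. (x, (a, b, c), (r1, r2, r3), o1) \<in> set (residue_table k) \<and>
    (a = y \<and> r1 = r \<or> b = y \<and> r2 = r \<or> c = y \<and> r3 = r)"
proof -
  have "(\<lambda>T. list_all (\<lambda>x. list_all (\<lambda>y. list_all (\<lambda>r. x = y \<or> list_ex (\<lambda>(x', (a, b, c), (r1, r2, r3), o1).
     x' = x \<and> (a = y \<and> r1 = r \<or> b = y \<and> r2 = r \<or> c = y \<and> r3 = r)) T) [0,1,2])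
     [0,1,2,3,4,5,6,7,8]) [0,1,2,3,4,5,6,7,8]) (residue_table k)"
    by (rule residue_table_cases) code_simp+
  then have "x = y \<or> list_ex (\<lambda>(x', (a, b, c), (r1, r2, r3), o1).
     x' = x \<and> (a = y \<and> r1 = r \<or> b = y \<and> r2 = r \<or> c = y \<and> r3 = r)) (residue_table k)"
    by (rule list_all3) (use nine_cases assms in auto)
  then have "\<exists>e\<in>set (residue_table k). (\<lambda>(x', (a, b, c), (r1, r2, r3), o1).
     x' = x \<and> (a = y \<and> r1 = r \<or> b = y \<and> r2 = r \<or> c = y \<and> r3 = r)) e" using assms(3) unfolding list_ex_iff by simp
  then obtain e where e: "e \<in> set (residue_table k)" "(\<lambda>(x', (a, b, c), (r1, r2, r3), o1).
     x' = x \<and> (a = y \<and> r1 = r \<or> b = y \<and> r2 = r \<or> c = y \<and> r3 = r)) e" by (rule bexE)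
  obtain x' a b c r1 r2 r3 o1 where ee: "e = (x', (a, b, c), (r1, r2, r3), o1)" by (metis prod.exhaust)
  have "x' = x" "a = y \<and> r1 = r \<or> b = y \<and> r2 = r \<or> c = y \<and> r3 = r" using e(2) unfolding ee by simp_all
  then show ?thesis using e(1) unfolding ee by blast
qed

text \<open>Six points lie off a given line, and six of the nine vectors of residues with first
  entry 0 are not progressions. The three progressions with two signs fill the other table in the
  same way.\<close>

lemma residue_table_generic:
  assumes "L \<in> set (concat line_classes)" "p \<in> {0..<3}" "q \<in> {0..<3}" "q \<noteq> 2 * p mod 3"
  shows "\<exists>x r1 r2 r3 o1. (x, L, (r1, r2, r3), o1) \<in> set (residue_table 0) \<and> (r2 - r1) mod 3 = p \<and> (r3 - r1) mod 3 = q"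
proof -
  have "list_all (\<lambda>L. list_all (\<lambda>p. list_all (\<lambda>q. q = 2 * p mod 3 \<or> list_ex (\<lambda>(x, L', (r1, r2, r3), o1).
     L' = L \<and> (r2 - r1) mod 3 = p \<and> (r3 - r1) mod 3 = q) residues_generic) [0,1,2]) [0,1,2]) (concat line_classes)"
    by code_simp
  then have "q = 2 * p mod 3 \<or> list_ex (\<lambda>(x, L', (r1, r2, r3), o1).
     L' = L \<and> (r2 - r1) mod 3 = p \<and> (r3 - r1) mod 3 = q) residues_generic"
    by (rule list_all3) (use assms in auto)
  then have "\<exists>e\<in>set residues_generic. (\<lambda>(x, L', (r1, r2, r3), o1).
     L' = L \<and> (r2 - r1) mod 3 = p \<and> (r3 - r1) mod 3 = q) e" using assms(4) unfolding list_ex_iff by simp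
  then obtain e where e: "e \<in> set residues_generic" "(\<lambda>(x, L', (r1, r2, r3), o1).
     L' = L \<and> (r2 - r1) mod 3 = p \<and> (r3 - r1) mod 3 = q) e" by (rule bexE)
  obtain x L' r1 r2 r3 o1 where ee: "e = (x, L', (r1, r2, r3), o1)" by (metis prod.exhaust)
  have "L' = L" "(r2 - r1) mod 3 = p" "(r3 - r1) mod 3 = q" using e(2) unfolding ee by simp_all
  moreover have "(x, L', (r1, r2, r3), o1) \<in> set (residue_table 0)" using e(1) unfolding ee residue_table_def by simp
  ultimately show ?thesis by blast
qed

lemma residue_table_sign:
  assumes "L \<in> set (concat line_classes)" "p \<in> {0..<3}" "o1 = 1 \<or> o1 = -1"
  shows "\<exists>x r1 r2 r3. (x, L, (r1, r2, r3), o1) \<in> set (residue_table 1) \<and> (r2 - r1) mod 3 = p"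
proof -
  have "list_all (\<lambda>L. list_all (\<lambda>p. list_all (\<lambda>o1. list_ex (\<lambda>(x, L', (r1, r2, r3), o1').
     L' = L \<and> (r2 - r1) mod 3 = p \<and> o1' = o1) residues_progression) [1,-1]) [0,1,2]) (concat line_classes)"
    by code_simp
  then have "list_ex (\<lambda>(x, L', (r1, r2, r3), o1').
     L' = L \<and> (r2 - r1) mod 3 = p \<and> o1' = o1) residues_progression"
    by (rule list_all3) (use assms in auto)
  then have "\<exists>e\<in>set residues_progression. (\<lambda>(x, L', (r1, r2, r3), o1').
     L' = L \<and> (r2 - r1) mod 3 = p \<and> o1' = o1) e" unfolding list_ex_iff .
  then obtain e where e: "e \<in> set residues_progression" "(\<lambda>(x, L', (r1, r2, r3), o1').
     L' = L \<and> (r2 - r1) mod 3 = p \<and> o1' = o1) e" by (rule bexE)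
  obtain x L' r1 r2 r3 o1' where ee: "e = (x, L', (r1, r2, r3), o1')" by (metis prod.exhaust)
  have "L' = L" "(r2 - r1) mod 3 = p" "o1' = o1" using e(2) unfolding ee by simp_all
  moreover have "(x, L', (r1, r2, r3), o1') \<in> set (residue_table 1)" using e(1) unfolding ee residue_table_def by simp
  ultimately show ?thesis by blast
qed

text \<open>The successor of a class for the hole \<open>x\<close> is the class for x + 3. Two
  blocks of these over the same line that met twice would agree in two residues.\<close>

lemma residue_table_agree:
  assumes "(x, L, (r1, r2, r3), o1) \<in> set (residue_table k)" "((x + 3) mod 9, L, (t1, t2, t3), o2) \<in> set (residue_table k)"
  shows "\<not> (r1 = t1 \<and> r2 = t2) \<and> \<not> (r1 = t1 \<and> r3 = t3) \<and> \<not> (r2 = t2 \<and> r3 = t3)"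
proof -
  have "(\<lambda>T. list_all (\<lambda>(x, L, (r1, r2, r3), o1). list_all (\<lambda>(x', L', (t1, t2, t3), o2).
     x' \<noteq> (x + 3) mod 9 \<or> L' \<noteq> L \<or> \<not> (r1 = t1 \<and> r2 = t2) \<and> \<not> (r1 = t1 \<and> r3 = t3) \<and> \<not> (r2 = t2 \<and> r3 = t3)) T) T) (residue_table k)"
    by (rule residue_table_cases) code_simp+
  then show ?thesis using assms unfolding list_all_iff by fast
qed

section \<open>Triples over a line that are not in progression\<close>

definition outer_block :: "int \<Rightarrow> nat \<times> int \<times> int \<times> int \<Rightarrow>
    nat \<times> (nat \<times> nat \<times> nat) \<times> (int \<times> int \<times> int) \<times> int \<Rightarrow> int \<Rightarrow> (nat \<times> int) set" where
  "outer_block w = (\<lambda>(k, e, al, be) (x, L, (r1, r2, r3), o1) h.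
     let s = r2 - r1 + 3 * al in
     tri w L ((r1 + e) mod 3 + 3 * h) s (if k = 0 then r3 - r1 + 3 * be else 2 * s + 3 * o1 * be))"

lemma outer_block_residue:
  assumes w: "w = 3 * v" "v > 0" and e: "(x, (a, b, c), (r1, r2, r3), o1) \<in> set (residue_table k)"
    and p: "(y, i) \<in> outer_block w (k, e, al, be) (x, (a, b, c), (r1, r2, r3), o1) h"
  shows "y = a \<and> i mod 3 = (r1 + e) mod 3 \<or> y = b \<and> i mod 3 = (r2 + e) mod 3 \<or> y = c \<and> i mod 3 = (r3 + e) mod 3"
proof -
  define s where "s = r2 - r1 + 3 * al"
  define t where "t = (if k = 0 then r3 - r1 + 3 * be else 2 * s + 3 * o1 * be)"
  define j where "j = (r1 + e) mod 3 + 3 * h"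
  have mm: "z mod w mod 3 = z mod 3" for z using w by (simp add: mod_mod_cancel)
  have j3: "j mod 3 = (r1 + e) mod 3" unfolding j_def by simp
  have s3: "s mod 3 = (r2 - r1) mod 3" unfolding s_def by simp
  have t3: "t mod 3 = (r3 - r1) mod 3"
  proof (cases "k = 0")
    case False
    have "t mod 3 = (2 * s) mod 3" unfolding t_def using False by (simp add: mult.assoc)
    also have "\<dots> = (2 * (r2 - r1)) mod 3" by (rule mod_mult_cong[OF refl s3])
    finally show ?thesis using residue_table_progression[OF e False] by simp
  qed (simp add: t_def)
  have "(j + s) mod 3 = ((r1 + e) + (r2 - r1)) mod 3" by (rule mod_add_cong) (simp_all add: j3 s3)
  then have js: "(j + s) mod w mod 3 = (r2 + e) mod 3" unfolding mm by (simp add: algebra_simps)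
  have "(j + t) mod 3 = ((r1 + e) + (r3 - r1)) mod 3" by (rule mod_add_cong) (simp_all add: j3 t3)
  then have jt: "(j + t) mod w mod 3 = (r3 + e) mod 3" unfolding mm by (simp add: algebra_simps)
  have "(y, i) \<in> {(a, j), (b, (j + s) mod w), (c, (j + t) mod w)}"
    using p unfolding outer_block_def tri_def j_def s_def t_def by (simp add: Let_def)
  then show ?thesis using j3 js jt by auto
qed

lemma outer_block_hits:
  assumes w: "w = 3 * v" "v > 0" and e: "(x, (a, b, c), (r1, r2, r3), o1) \<in> set (residue_table k)"
    and i: "i \<in> {0..<w}"
    and y: "y = a \<and> i mod 3 = (r1 + e) mod 3 \<or> y = b \<and> i mod 3 = (r2 + e) mod 3 \<or> y = c \<and> i mod 3 = (r3 + e) mod 3"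
  shows "\<exists>h\<in>{0..<v}. (y, i) \<in> outer_block w (k, e, al, be) (x, (a, b, c), (r1, r2, r3), o1) h"
proof -
  define s where "s = r2 - r1 + 3 * al"
  define t where "t = (if k = 0 then r3 - r1 + 3 * be else 2 * s + 3 * o1 * be)"
  have mm: "z mod w mod 3 = z mod 3" for z using w by (simp add: mod_mod_cancel)
  have s3: "s mod 3 = (r2 - r1) mod 3" unfolding s_def by simp
  have t3: "t mod 3 = (r3 - r1) mod 3"
  proof (cases "k = 0")
    case False
    have "t mod 3 = (2 * s) mod 3" unfolding t_def using False by (simp add: mult.assoc)
    also have "\<dots> = (2 * (r2 - r1)) mod 3" by (rule mod_mult_cong[OF refl s3])
    finally show ?thesis using residue_table_progression[OF e False] by simp
  qed (simp add: t_def)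
  have ob: "outer_block w (k, e, al, be) (x, (a, b, c), (r1, r2, r3), o1) h =
     {(a, (r1 + e) mod 3 + 3 * h), (b, ((r1 + e) mod 3 + 3 * h + s) mod w), (c, ((r1 + e) mod 3 + 3 * h + t) mod w)}" for h
    unfolding outer_block_def tri_def s_def t_def by (simp add: Let_def)
  have sol: "\<exists>h\<in>{0..<v}. (r1 + e) mod 3 + 3 * h = j" if "j \<in> {0..<w}" "j mod 3 = (r1 + e) mod 3" for j
  proof (rule bexI[of _ "j div 3"])
    show "(r1 + e) mod 3 + 3 * (j div 3) = j" unfolding that(2)[symmetric] by simp
    show "j div 3 \<in> {0..<v}" using that(1) w by auto
  qed
  have wr: "z mod w \<in> {0..<w}" for z using w by simp
  from y show ?thesis
  proof (elim disjE conjE)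
    assume "y = a" "i mod 3 = (r1 + e) mod 3"
    then show ?thesis using sol[OF i] unfolding ob by blast
  next
    assume yb: "y = b" and r: "i mod 3 = (r2 + e) mod 3"
    have "(i - s) mod 3 = ((r2 + e) - (r2 - r1)) mod 3" by (rule mod_diff_cong) (simp_all add: r s3)
    then have "(i - s) mod w mod 3 = (r1 + e) mod 3" unfolding mm by (simp add: algebra_simps)
    then obtain h where h: "h \<in> {0..<v}" "(r1 + e) mod 3 + 3 * h = (i - s) mod w" using sol[OF wr] by blast
    have "((i - s) mod w + s) mod w = i" using i by (simp add: mod_add_left_eq)
    then show ?thesis using h yb unfolding ob by (intro bexI[of _ h]) auto
  next
    assume yc: "y = c" and r: "i mod 3 = (r3 + e) mod 3"
    have "(i - t) mod 3 = ((r3 + e) - (r3 - r1)) mod 3" by (rule mod_diff_cong) (simp_all add: r t3)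
    then have "(i - t) mod w mod 3 = (r1 + e) mod 3" unfolding mm by (simp add: algebra_simps)
    then obtain h where h: "h \<in> {0..<v}" "(r1 + e) mod 3 + 3 * h = (i - t) mod w" using sol[OF wr] by blast
    have "((i - t) mod w + t) mod w = i" using i by (simp add: mod_add_left_eq)
    then show ?thesis using h yc unfolding ob by (intro bexI[of _ h]) auto
  qed
qed

text \<open>The sign in the second table supplies the negative half of the range of
  \<open>be\<close>, so that half is left out here. With W = 3 v there are W (W - 1) / 2 parameters,
  exactly the number of classes on W + 1 points that cover a given point.\<close>

definition hole_params :: "int \<Rightarrow> (nat \<times> int \<times> int \<times> int) set" where
  "hole_params v = {0} \<times> {0..<3} \<times> {0..<v} \<times> {0..<v} \<union> {1} \<times> {0..<3} \<times> {0..<v} \<times> {1..(v-1) div 2}"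

lemma card_hole_params:
  assumes "odd v" "v > 0"
  shows "finite (hole_params v)" "2 * card (hole_params v) = 9 * (nat v * nat v) - 3 * nat v"
proof -
  show "finite (hole_params v)" unfolding hole_params_def by simp
  have "card (hole_params v) = card ({0::nat} \<times> {0..<3::int} \<times> {0..<v} \<times> {0..<v}) +
     card ({1::nat} \<times> {0..<3::int} \<times> {0..<v} \<times> {1..(v-1) div 2})"
    unfolding hole_params_def by (rule card_Un_disjoint) auto
  then have c: "card (hole_params v) = 3 * (nat v * nat v) + 3 * (nat v * nat ((v - 1) div 2))"
    by (simp add: card_cartesian_product)
  obtain n where n: "v = int (2 * n + 1)" using assms by (metis oddE odd_Suc_div_two of_nat_Suc Suc_eq_plus1 zero_less_imp_eq_int even_of_nat)
  have nv: "nat v = 2 * n + 1" "nat ((v - 1) div 2) = n" unfolding n by auto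
  show "2 * card (hole_params v) = 9 * (nat v * nat v) - 3 * nat v"
    unfolding c nv by (simp add: algebra_simps)
qed

text \<open>If t and 2 s differ modulo three, the residues of the triple form no progression and the
  generic table has a row for them. Otherwise t - 2 s is three times a number that is nonzero modulo
  \<open>v\<close>, and this number is plus or minus some \<open>be\<close> up to (v - 1) / 2. The
  remaining freedom in \<open>e\<close>, \<open>al\<close> and \<open>h\<close> fits the base point
  and the second point.\<close>

lemma outer_coverage:
  assumes w: "w = 3 * v" "odd v" "v > 0" and L: "L \<in> set (concat line_classes)"
    and i: "i \<in> {0..<w}" and s: "s \<in> {0..<w}" and t: "t \<in> {0..<w}" and ne: "t \<noteq> 2 * s mod w"
  shows "\<exists>par\<in>hole_params v. \<exists>en\<in>set (residue_table (fst par)). \<exists>h\<in>{0..<v}. tri w L i s t = outer_block w par en h"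
proof -
  obtain a b c where Le: "L = (a, b, c)" by (cases L)
  have tri_cong: "tri w L i s' t' = tri w L i s t" if "s' mod w = s mod w" "t' mod w = t mod w" for s' t'
  proof -
    have "(i + s') mod w = (i + s) mod w" "(i + t') mod w = (i + t) mod w" by (intro mod_add_cong refl that)+
    then show ?thesis unfolding tri_def Le by simp
  qed
  have hsol: "\<exists>e\<in>{0..<3}. \<exists>h\<in>{0..<v}. (r1 + e) mod 3 + 3 * h = i" for r1 :: int
  proof (rule bexI[of _ "(i - r1) mod 3"], rule bexI[of _ "i div 3"])
    have "(r1 + (i - r1) mod 3) mod 3 = i mod 3" by (simp add: mod_add_right_eq)
    then show "(r1 + (i - r1) mod 3) mod 3 + 3 * (i div 3) = i" by simp
  qed (use i w in auto)
  have mm: "z mod w mod 3 = z mod 3" for z using w by (simp add: mod_mod_cancel)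
  have asol: "\<exists>al\<in>{0..<v}. (r + 3 * al) mod w = z mod w" if "r mod 3 = z mod 3" for r z
  proof -
    define u where "u = (z - r) mod w"
    have "u mod 3 = (z - r) mod 3" unfolding u_def by (rule mm)
    moreover have "(z - r) mod 3 = 0" using that by (metis mod_eq_dvd_iff mod_eq_0_iff_dvd)
    ultimately have "u mod 3 = 0" by simp
    then have u: "3 * (u div 3) = u" by auto
    have "u \<in> {0..<w}" unfolding u_def using w by simp
    then have "u div 3 \<in> {0..<v}" using w by auto
    moreover have "(r + 3 * (u div 3)) mod w = z mod w" unfolding u unfolding u_def by (simp add: mod_add_right_eq)
    ultimately show ?thesis by blast
  qed
  show ?thesis
  proof (cases "t mod 3 = (2 * s) mod 3")
    case False
    have "t mod 3 \<noteq> 2 * (s mod 3) mod 3" using False by (simp add: mod_mult_right_eq)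
    then obtain x r1 r2 r3 o1 where en: "(x, L, (r1, r2, r3), o1) \<in> set (residue_table 0)"
      and r: "(r2 - r1) mod 3 = s mod 3" "(r3 - r1) mod 3 = t mod 3"
      using residue_table_generic[OF L, of "s mod 3" "t mod 3"] by auto
    obtain e h where eh: "e \<in> {0..<3}" "h \<in> {0..<v}" "(r1 + e) mod 3 + 3 * h = i" using hsol by blast
    obtain al where al: "al \<in> {0..<v}" "(r2 - r1 + 3 * al) mod w = s mod w" using asol[OF r(1)] by blast
    obtain be where be: "be \<in> {0..<v}" "(r3 - r1 + 3 * be) mod w = t mod w" using asol[OF r(2)] by blast
    have "tri w L i s t = outer_block w (0, e, al, be) (x, L, (r1, r2, r3), o1) h"
      unfolding outer_block_def using eh(3) tri_cong[OF al(2) be(2)] by (simp add: Let_def)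
    moreover have "(0, e, al, be) \<in> hole_params v" unfolding hole_params_def using eh al be by auto
    ultimately show ?thesis using en eh(2) by (intro bexI[of _ "(0, e, al, be)"] bexI[of _ "(x, L, (r1, r2, r3), o1)"] bexI[of _ h]) auto
  next
    case True
    define g where "g = (t - 2 * s) mod w"
    have "g mod 3 = (t - 2 * s) mod 3" unfolding g_def by (rule mm)
    moreover have "(t - 2 * s) mod 3 = 0" using True by (metis mod_eq_dvd_iff mod_eq_0_iff_dvd)
    ultimately have "g mod 3 = 0" by simp
    then obtain g' where g': "g = 3 * g'" by auto
    have "g \<noteq> 0"
    proof
      assume "g = 0"
      then have "t mod w = 2 * s mod w" unfolding g_def by (simp add: mod_eq_dvd_iff mod_eq_0_iff_dvd)
      then show False using ne t by simp
    qed
    moreover have "0 \<le> g" "g < w" unfolding g_def using w by auto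
    ultimately have gr: "1 \<le> g'" "g' < v" using g' w by auto
    have "\<exists>o1 be. (o1 = 1 \<or> o1 = -1) \<and> be \<in> {1..(v-1) div 2} \<and> (3 * o1 * be) mod w = g mod w"
    proof (cases "g' \<le> (v - 1) div 2")
      case True
      then show ?thesis using gr g' by (intro exI[of _ 1] exI[of _ g']) auto
    next
      case False
      have "v - g' \<in> {1..(v-1) div 2}" using False gr w(2) by (auto, presburger)
      moreover have "(3 * -1 * (v - g')) mod w = g mod w"
      proof -
        have "3 * -1 * (v - g') = g - w" unfolding g' w(1) by simp
        then show ?thesis by simp
      qed
      ultimately show ?thesis by blast
    qed
    then obtain o1 be where ob: "o1 = 1 \<or> o1 = -1" "be \<in> {1..(v-1) div 2}" "(3 * o1 * be) mod w = g mod w" by blast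
    obtain x r1 r2 r3 where en: "(x, L, (r1, r2, r3), o1) \<in> set (residue_table 1)" and r: "(r2 - r1) mod 3 = s mod 3"
      using residue_table_sign[OF L _ ob(1), of "s mod 3"] by auto
    obtain e h where eh: "e \<in> {0..<3}" "h \<in> {0..<v}" "(r1 + e) mod 3 + 3 * h = i" using hsol by blast
    obtain al where al: "al \<in> {0..<v}" "(r2 - r1 + 3 * al) mod w = s mod w" using asol[OF r] by blast
    have "(2 * (r2 - r1 + 3 * al) + 3 * o1 * be) mod w = (2 * s + (t - 2 * s)) mod w"
    proof (intro mod_add_cong mod_mult_cong refl al(2))
      show "3 * o1 * be mod w = (t - 2 * s) mod w" unfolding ob(3) g_def by simp
    qed
    then have tt: "(2 * (r2 - r1 + 3 * al) + 3 * o1 * be) mod w = t mod w" by simp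
    have "tri w L i s t = outer_block w (1, e, al, be) (x, L, (r1, r2, r3), o1) h"
      unfolding outer_block_def using eh(3) tri_cong[OF al(2) tt] by (simp add: Let_def)
    moreover have "(1, e, al, be) \<in> hole_params v" unfolding hole_params_def using eh al ob by auto
    ultimately show ?thesis using en eh(2) by (intro bexI[of _ "(1, e, al, be)"] bexI[of _ "(x, L, (r1, r2, r3), o1)"] bexI[of _ h]) auto
  qed
qed

lemma pclass_missing:
  assumes "finite Y" "pclass Y P" "card Y mod 3 = 1"
  shows "\<exists>y\<in>Y. Y - {y} \<subseteq> \<Union>P"
proof -
  have "card (\<Union>P) = sum card P"
    using assms(2) unfolding pclass_def triples_def
    by (intro card_Union_disjoint) (auto intro: finite_subset[OF _ assms(1)])
  also have "\<dots> = sum (\<lambda>_. 3) P" using assms(2) unfolding pclass_def triples_def by (intro sum.cong) auto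
  also have "\<dots> = 3 * (card Y div 3)" using assms(2) unfolding pclass_def by simp
  finally have "card (\<Union>P) + 1 = card Y" using mult_div_mod_eq[of 3 "card Y"] assms(3) by simp
  moreover have "card (Y - \<Union>P) = card Y - card (\<Union>P)"
    using pclass_Union[OF assms(2)] assms(1) by (intro card_Diff_subset) (auto intro: finite_subset)
  ultimately have "card (Y - \<Union>P) = 1" by simp
  then obtain y where "Y - \<Union>P = {y}" by (auto simp: card_1_singleton_iff)
  then show ?thesis by blast
qed

section \<open>Classes that fill one column together with infinity\<close>

definition local_point :: "nat \<Rightarrow> nat \<Rightarrow> nat \<Rightarrow> nat \<times> int" where
  "local_point W x i = (if i = W then (9, 0) else (x, int i))"

lemma local_block:
  assumes "x < 9" "B \<subseteq> {..<W + 1}" "card B = 3"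
  shows "local_point W x ` B \<subseteq> nine_points (int W) \<and> card (local_point W x ` B) \<le> 3"
proof
  show "local_point W x ` B \<subseteq> nine_points (int W)"
    using assms(1,2) unfolding local_point_def nine_points_def by auto
  have "finite B" using assms(2) finite_subset by blast
  then show "card (local_point W x ` B) \<le> 3" using card_image_le[of B "local_point W x"] assms(3) by simp
qed

definition hole_block :: "nat \<Rightarrow> nat \<Rightarrow> nat \<times> int \<times> int \<times> int \<Rightarrow> nat set + nat \<times> int \<Rightarrow> (nat \<times> int) set" where
  "hole_block W x par = case_sum (\<lambda>B. local_point W x ` B)
     (\<lambda>(m, h). outer_block (int W) par (residue_row (fst par) x ! m) h)"

text \<open>A class on W + 1 points fills column \<open>x\<close> and infinity up to one point. Any
  other column is split by residues modulo three among the three lines through it that miss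
  \<open>x\<close>, so v blocks over each of the eight lines complete the class. The filled columns
  of consecutive classes share only infinity, and a block over a line meets a column at most
  once.\<close>

lemma hole_family:
  fixes W :: nat and v :: int
  assumes w: "int W = 3 * v" "odd v" "v > 0"
    and c: "\<And>par. par \<in> hole_params v \<Longrightarrow> pclass {..<W + 1} (c par)"
  shows "linked_family (nine_points (int W)) ({..<9} \<times> hole_params v)
    (\<lambda>(x, par). hole_block W x par ` (Inl ` c par \<union> Inr ` ({..<8} \<times> {0..<v})))
    (\<lambda>(x, par). ((x + 3) mod 9, par))
    ({T. \<exists>x<9. \<exists>par\<in>hole_params v. \<exists>B\<in>c par. T = local_point W x ` B} \<union>
     {T. \<exists>L\<in>set (concat line_classes). \<exists>i\<in>{0..<int W}. \<exists>s\<in>{0..<int W}. \<exists>t\<in>{0..<int W}.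
        t \<noteq> 2 * s mod int W \<and> T = tri (int W) L i s t})"
    (is "linked_family _ ?I ?P ?s ?T")
proof -
  have shift3: "(z + 3) mod 9 = (if z < 6 then z + 3 else z - 6)" if "z < 9" for z :: nat
    using that by (auto simp: mod_if)
  have row: "residue_row k x ! m \<in> set (residue_table k) \<and> fst (residue_row k x ! m) = x" if "x < 9" "m < 8" for k x m
  proof -
    have "residue_row k x ! m \<in> set (residue_row k x)" using residue_row_length[OF that(1), of k] that(2) by simp
    then show ?thesis unfolding residue_row_def by simp
  qed
  have row_ex: "\<exists>m<8. residue_row k (fst en) ! m = en" if "en \<in> set (residue_table k)" "fst en < 9" for k en
  proof -
    have "en \<in> set (residue_row k (fst en))" using that(1) unfolding residue_row_def by simp
    then show ?thesis using residue_row_length[OF that(2), of k] by (metis in_set_conv_nth)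
  qed
  have outer: "\<exists>a b c' r1 r2 r3 o1. residue_row k x ! m = (x, (a, b, c'), (r1, r2, r3), o1) \<and>
      (x, (a, b, c'), (r1, r2, r3), o1) \<in> set (residue_table k)" if "x < 9" "m < 8" for k x m
    using row[OF that, of k] by (metis prod.exhaust fst_conv)
  have Wv: "nat v * 3 = W" using w by linarith
  have "(n * 3 + 1) mod 3 = 1 \<and> (n * 3 + 1) div 3 = n" for n :: nat by presburger
  from this[of "nat v"] have W3: "(W + 1) mod 3 = 1" "(W + 1) div 3 = nat v" unfolding Wv by auto
  have distinct_fst: "p = q" if hyp: "p \<in> outer_block (int W) par (residue_row k x ! m) h"
    "q \<in> outer_block (int W) par (residue_row k x ! m) h" "fst p = fst q" "x < 9" "m < 8" for p q par k x m h
  proof -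
    obtain a b c' r1 r2 r3 o1 where e: "residue_row k x ! m = (x, (a, b, c'), (r1, r2, r3), o1)"
      "(x, (a, b, c'), (r1, r2, r3), o1) \<in> set (residue_table k)" using outer[OF hyp(4,5)] by blast
    have "a < b" "b < c'" using lines_ordered[OF residue_table_entry(2)[OF e(2)]] by blast+
    then show ?thesis using hyp(1-3) unfolding e outer_block_def tri_def
      by (cases par) (auto simp: Let_def)
  qed
  show ?thesis unfolding linked_family_def
  proof (intro conjI ballI)
    show "finite ?I" using card_hole_params(1)[OF w(2,3)] by simp
    have "inj_on ?s ?I"
    proof (rule inj_onI)
      fix p q assume pq: "p \<in> ?I" "q \<in> ?I" "?s p = ?s q"
      obtain x par x' par' where e: "p = (x, par)" "q = (x', par')" by (cases p, cases q)
      have "(x + 3) mod 9 = (x' + 3) mod 9" "par = par'" "x < 9" "x' < 9" using pq unfolding e by auto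
      moreover from this have "x = x'" by (auto simp: shift3 split: if_splits)
      ultimately show "p = q" unfolding e by simp
    qed
    moreover have "?s ` ?I \<subseteq> ?I" by auto
    ultimately show "bij_betw ?s ?I ?I" unfolding bij_betw_def
      using endo_inj_surj[of ?I ?s] card_hole_params(1)[OF w(2,3)] by simp
  next
    fix xp assume "xp \<in> ?I"
    then obtain x par where xp: "xp = (x, par)" "x < 9" "par \<in> hole_params v" by auto
    obtain k e al be where par: "par = (k, e, al, be)" by (cases par)
    let ?J = "Inl ` c par \<union> Inr ` ({..<8::nat} \<times> {0..<v})"
    have cp: "pclass {..<W + 1} (c par)" by (rule c[OF xp(3)])
    have fc: "finite (c par)" using pclass_finite[OF _ cp] by simp
    have "pclass (nine_points (int W)) (hole_block W x par ` ?J)"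
    proof -
      have "card {..<W + 1} mod 3 = 1" using W3(1) by simp
      then obtain y0 where y0: "{..<W + 1} - {y0} \<subseteq> \<Union>(c par)" using pclass_missing[OF _ cp] by auto
      show ?thesis
      proof (rule nine_pclassI[where p = "local_point W x y0"])
        show "int W > 0" using w by simp
        show "finite ?J" using fc by simp
        have "card (c par) = nat v" using cp W3(2) unfolding pclass_def by simp
        then have "card ?J = nat v + 8 * nat v" using fc
          by (subst card_Un_disjoint) (auto simp: card_image card_cartesian_product)
        then show "card ?J = 3 * nat (int W)" using Wv by simp
        fix j assume j: "j \<in> ?J"
        show "hole_block W x par j \<subseteq> nine_points (int W) \<and> card (hole_block W x par j) \<le> 3"
        proof (cases j)
          case (Inl B)
          then have "B \<in> c par" using j by auto
          then have "B \<subseteq> {..<W + 1}" "card B = 3" using cp unfolding pclass_def triples_def by auto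
          then show ?thesis using local_block[OF xp(2)] unfolding Inl hole_block_def by simp
        next
          case (Inr mh)
          obtain m h where mh: "mh = (m, h)" "m < 8" "h \<in> {0..<v}" using j Inr by (cases mh) auto
          obtain a b c' r1 r2 r3 o1 where en: "residue_row k x ! m = (x, (a, b, c'), (r1, r2, r3), o1)"
            "(x, (a, b, c'), (r1, r2, r3), o1) \<in> set (residue_table k)" using outer[OF xp(2) mh(2)] by blast
          have "0 \<le> (r1 + e) mod 3" "(r1 + e) mod 3 < 3" by auto
          then have "(r1 + e) mod 3 + 3 * h \<in> {0..<int W}" using mh(3) w by auto
          then show ?thesis using tri_subset[OF residue_table_entry(2)[OF en(2)], of "(r1 + e) mod 3 + 3 * h"]
            unfolding Inr mh(1) hole_block_def par by (simp add: en(1) outer_block_def Let_def)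
        qed
      next
        let ?U = "\<Union>j\<in>?J. hole_block W x par j"
        show "nine_points (int W) - {local_point W x y0} \<subseteq> ?U"
        proof
          fix q assume q: "q \<in> nine_points (int W) - {local_point W x y0}"
          have loc: "local_point W x i \<in> ?U" if "i < W + 1" "local_point W x i \<noteq> local_point W x y0" for i
          proof -
            have "i \<in> {..<W + 1} - {y0}" using that by auto
            then obtain B where "B \<in> c par" "i \<in> B" using y0 by blast
            then have "local_point W x i \<in> hole_block W x par (Inl B)" "Inl B \<in> ?J" unfolding hole_block_def by auto
            then show ?thesis by blast
          qed
          show "q \<in> ?U"
          proof (cases "q = (9, 0) \<or> fst q = x")
            case True
            have "\<exists>i<W + 1. q = local_point W x i"
            proof (cases "q = (9, 0)")
              case True
              then show ?thesis by (intro exI[of _ W]) (simp add: local_point_def)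
            next
              case False
              then obtain i where "q = (x, i)" "0 \<le> i" "i < int W" using True q unfolding nine_points_def by auto
              then show ?thesis by (intro exI[of _ "nat i"]) (auto simp: local_point_def)
            qed
            then show ?thesis using loc q by blast
          next
            case False
            then obtain y i where yi: "q = (y, i)" "y < 9" "i \<in> {0..<int W}" "y \<noteq> x" using q unfolding nine_points_def by auto
            obtain a b c' r1 r2 r3 o1 where en: "(x, (a, b, c'), (r1, r2, r3), o1) \<in> set (residue_table k)"
              and r: "a = y \<and> r1 = (i - e) mod 3 \<or> b = y \<and> r2 = (i - e) mod 3 \<or> c' = y \<and> r3 = (i - e) mod 3"
              using residue_table_point[OF xp(2) yi(2,4), of "(i - e) mod 3" k] by auto
            have ie: "((i - e) mod 3 + e) mod 3 = i mod 3" by (simp add: mod_add_left_eq)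
            obtain h where h: "h \<in> {0..<v}" "(y, i) \<in> outer_block (int W) (k, e, al, be) (x, (a, b, c'), (r1, r2, r3), o1) h"
              using outer_block_hits[OF w(1,3) en yi(3), of y e al be] r ie by metis
            obtain m where m: "m < 8" "residue_row k x ! m = (x, (a, b, c'), (r1, r2, r3), o1)"
              using row_ex[OF en] xp(2) by auto
            have "q \<in> hole_block W x par (Inr (m, h))" unfolding hole_block_def par yi(1) using h(2) m(2) by simp
            moreover have "Inr (m, h) \<in> ?J" using m h by auto
            ultimately show ?thesis by blast
          qed
        qed
      qed
    qed
    then show "pclass (nine_points (int W)) (?P xp)" unfolding xp by simp
    let ?x' = "(x + 3) mod 9"
    have x': "?x' < 9" "?x' \<noteq> x" using xp(2) by (auto simp: shift3)
    show "meet_once (?P xp) (?P (?s xp))"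
    proof (rule meet_onceI)
      fix B C p q assume BC: "B \<in> ?P xp" "C \<in> ?P (?s xp)" and pq: "p \<in> B" "p \<in> C" "q \<in> B" "q \<in> C"
      have "B \<in> hole_block W x par ` ?J" "C \<in> hole_block W ?x' par ` ?J" using BC unfolding xp by (simp_all only: prod.case)
      then obtain j j' where j: "j \<in> ?J" "B = hole_block W x par j" and j': "j' \<in> ?J" "C = hole_block W ?x' par j'"
        by (elim imageE)
      have lf: "fst r = z \<or> r = (9, 0)" if "r \<in> local_point W z ` D" for r z D
        using that unfolding local_point_def by (auto split: if_splits)
      have out: "fst r < 9" if hyp: "r \<in> outer_block (int W) par (residue_row k z ! m) h" "z < 9" "m < 8" for r z m h
      proof -
        obtain a b c' r1 r2 r3 o1 where e: "residue_row k z ! m = (z, (a, b, c'), (r1, r2, r3), o1)"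
          "(z, (a, b, c'), (r1, r2, r3), o1) \<in> set (residue_table k)" using outer[OF hyp(2,3)] by blast
        have "a < b" "b < c'" "c' < 9" using lines_ordered[OF residue_table_entry(2)[OF e(2)]] by blast+
        then show ?thesis using hyp(1) unfolding e outer_block_def tri_def par by (auto simp: Let_def)
      qed
      show "p = q"
      proof (cases j; cases j')
        fix D D' assume "j = Inl D" "j' = Inl D'"
        then have "p \<in> local_point W x ` D" "p \<in> local_point W ?x' ` D'" "q \<in> local_point W x ` D" "q \<in> local_point W ?x' ` D'"
          using pq unfolding j j' hole_block_def by simp_all
        then show ?thesis using lf x'(2) by metis
      next
        fix D mh assume jj: "j = Inl D" "j' = Inr mh"
        obtain m h where mh: "mh = (m, h)" "m < 8" using j' jj by (cases mh) auto
        have o: "p \<in> outer_block (int W) par (residue_row k ?x' ! m) h" "q \<in> outer_block (int W) par (residue_row k ?x' ! m) h"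
          and l: "p \<in> local_point W x ` D" "q \<in> local_point W x ` D"
          using pq unfolding j j' jj mh hole_block_def par by simp_all
        have "fst p = x" "fst q = x" using lf[OF l(1)] lf[OF l(2)] out[OF o(1) x'(1) mh(2)] out[OF o(2) x'(1) mh(2)] by auto
        then show ?thesis using distinct_fst[OF o _ x'(1) mh(2)] by simp
      next
        fix D mh assume jj: "j = Inr mh" "j' = Inl D"
        obtain m h where mh: "mh = (m, h)" "m < 8" using j jj by (cases mh) auto
        have o: "p \<in> outer_block (int W) par (residue_row k x ! m) h" "q \<in> outer_block (int W) par (residue_row k x ! m) h"
          and l: "p \<in> local_point W ?x' ` D" "q \<in> local_point W ?x' ` D"
          using pq unfolding j j' jj mh hole_block_def par by simp_all
        have "fst p = ?x'" "fst q = ?x'" using lf[OF l(1)] lf[OF l(2)] out[OF o(1) xp(2) mh(2)] out[OF o(2) xp(2) mh(2)] by auto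
        then show ?thesis using distinct_fst[OF o _ xp(2) mh(2)] by simp
      next
        fix mh mh' assume jj: "j = Inr mh" "j' = Inr mh'"
        obtain m h where mh: "mh = (m, h)" "m < 8" using j jj by (cases mh) auto
        obtain m' h' where mh': "mh' = (m', h')" "m' < 8" using j' jj by (cases mh') auto
        have o: "p \<in> outer_block (int W) par (residue_row k x ! m) h" "q \<in> outer_block (int W) par (residue_row k x ! m) h"
          and o': "p \<in> outer_block (int W) par (residue_row k ?x' ! m') h'" "q \<in> outer_block (int W) par (residue_row k ?x' ! m') h'"
          using pq unfolding j j' jj mh mh' hole_block_def par by simp_all
        obtain a b c' r1 r2 r3 o1 where en: "residue_row k x ! m = (x, (a, b, c'), (r1, r2, r3), o1)"
          "(x, (a, b, c'), (r1, r2, r3), o1) \<in> set (residue_table k)" using outer[OF xp(2) mh(2)] by blast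
        obtain a' b' d' t1 t2 t3 o2 where en': "residue_row k ?x' ! m' = (?x', (a', b', d'), (t1, t2, t3), o2)"
          "(?x', (a', b', d'), (t1, t2, t3), o2) \<in> set (residue_table k)" using outer[OF x'(1) mh'(2)] by blast
        obtain y i z l where pe: "p = (y, i)" "q = (z, l)" by (cases p, cases q)
        note R = outer_block_residue[OF w(1,3) en(2)] and R' = outer_block_residue[OF w(1,3) en'(2)]
        have py: "y = a \<and> i mod 3 = (r1 + e) mod 3 \<or> y = b \<and> i mod 3 = (r2 + e) mod 3 \<or> y = c' \<and> i mod 3 = (r3 + e) mod 3"
          using R o(1) unfolding pe par en(1) by blast
        have pz: "z = a \<and> l mod 3 = (r1 + e) mod 3 \<or> z = b \<and> l mod 3 = (r2 + e) mod 3 \<or> z = c' \<and> l mod 3 = (r3 + e) mod 3"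
          using R o(2) unfolding pe par en(1) by blast
        have py': "y = a' \<and> i mod 3 = (t1 + e) mod 3 \<or> y = b' \<and> i mod 3 = (t2 + e) mod 3 \<or> y = d' \<and> i mod 3 = (t3 + e) mod 3"
          using R' o'(1) unfolding pe par en'(1) by blast
        have pz': "z = a' \<and> l mod 3 = (t1 + e) mod 3 \<or> z = b' \<and> l mod 3 = (t2 + e) mod 3 \<or> z = d' \<and> l mod 3 = (t3 + e) mod 3"
          using R' o'(2) unfolding pe par en'(1) by blast
        show ?thesis
        proof (cases "y = z")
          case True
          then show ?thesis using distinct_fst[OF o _ xp(2) mh(2)] unfolding pe by simp
        next
          case False
          \<comment> \<open>Two common columns determine the line, and the positions of the common
            points modulo three would make two residues agree.\<close>
          have "(a, b, c') = (a', b', d')"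
            by (rule lines_meet[OF residue_table_entry(2)[OF en(2)] residue_table_entry(2)[OF en'(2)] refl refl, of y z])
               (use py pz py' pz' False in auto)
          then have L: "a' = a" "b' = b" "d' = c'" by auto
          have ord: "a < b" "b < c'" using lines_ordered[OF residue_table_entry(2)[OF en(2)]] by blast+
          have eqr: "r = t" if "(r + e) mod 3 = (t + e) mod 3" "r \<in> {0..<3}" "t \<in> {0..<3}" for r t :: int
          proof -
            have "r mod 3 = t mod 3" using that(1) by (simp add: mod_eq_dvd_iff)
            then show ?thesis using that(2,3) by simp
          qed
          have r3: "r1 \<in> {0..<3}" "r2 \<in> {0..<3}" "r3 \<in> {0..<3}" "t1 \<in> {0..<3}" "t2 \<in> {0..<3}" "t3 \<in> {0..<3}"
            using residue_table_entry(4)[OF en(2)] residue_table_entry(4)[OF en'(2)] by auto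
          have A: "y = a \<and> r1 = t1 \<or> y = b \<and> r2 = t2 \<or> y = c' \<and> r3 = t3"
            using py py' ord eqr[of r1 t1] eqr[of r2 t2] eqr[of r3 t3] r3 unfolding L by auto
          have B': "z = a \<and> r1 = t1 \<or> z = b \<and> r2 = t2 \<or> z = c' \<and> r3 = t3"
            using pz pz' ord eqr[of r1 t1] eqr[of r2 t2] eqr[of r3 t3] r3 unfolding L by auto
          show ?thesis using residue_table_agree[OF en(2) en'(2)[unfolded L]] A B' False by auto
        qed
      qed
    qed
  next
    fix T assume "T \<in> ?T"
    then consider x par B where "x < 9" "par \<in> hole_params v" "B \<in> c par" "T = local_point W x ` B"
      | L i s t where "L \<in> set (concat line_classes)" "i \<in> {0..<int W}" "s \<in> {0..<int W}" "t \<in> {0..<int W}"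
        "t \<noteq> 2 * s mod int W" "T = tri (int W) L i s t" by blast
    then show "\<exists>xp\<in>?I. T \<in> ?P xp"
    proof cases
      case 1
      then have "T \<in> ?P (x, par)" by (auto simp: hole_block_def intro!: image_eqI[of _ _ "Inl B"])
      then show ?thesis using 1 by blast
    next
      case 2
      obtain par en h where h: "par \<in> hole_params v" "en \<in> set (residue_table (fst par))" "h \<in> {0..<v}"
        "T = outer_block (int W) par en h" using outer_coverage[OF w 2(1-5)] 2(6) by metis
      have "fst en < 9" using residue_table_entry(1) h(2) by (metis prod.exhaust fst_conv)
      then obtain m where m: "m < 8" "residue_row (fst par) (fst en) ! m = en" using row_ex[OF h(2)] by blast
      then have "T = hole_block W (fst en) par (Inr (m, h))" unfolding hole_block_def h(4) by simp
      then have "T \<in> ?P (fst en, par)" using m h(3) by auto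
      then show ?thesis using h(1) \<open>fst en < 9\<close> by blast
    qed
  qed
qed

section \<open>Assembling the classes on 9 W + 1 points\<close>

lemma sort_three:
  fixes a b c :: nat
  assumes "a \<noteq> b" "a \<noteq> c" "b \<noteq> c" "Q a i" "Q b j" "Q c k"
  shows "\<exists>x y z i' j' k'. x < y \<and> y < z \<and> Q x i' \<and> Q y j' \<and> Q z k' \<and> {(a, i), (b, j), (c, k)} = {(x, i'), (y, j'), (z, k')}"
proof -
  consider "a < b" "b < c" | "a < c" "c < b" | "b < a" "a < c" | "b < c" "c < a" | "c < a" "a < b" | "c < b" "b < a"
    using assms(1-3) by linarith
  then show ?thesis
  proof cases
    case 1 then show ?thesis using assms by blast
  next
    case 2
    have "{(a, i), (b, j), (c, k)} = {(a, i), (c, k), (b, j)}" by blast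
    then show ?thesis using 2 assms by blast
  next
    case 3
    have "{(a, i), (b, j), (c, k)} = {(b, j), (a, i), (c, k)}" by blast
    then show ?thesis using 3 assms by blast
  next
    case 4
    have "{(a, i), (b, j), (c, k)} = {(b, j), (c, k), (a, i)}" by blast
    then show ?thesis using 4 assms by blast
  next
    case 5
    have "{(a, i), (b, j), (c, k)} = {(c, k), (a, i), (b, j)}" by blast
    then show ?thesis using 5 assms by blast
  next
    case 6
    have "{(a, i), (b, j), (c, k)} = {(c, k), (b, j), (a, i)}" by blast
    then show ?thesis using 6 assms by blast
  qed
qed

lemma card_triples_through:
  "card {B \<in> triples {..<W + 1}. W \<in> B} = W choose 2"
proof -
  have "{B \<in> triples {..<W + 1}. W \<in> B} = insert W ` {D. D \<subseteq> {..<W} \<and> card D = 2}"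
  proof (intro equalityI subsetI)
    fix B assume "B \<in> {B \<in> triples {..<W + 1}. W \<in> B}"
    then have B: "B \<subseteq> {..<W + 1}" "card B = 3" "W \<in> B" unfolding triples_def by auto
    have "B - {W} \<subseteq> {..<W}" using B(1) by auto
    moreover have "card (B - {W}) = 2" using B by simp
    moreover have "B = insert W (B - {W})" using B(3) by blast
    ultimately show "B \<in> insert W ` {D. D \<subseteq> {..<W} \<and> card D = 2}" by blast
  next
    fix B assume "B \<in> insert W ` {D. D \<subseteq> {..<W} \<and> card D = 2}"
    then obtain D where D: "D \<subseteq> {..<W}" "card D = 2" "B = insert W D" by blast
    then have "W \<notin> D" "finite D" by (auto intro: finite_subset)
    then show "B \<in> {B \<in> triples {..<W + 1}. W \<in> B}" using D unfolding triples_def by auto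
  qed
  moreover have "inj_on (insert W) {D. D \<subseteq> {..<W} \<and> card D = 2}"
  proof (rule inj_onI)
    fix C D assume "C \<in> {D. D \<subseteq> {..<W} \<and> card D = 2}" "D \<in> {D. D \<subseteq> {..<W} \<and> card D = 2}" "insert W C = insert W D"
    moreover from this have "W \<notin> C" "W \<notin> D" by auto
    ultimately show "C = D" by (metis insert_ident)
  qed
  ultimately show ?thesis using n_subsets[of "{..<W}" 2] by (simp add: card_image)
qed

text \<open>The given classes on W + 1 points are split by whether they cover the point
  \<open>W\<close>, in the role of infinity. Those that do are matched with the parameters of
  \<open>hole_params\<close> and used once for each of the nine columns. Those that do not are
  copied into all nine columns at once; they become classes missing infinity and are inserted among
  the line classes.\<close>

theorem resolved_nine:
  assumes res: "resolved (W + 1)" and W: "W mod 6 = 3" "W \<ge> 9"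
  shows "resolved (9 * W + 1)"
proof -
  let ?w = "int W"
  let ?Y = "{..<W + 1}"
  let ?X = "nine_points ?w"
  define V where "V = W div 3"
  define v where "v = int V"
  have WV: "W = 3 * V" "odd V" "V > 0" "odd W" using W unfolding V_def by presburger+
  have w: "?w = 3 * v" "odd v" "v > 0" "odd ?w" "?w \<ge> 9" using WV W unfolding v_def by auto
  obtain I :: "nat set" and P s where L: "linked_family ?Y I P s (triples ?Y)"
    and cI: "card I * ((W + 1) div 3) = (W + 1) choose 3"
    using res unfolding resolved_def linked_def by blast
  have fI: "finite I" and pc: "\<And>i. i \<in> I \<Longrightarrow> pclass ?Y (P i)"
    and cov: "\<And>B. B \<in> triples ?Y \<Longrightarrow> \<exists>i\<in>I. B \<in> P i"
    using L unfolding linked_family_def by auto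
  have uniq: "i = j" if "i \<in> I" "j \<in> I" "B \<in> P i" "B \<in> P j" for i j B
    using linked_unique[OF L, of i j B] cI that by simp
  have PT: "B \<subseteq> ?Y" "card B = 3" if "i \<in> I" "B \<in> P i" for i B
    using pc[OF that(1)] that unfolding pclass_def triples_def by auto
  define Iinf where "Iinf = {i \<in> I. \<exists>B\<in>P i. W \<in> B}"
  define I0 where "I0 = I - Iinf"
  have V3: "(W + 1) div 3 = V" using WV(1) by presburger
  have cinf: "card Iinf = W choose 2"
  proof -
    define f where "f i = (SOME B. B \<in> P i \<and> W \<in> B)" for i
    have f: "f i \<in> P i \<and> W \<in> f i" if "i \<in> Iinf" for i
      using that someI_ex[of "\<lambda>B. B \<in> P i \<and> W \<in> B"] unfolding Iinf_def f_def by blast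
    have "inj_on f Iinf"
    proof (rule inj_onI)
      fix i j assume "i \<in> Iinf" "j \<in> Iinf" "f i = f j"
      then show "i = j" using f[of i] f[of j] uniq[of i j "f i"] unfolding Iinf_def by auto
    qed
    moreover have "f ` Iinf = {B \<in> triples ?Y. W \<in> B}"
    proof (intro equalityI subsetI)
      fix B assume "B \<in> f ` Iinf"
      then obtain i where i: "i \<in> Iinf" "B = f i" by blast
      then have "i \<in> I" unfolding Iinf_def by blast
      then show "B \<in> {B \<in> triples ?Y. W \<in> B}" using f[OF i(1)] PT i(2) unfolding triples_def by blast
    next
      fix B assume B: "B \<in> {B \<in> triples ?Y. W \<in> B}"
      then obtain i where i: "i \<in> I" "B \<in> P i" using cov by blast
      then have iI: "i \<in> Iinf" using B unfolding Iinf_def by blast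
      have "f i = B" using f[OF iI] i B pc[OF i(1)] unfolding pclass_def pairwise_def disjnt_def by blast
      then show "B \<in> f ` Iinf" using iI by blast
    qed
    ultimately show ?thesis using card_triples_through[of W] card_image by metis
  qed
  have c2inf: "2 * card Iinf = W * (W - 1)"
    using times_binomial_minus1_eq[of 2 W] unfolding cinf by (simp add: numeral_2_eq_2)
  have c2I: "2 * card I = (W + 1) * (W - 1)"
  proof -
    have "6 * (card I * V) = (W + 1) * W * (W - 1)" using cI choose_three[of "W + 1"] unfolding V3 by simp
    moreover have "6 * (card I * V) = (3 * V) * (2 * card I)" by simp
    moreover have "(W + 1) * W * (W - 1) = W * ((W + 1) * (W - 1))" by (simp only: ac_simps)
    ultimately have "(3 * V) * (2 * card I) = W * ((W + 1) * (W - 1))" by (simp only:)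
    then have "W * (2 * card I) = W * ((W + 1) * (W - 1))" unfolding WV(1)[symmetric] .
    then show ?thesis using W(2) by simp
  qed
  have Isub: "Iinf \<subseteq> I" unfolding Iinf_def by blast
  obtain u where u: "W = Suc u" using W(2) by (cases W) auto
  have c0: "card I0 = card I - card Iinf" unfolding I0_def using Isub fI finite_subset by (intro card_Diff_subset) auto
  have c20: "2 * card I0 = W - 1"
    using c2I c2inf unfolding c0 diff_mult_distrib2 u by (simp add: algebra_simps)
  have fin0: "finite Iinf" "finite I0" using fI Isub finite_subset unfolding I0_def by auto
  have chp: "2 * card (hole_params v) = W * (W - 1)"
  proof -
    have "2 * card (hole_params v) = 9 * (V * V) - 3 * V" using card_hole_params(2)[OF w(2,3)] unfolding v_def by simp
    also have "\<dots> = W * (W - 1)" unfolding WV(1) by (simp add: diff_mult_distrib2)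
    finally show ?thesis .
  qed
  then have "card (hole_params v) = card Iinf" using c2inf by simp
  \<comment> \<open>Any bijection serves, because the columns filled by consecutive classes share no
    point but infinity.\<close>
  then obtain ph where ph: "bij_betw ph (hole_params v) Iinf"
    using finite_same_card_bij[OF card_hole_params(1)[OF w(2,3)] fin0(1)] by blast
  have phI: "ph par \<in> I" if "par \<in> hole_params v" for par using bij_betwE[OF ph] that Isub by blast
  have hol: "linked ?X (card ({..<9::nat} \<times> hole_params v))
    ({T. \<exists>x<9. \<exists>par\<in>hole_params v. \<exists>B\<in>P (ph par). T = local_point W x ` B} \<union>
     {T. \<exists>L\<in>set (concat line_classes). \<exists>i\<in>{0..<?w}. \<exists>s\<in>{0..<?w}. \<exists>t\<in>{0..<?w}.
        t \<noteq> 2 * s mod ?w \<and> T = tri ?w L i s t})" (is "linked _ _ (?H1 \<union> ?H2)")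
    by (rule linkedI[OF hole_family[OF w(1-3), of "\<lambda>par. P (ph par)"] refl]) (rule pc[OF phI])
  define R where "R j = (\<lambda>(x, B). local_point W x ` B) ` ({..<9::nat} \<times> P j)" for j
  have noW: "W \<notin> B" if "j \<in> I0" "B \<in> P j" for j B using that unfolding I0_def Iinf_def by blast
  have pcR: "pclass ?X (R j)" if j: "j \<in> I0" for j
    unfolding R_def
  proof (rule nine_pclassI[where p = "(9, 0)"])
    have jI: "j \<in> I" using j unfolding I0_def by blast
    have fP: "finite (P j)" "card (P j) = V" using pclass_finite[OF _ pc[OF jI]] pc[OF jI] V3 unfolding pclass_def by auto
    show "?w > 0" using w by simp
    show "finite ({..<9::nat} \<times> P j)" using fP by simp
    show "card ({..<9::nat} \<times> P j) = 3 * nat ?w" using fP WV(1) by (simp add: card_cartesian_product)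
    show "(case xB of (x, B) \<Rightarrow> local_point W x ` B) \<subseteq> ?X \<and> card (case xB of (x, B) \<Rightarrow> local_point W x ` B) \<le> 3"
      if xB: "xB \<in> {..<9::nat} \<times> P j" for xB
    proof -
      obtain x B where e: "xB = (x, B)" "x < 9" "B \<in> P j" using xB by auto
      show ?thesis unfolding e(1) using local_block[OF e(2) PT[OF jI e(3)]] by simp
    qed
    have "card ?Y mod 3 = 1" using WV(1) by simp
    then obtain y where y: "?Y - {y} \<subseteq> \<Union>(P j)" using pclass_missing[OF _ pc[OF jI]] by auto
    have "W \<notin> \<Union>(P j)" using noW[OF j] by blast
    moreover have "W \<in> ?Y" by simp
    ultimately have "y = W" using y by blast
    have all: "i \<in> \<Union>(P j)" if "i < W" for i
    proof -
      have "i \<in> ?Y - {y}" using that \<open>y = W\<close> by simp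
      then show ?thesis using y by blast
    qed
    show "?X - {(9, 0)} \<subseteq> (\<Union>xB\<in>{..<9::nat} \<times> P j. case xB of (x, B) \<Rightarrow> local_point W x ` B)"
    proof
      fix q assume "q \<in> ?X - {(9, 0)}"
      then obtain x i where q: "q = (x, i)" "x < 9" "0 \<le> i" "i < ?w" unfolding nine_points_def by auto
      have "nat i < W" using q by linarith
      then obtain B where B: "B \<in> P j" "nat i \<in> B" using all by blast
      have "q = local_point W x (nat i)" using q unfolding local_point_def by auto
      then have "q \<in> (case (x, B) of (x, B) \<Rightarrow> local_point W x ` B)" using B(2) by simp
      then show "q \<in> (\<Union>xB\<in>{..<9::nat} \<times> P j. case xB of (x, B) \<Rightarrow> local_point W x ` B)"
        using q(2) B(1) by (intro UN_I[of "(x, B)"]) auto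
    qed
  qed
  have mR: "meet_once ((\<lambda>(k, s). (\<lambda>(m, i). tri ?w (line_classes ! k ! m) i s (2 * s)) ` ({..<3} \<times> {0..<?w})) ks) (R j)"
    if j: "j \<in> I0" and ks: "ks \<in> {..<4} \<times> {0..<?w}" for j ks
  proof (rule meet_onceI)
    fix B C p q assume B: "B \<in> (\<lambda>(k, s). (\<lambda>(m, i). tri ?w (line_classes ! k ! m) i s (2 * s)) ` ({..<3} \<times> {0..<?w})) ks"
      and C: "C \<in> R j" and pq: "p \<in> B" "p \<in> C" "q \<in> B" "q \<in> C"
    obtain k s where k: "ks = (k, s)" "k < 4" using ks by auto
    obtain m i where m: "m < 3" "B = tri ?w (line_classes ! k ! m) i s (2 * s)" using B unfolding k by auto
    obtain a b c where l: "line_classes ! k ! m = (a, b, c)" by (cases "line_classes ! k ! m")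
    have ord: "a < b" "b < c" using lines_ordered line_classes_mem[OF k(2) m(1)] unfolding l by blast+
    obtain x D where D: "D \<in> P j" "C = local_point W x ` D" using C unfolding R_def by auto
    have "fst z = x" if "z \<in> C" for z using that noW[OF j D(1)] unfolding D(2) local_point_def by auto
    then have "fst p = fst q" using pq by simp
    then show "p = q" using pq(1,3) ord unfolding m(2) l tri_def by auto
  qed
  \<comment> \<open>A line class is followed by at most one inserted class, and there are 4 W places
    for (W - 1) / 2 classes.\<close>
  have "card I0 \<le> card ({..<4::nat} \<times> {0..<?w})" using c20 by (simp add: card_cartesian_product)
  then obtain h where h: "h ` I0 \<subseteq> {..<4::nat} \<times> {0..<?w}" "inj_on h I0"
    using card_le_inj[OF fin0(2), of "{..<4::nat} \<times> {0..<?w}"] by auto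
  note lf = line_family[OF w(4,5)]
  have lfs: "(\<lambda>(k, s). (k, (s + 1) mod ?w)) z \<in> {..<4} \<times> {0..<?w}" if "z \<in> {..<4::nat} \<times> {0..<?w}" for z
    using that w by auto
  have lin: "linked ?X (card ({..<4::nat} \<times> {0..<?w}) + card I0)
    ({T. \<exists>L\<in>set (concat line_classes). \<exists>i\<in>{0..<?w}. \<exists>s\<in>{0..<?w}. T = tri ?w L i s (2 * s)} \<union> (\<Union>j\<in>I0. R j))"
    (is "linked _ _ (?L1 \<union> ?L2)")
  proof (rule linked_insert[OF lf fin0(2) pcR h(2,1)])
    fix j assume j: "j \<in> I0"
    then have hj: "h j \<in> {..<4} \<times> {0..<?w}" using h(1) by blast
    show "meet_once ((\<lambda>(k, s). (\<lambda>(m, i). tri ?w (line_classes ! k ! m) i s (2 * s)) ` ({..<3} \<times> {0..<?w})) (h j)) (R j)"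
      by (rule mR[OF j hj])
    show "meet_once (R j) ((\<lambda>(k, s). (\<lambda>(m, i). tri ?w (line_classes ! k ! m) i s (2 * s)) ` ({..<3} \<times> {0..<?w}))
       ((\<lambda>(k, s). (k, (s + 1) mod ?w)) (h j)))"
      by (rule meet_once_sym[OF mR[OF j lfs[OF hj]]])
  qed
  note nl = near_linked[OF w(4,5)]
  let ?T0 = "{T. \<exists>a<9. \<exists>b<9. \<exists>i\<in>{0..<?w}. \<exists>j\<in>{0..<?w}. a \<noteq> b \<and> T = {(9, 0), (a, i), (b, j)}}"
  let ?T1 = "{T. \<exists>a<9. \<exists>x<9. \<exists>p\<in>{0..<?w}. \<exists>q\<in>{0..<?w}. \<exists>j\<in>{0..<?w}. a \<noteq> x \<and> p \<noteq> q \<and> T = {(a, p), (a, q), (x, j)}}"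
  let ?T2 = "{T. \<exists>x y z. \<exists>i\<in>{0..<?w}. \<exists>j\<in>{0..<?w}. \<exists>k\<in>{0..<?w}. x < y \<and> y < z \<and> z < 9 \<and>
        (x, y, z) \<notin> set (concat line_classes) \<and> T = {(x, i), (y, j), (z, k)}}"
  \<comment> \<open>Triples through infinity meet one or two columns, the others one, two or three.
    Three columns that form a line are split again by whether the positions are in
    progression.\<close>
  have sub: "triples ?X \<subseteq> (?T0 \<union> ?T1 \<union> ?T2) \<union> (?L1 \<union> ?L2) \<union> (?H1 \<union> ?H2)"
  proof
    fix T assume "T \<in> triples ?X"
    then have T3: "card T = 3" and TX: "T \<subseteq> ?X" unfolding triples_def by auto
    have loc: "T \<in> ?L2 \<union> ?H1" if B: "B \<subseteq> ?Y" "T = local_point W x ` B" "x < 9" for x B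
    proof -
      have fB: "finite B" using B(1) finite_subset by blast
      have "inj_on (local_point W x) ?Y" using B(3) unfolding inj_on_def local_point_def by auto
      then have "card T = card B" unfolding B(2) using B(1) by (intro card_image) (rule inj_on_subset)
      then have "B \<in> triples ?Y" using B(1) T3 unfolding triples_def by simp
      then obtain i where i: "i \<in> I" "B \<in> P i" using cov by blast
      show ?thesis
      proof (cases "i \<in> Iinf")
        case True
        then obtain par where "par \<in> hole_params v" "ph par = i" using ph unfolding bij_betw_def by blast
        then have "T \<in> ?H1" using i B by blast
        then show ?thesis by blast
      next
        case False
        then have "i \<in> I0" using i unfolding I0_def by blast
        moreover have "T \<in> R i" unfolding R_def using i B by (intro image_eqI[of _ _ "(x, B)"]) auto
        ultimately show ?thesis by blast
      qed
    qed
    obtain p q r where pqr: "T = {p, q, r}" "p \<noteq> q" "p \<noteq> r" "q \<noteq> r" using T3 by (auto simp: card_3_iff)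
    show "T \<in> (?T0 \<union> ?T1 \<union> ?T2) \<union> (?L1 \<union> ?L2) \<union> (?H1 \<union> ?H2)"
    proof (cases "(9, 0) \<in> T")
      case True
      then consider "p = (9, 0)" | "q = (9, 0)" | "r = (9, 0)" using pqr(1) by blast
      then have "\<exists>p' q'. T = {(9, 0), p', q'} \<and> p' \<noteq> q' \<and> p' \<noteq> (9, 0) \<and> q' \<noteq> (9, 0)"
      proof cases
        case 1
        then have "T = {(9, 0), q, r} \<and> q \<noteq> r \<and> q \<noteq> (9, 0) \<and> r \<noteq> (9, 0)" using pqr by blast
        then show ?thesis by (intro exI)
      next
        case 2
        then have "T = {(9, 0), p, r} \<and> p \<noteq> r \<and> p \<noteq> (9, 0) \<and> r \<noteq> (9, 0)" using pqr by blast
        then show ?thesis by (intro exI)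
      next
        case 3
        then have "T = {(9, 0), p, q} \<and> p \<noteq> q \<and> p \<noteq> (9, 0) \<and> q \<noteq> (9, 0)" using pqr by blast
        then show ?thesis by (intro exI)
      qed
      then obtain p' q' where pq: "T = {(9, 0), p', q'}" "p' \<noteq> q'" "p' \<noteq> (9, 0)" "q' \<noteq> (9, 0)" by blast
      obtain a i b j where e: "p' = (a, i)" "q' = (b, j)" by (cases p', cases q')
      have r: "a < 9" "b < 9" "i \<in> {0..<?w}" "j \<in> {0..<?w}" using TX pq unfolding e nine_points_def by auto
      show ?thesis
      proof (cases "a = b")
        case False
        then have "T \<in> ?T0" using r pq unfolding e by blast
        then show ?thesis by blast
      next
        case True
        have "T = local_point W a ` {W, nat i, nat j}" using r True unfolding pq e local_point_def by auto
        moreover have "{W, nat i, nat j} \<subseteq> ?Y" using r by auto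
        ultimately have "T \<in> ?L2 \<union> ?H1" using loc r(1) by blast
        then show ?thesis by blast
      qed
    next
      case False
      obtain a i b j c k where e: "p = (a, i)" "q = (b, j)" "r = (c, k)" by (cases p, cases q, cases r)
      have rg: "a < 9" "b < 9" "c < 9" "i \<in> {0..<?w}" "j \<in> {0..<?w}" "k \<in> {0..<?w}"
        using TX False unfolding pqr e nine_points_def by auto
      consider "a = b" "b = c" | "a = b" "a \<noteq> c" | "a = c" "a \<noteq> b" | "b = c" "a \<noteq> b" | "a \<noteq> b" "a \<noteq> c" "b \<noteq> c" by blast
      then show ?thesis
      proof cases
        case 1
        have "T = local_point W a ` {nat i, nat j, nat k}" using rg 1 unfolding pqr e local_point_def by auto
        moreover have "{nat i, nat j, nat k} \<subseteq> ?Y" using rg by auto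
        ultimately have "T \<in> ?L2 \<union> ?H1" using loc rg(1) by blast
        then show ?thesis by blast
      next
        case 2
        then have "i \<noteq> j" "T = {(a, i), (a, j), (c, k)}" using pqr e by auto
        then have "T \<in> ?T1" using rg 2 by blast
        then show ?thesis by blast
      next
        case 3
        then have "i \<noteq> k" "T = {(a, i), (a, k), (b, j)}" using pqr e by auto
        then have "T \<in> ?T1" using rg 3 by blast
        then show ?thesis by blast
      next
        case 4
        then have "j \<noteq> k" "T = {(b, j), (b, k), (a, i)}" using pqr e by auto
        then have "T \<in> ?T1" using rg 4 by blast
        then show ?thesis by blast
      next
        case 5
        obtain x y z i' j' k' where xyz: "x < y" "y < z" "x < 9 \<and> i' \<in> {0..<?w}" "y < 9 \<and> j' \<in> {0..<?w}" "z < 9 \<and> k' \<in> {0..<?w}"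
          "{(a, i), (b, j), (c, k)} = {(x, i'), (y, j'), (z, k')}"
          using sort_three[OF 5, of "\<lambda>x i. x < 9 \<and> i \<in> {0..<?w}" i j k] rg by blast
        have T: "T = {(x, i'), (y, j'), (z, k')}" using xyz(6) unfolding pqr e .
        show ?thesis
        proof (cases "(x, y, z) \<in> set (concat line_classes)")
          case False
          then have "T \<in> ?T2" using xyz T by blast
          then show ?thesis by blast
        next
          case True
          define s where "s = (j' - i') mod ?w"
          define t where "t = (k' - i') mod ?w"
          have st: "s \<in> {0..<?w}" "t \<in> {0..<?w}" unfolding s_def t_def using w by auto
          have "(i' + s) mod ?w = j'" "(i' + t) mod ?w = k'" unfolding s_def t_def using xyz by (simp_all add: mod_add_right_eq)
          then have Tt: "T = tri ?w (x, y, z) i' s t" unfolding T tri_def by simp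
          show ?thesis
          proof (cases "t = 2 * s mod ?w")
            case t: True
            have "(i' + t) mod ?w = (i' + 2 * s) mod ?w" unfolding t by (simp add: mod_add_right_eq)
            then have "T = tri ?w (x, y, z) i' s (2 * s)" unfolding Tt tri_def by simp
            then have "T \<in> ?L1" using True st xyz(3) by blast
            then show ?thesis by blast
          next
            case False
            then have "T \<in> ?H2" using Tt True st xyz(3) by blast
            then show ?thesis by blast
          qed
        qed
      qed
    qed
  qed
  \<comment> \<open>The count is 36 W^2 + 4 W + (W - 1) / 2 + 9 W (W - 1) / 2 = (9 W + 1) (9 W - 1)
    / 2.\<close>
  define M where "M = 36 * (nat ?w * nat ?w) + (card ({..<4::nat} \<times> {0..<?w}) + card I0) + card ({..<9::nat} \<times> hole_params v)"
  have L': "linked ?X M (triples ?X)" unfolding M_def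
    by (rule linked_mono[OF linked_Un[OF linked_Un[OF nl lin] hol] sub])
  have cX: "card ?X = 9 * W + 1" by (simp add: nine_points_card)
  have "M = 36 * (W * W) + (4 * W + card I0) + 9 * card (hole_params v)" unfolding M_def by (simp add: card_cartesian_product)
  then have "2 * M = 72 * (W * W) + 8 * W + 2 * card I0 + 9 * (2 * card (hole_params v))" by simp
  also have "\<dots> = (9 * W + 1) * (9 * W - 1)" unfolding c20 chp u by (simp add: algebra_simps)
  finally have M2: "2 * M = (9 * W + 1) * (9 * W - 1)" .
  have "(9 * W + 1) div 3 = 3 * W" by simp
  moreover have "M * (3 * W) = (9 * W + 1) choose 3"
  proof -
    have "6 * (M * (3 * W)) = (2 * M) * (9 * W)" by simp
    also have "\<dots> = (9 * W + 1) * (9 * W) * (9 * W - 1)" unfolding M2 by (simp only: ac_simps)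
    also have "\<dots> = 6 * ((9 * W + 1) choose 3)" unfolding choose_three by simp
    finally show ?thesis by simp
  qed
  ultimately have "M * ((9 * W + 1) div 3) = (9 * W + 1) choose 3" by simp
  then show ?thesis by (rule resolvedI[OF L' nine_points_finite cX])
qed

section \<open>Order nine and the theorem\<close>

text \<open>A large set of Kirkman triple systems: the 84 triples of nine points split into seven
  affine planes of order three. Two lines of a plane meet at most once, so the four parallel classes
  of each plane form a cycle in any order.\<close>

definition kirkman_classes_9 :: "block list list list" where
  "kirkman_classes_9 =
    [[[(0, 3, 6, []), (1, 4, 7, []), (2, 5, 8, [])],
      [(0, 1, 2, []), (3, 4, 5, []), (6, 7, 8, [])],
      [(0, 4, 8, []), (1, 5, 6, []), (2, 3, 7, [])],
      [(0, 5, 7, []), (1, 3, 8, []), (2, 4, 6, [])]],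
     [[(0, 2, 6, []), (1, 4, 8, []), (3, 5, 7, [])],
      [(0, 1, 3, []), (2, 4, 7, []), (5, 6, 8, [])],
      [(0, 4, 5, []), (1, 6, 7, []), (2, 3, 8, [])],
      [(0, 7, 8, []), (1, 2, 5, []), (3, 4, 6, [])]],
     [[(0, 2, 8, []), (1, 3, 6, []), (4, 5, 7, [])],
      [(0, 1, 4, []), (2, 5, 6, []), (3, 7, 8, [])],
      [(0, 6, 7, []), (1, 5, 8, []), (2, 3, 4, [])],
      [(0, 3, 5, []), (1, 2, 7, []), (4, 6, 8, [])]],
     [[(0, 2, 7, []), (1, 4, 6, []), (3, 5, 8, [])],
      [(0, 1, 5, []), (2, 3, 6, []), (4, 7, 8, [])],
      [(0, 6, 8, []), (1, 3, 7, []), (2, 4, 5, [])],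
      [(0, 3, 4, []), (1, 2, 8, []), (5, 6, 7, [])]],
     [[(0, 2, 3, []), (1, 7, 8, []), (4, 5, 6, [])],
      [(0, 1, 6, []), (2, 5, 7, []), (3, 4, 8, [])],
      [(0, 4, 7, []), (1, 3, 5, []), (2, 6, 8, [])],
      [(0, 5, 8, []), (1, 2, 4, []), (3, 6, 7, [])]],
     [[(0, 2, 5, []), (1, 6, 8, []), (3, 4, 7, [])],
      [(0, 1, 7, []), (2, 4, 8, []), (3, 5, 6, [])],
      [(0, 3, 8, []), (1, 4, 5, []), (2, 6, 7, [])],
      [(0, 4, 6, []), (1, 2, 3, []), (5, 7, 8, [])]],
     [[(0, 2, 4, []), (1, 5, 7, []), (3, 6, 8, [])],
      [(0, 1, 8, []), (2, 3, 5, []), (4, 6, 7, [])],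
      [(0, 5, 6, []), (1, 3, 4, []), (2, 7, 8, [])],
      [(0, 3, 7, []), (1, 2, 6, []), (4, 5, 8, [])]]]"

lemma kirkman_classes_9_check:
  "length kirkman_classes_9 = 7" (is ?A)
  "list_all (\<lambda>g. length g = 4 \<and> list_all (\<lambda>b. msort 5 (concat (map block_pts b)) = [0..8]) g \<and>
     list_all (\<lambda>i. increasing (msort 5 (concat (map (block_edges 9 (\<lambda>x. x)) (g ! i)) @
       concat (map (block_edges 9 (\<lambda>x. x)) (g ! ((i + 1) mod 4)))))) [0,1,2,3]) kirkman_classes_9" (is ?B)
  "list_all (\<lambda>x. list_all (\<lambda>y. list_all (\<lambda>z. list_ex (\<lambda>(x', y', z', _). x' = x \<and> y' = y \<and> z' = z)
     (concat (concat kirkman_classes_9))) [y+1..8]) [x+1..8]) [0..8]" (is ?C)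
proof -
  show ?A by code_simp
  show ?B by code_simp
  show ?C by code_simp
qed

lemma resolved_9: "resolved 9"
proof -
  let ?X = "{0..<9::int}"
  let ?bs = "\<lambda>bl. (\<lambda>b. set (block_pts b)) ` set bl"
  let ?I = "{..<7::nat} \<times> {..<4::nat}"
  let ?P = "\<lambda>(i, j). ?bs (kirkman_classes_9 ! i ! j)"
  let ?s = "\<lambda>(i::nat, j). (i, (j + 1) mod 4)"
  have grp: "length (kirkman_classes_9 ! i) = 4"
    "j < 4 \<Longrightarrow> msort 5 (concat (map block_pts (kirkman_classes_9 ! i ! j))) = [0..8]"
    "j < 4 \<Longrightarrow> increasing (msort 5 (concat (map (block_edges 9 (\<lambda>x. x)) (kirkman_classes_9 ! i ! j)) @
       concat (map (block_edges 9 (\<lambda>x. x)) (kirkman_classes_9 ! i ! ((j + 1) mod 4)))))" if "i < 7" for i j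
  proof -
    have "kirkman_classes_9 ! i \<in> set kirkman_classes_9" using that kirkman_classes_9_check(1) by simp
    note q = bspec[OF iffD1[OF list_all_iff kirkman_classes_9_check(2)] this]
    have g: "length (kirkman_classes_9 ! i) = 4"
      "\<forall>b\<in>set (kirkman_classes_9 ! i). msort 5 (concat (map block_pts b)) = [0..8]"
      "\<forall>j\<in>set [0,1,2,3]. increasing (msort 5 (concat (map (block_edges 9 (\<lambda>x. x)) (kirkman_classes_9 ! i ! j)) @
       concat (map (block_edges 9 (\<lambda>x. x)) (kirkman_classes_9 ! i ! ((j + 1) mod 4)))))"
      by (rule conjunct1[OF q], rule iffD1[OF list_all_iff conjunct1[OF conjunct2[OF q]]],
          rule iffD1[OF list_all_iff conjunct2[OF conjunct2[OF q]]])
    show "length (kirkman_classes_9 ! i) = 4" by (rule g(1))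
    show "msort 5 (concat (map block_pts (kirkman_classes_9 ! i ! j))) = [0..8]" if "j < 4"
      by (rule bspec[OF g(2)]) (use g(1) that in simp)
    show "increasing (msort 5 (concat (map (block_edges 9 (\<lambda>x. x)) (kirkman_classes_9 ! i ! j)) @
       concat (map (block_edges 9 (\<lambda>x. x)) (kirkman_classes_9 ! i ! ((j + 1) mod 4)))))" if "j < 4"
    proof -
      have "j \<in> set [0,1,2,3]" using that by auto
      then show ?thesis by (rule bspec[OF g(3)])
    qed
  qed
  have "linked_family ?X ?I ?P ?s (triples ?X)"
    unfolding linked_family_def
  proof (intro conjI ballI)
    have "inj_on ?s ?I"
    proof (rule inj_onI, clarsimp)
      fix j j' :: nat assume "j < 4" "j' < 4" "Suc j mod 4 = Suc j' mod 4"
      then show "j = j'" by (auto simp: mod_Suc split: if_splits)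
    qed
    moreover have "?s ` ?I \<subseteq> ?I" by auto
    ultimately show "bij_betw ?s ?I ?I" unfolding bij_betw_def using endo_inj_surj[of ?I ?s] by simp
  next
    fix ij assume "ij \<in> ?I"
    then obtain i j where ij: "ij = (i, j)" "i < 7" "j < 4" by auto
    have ps: "mset (concat (map block_pts (kirkman_classes_9 ! i ! j))) = mset [0..8]"
      unfolding grp(2)[OF ij(2,3), symmetric] mset_msort ..
    have "set (concat (map block_pts (kirkman_classes_9 ! i ! j))) = set [0..8]"
      unfolding grp(2)[OF ij(2,3), symmetric] set_msort ..
    moreover have "set [0..8] \<subseteq> ?X" by auto
    ultimately have sub: "set (concat (map block_pts (kirkman_classes_9 ! i ! j))) \<subseteq> ?X" by (simp only:)
    have "pclass ?X (?bs (kirkman_classes_9 ! i ! j))"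
    proof (rule pclass_blocks[OF _ _ sub])
      have "length (concat (map block_pts (kirkman_classes_9 ! i ! j))) = 9" using arg_cong[OF ps, of size] by simp
      then show "3 * (card ?X div 3) = length (concat (map block_pts (kirkman_classes_9 ! i ! j)))" by simp
      show "distinct (concat (map block_pts (kirkman_classes_9 ! i ! j)))" using mset_eq_imp_distinct_iff[OF ps] by simp
    qed simp
    then show "pclass ?X (?P ij)" unfolding ij by simp
    have id: "(`) (\<lambda>x::int. x) ` S = S" for S by auto
    show "meet_once (?P ij) (?P (?s ij))"
      using meet_once_blocks[OF msort_increasing_distinct[OF grp(3)[OF ij(2,3)]]] unfolding id ij by simp
  next
    fix B assume "B \<in> triples ?X"
    then have B: "card B = 3" "B \<subseteq> ?X" unfolding triples_def by auto
    then obtain a b c where abc: "B = {a, b, c}" "a \<noteq> b" "a \<noteq> c" "b \<noteq> c" by (auto simp: card_3_iff)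
    have "\<exists>x y z. x < y \<and> y < z \<and> B = {x, y, z}"
    proof -
      consider "a < b" "b < c" | "a < c" "c < b" | "b < a" "a < c" | "b < c" "c < a" | "c < a" "a < b" | "c < b" "b < a"
        using abc by linarith
      then show ?thesis
      proof cases
        case 1 then show ?thesis using abc by blast
      next
        case 2
        have "B = {a, c, b}" using abc by blast
        then show ?thesis using 2 by blast
      next
        case 3
        have "B = {b, a, c}" using abc by blast
        then show ?thesis using 3 by blast
      next
        case 4
        have "B = {b, c, a}" using abc by blast
        then show ?thesis using 4 by blast
      next
        case 5
        have "B = {c, a, b}" using abc by blast
        then show ?thesis using 5 by blast
      next
        case 6
        have "B = {c, b, a}" using abc by blast
        then show ?thesis using 6 by blast
      qed
    qed
    then obtain x y z where xyz: "x < y" "y < z" "B = {x, y, z}" by blast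
    have mem: "x \<in> set [0..8]" "y \<in> set [x+1..8]" "z \<in> set [y+1..8]" using B xyz by auto
    have "list_ex (\<lambda>(x', y', z', _). x' = x \<and> y' = y \<and> z' = z) (concat (concat kirkman_classes_9))"
      using kirkman_classes_9_check(3)[THEN iffD1[OF list_all_iff], THEN bspec, OF mem(1),
        THEN iffD1[OF list_all_iff], THEN bspec, OF mem(2),
        THEN iffD1[OF list_all_iff], THEN bspec, OF mem(3)] .
    then have "\<exists>e\<in>set (concat (concat kirkman_classes_9)). (\<lambda>(x', y', z', _). x' = x \<and> y' = y \<and> z' = z) e"
      unfolding list_ex_iff .
    then obtain e where e: "e \<in> set (concat (concat kirkman_classes_9))" "(\<lambda>(x', y', z', _). x' = x \<and> y' = y \<and> z' = z) e"
      by (rule bexE)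
    obtain x' y' z' ms where ee: "e = (x', y', z', ms)" by (cases e)
    have Be: "B = set (block_pts e)" using e(2) xyz unfolding ee by simp
    obtain g bl where g: "g \<in> set kirkman_classes_9" "bl \<in> set g" "e \<in> set bl" using e(1) by auto
    obtain i where i: "i < 7" "kirkman_classes_9 ! i = g" using g(1) kirkman_classes_9_check(1) by (metis in_set_conv_nth)
    obtain j where j: "j < 4" "g ! j = bl" using g(2) grp(1)[OF i(1)] i(2) by (metis in_set_conv_nth)
    have "B \<in> ?P (i, j)" using Be g(3) i(2) j(2) by auto
    then show "\<exists>ij\<in>?I. B \<in> ?P ij" using i(1) j(1) by blast
  qed simp
  then have "linked ?X 28 (triples ?X)" by (rule linkedI) (simp add: card_cartesian_product)
  then show ?thesis
  proof (rule resolvedI)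
    show "28 * (9 div 3) = (9::nat) choose 3" using choose_three[of 9] by simp
  qed simp_all
qed

section \<open>Iteration and the list of starting orders\<close>

lemma resolved_pow3:
  assumes "resolved n" "odd n" "n mod 3 = 0" "n \<ge> 3"
  shows "resolved (3 ^ k * n)"
proof (induction k)
  case (Suc k)
  have "odd (3 ^ k * n)" "3 ^ k * n mod 3 = 0" using assms by auto
  moreover have "3 ^ k * n \<ge> 3" using assms(4) by (metis mult_le_mono nat_mult_1 one_le_numeral one_le_power)
  ultimately show ?case using resolved_triple[OF Suc] by (simp add: mult.assoc)
qed (use assms in simp)

lemma resolved_pow9:
  assumes "resolved (W + 1)" "W mod 6 = 3" "W \<ge> 9"
  shows "resolved (9 ^ k * W + 1)"
proof (induction k)
  case (Suc k)
  have "9 ^ k * W mod 6 = 3"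
  proof (induction k)
    case (Suc k)
    have "9 * (9 ^ k * W) mod 6 = 9 * (9 ^ k * W mod 6) mod 6" by (rule mod_mult_right_eq[symmetric])
    then show ?case using Suc by (simp add: mult.assoc)
  qed (use assms in simp)
  moreover have "9 ^ k * W \<ge> 9" using assms(3) by (metis mult_le_mono nat_mult_1 one_le_numeral one_le_power)
  ultimately show ?case using resolved_nine[OF Suc] by (simp add: mult.assoc)
qed (use assms in simp)

theorem theorem4p11:
  fixes a m :: nat
  assumes "a > 0" and "a mod 6 = 3" and "a < 100"
    and "a mod 12 = 3 \<Longrightarrow> odd m"
    and "a mod 12 = 9 \<Longrightarrow> even m"
  shows "(a \<notin> {57, 87, 93} \<longrightarrow> TOC_exists 3 (3 ^ m * a) 5 3)
       \<and> (a \<notin> {51, 69, 75} \<longrightarrow> TOC_exists 3 (3 ^ m * a + 1) 5 3)"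
proof -
  have a_cases: "a \<in> set [3, 9, 15, 21, 27, 33, 39, 45, 51, 57, 63, 69, 75, 81, 87, 93, 99]"
  proof -
    have a: "a = 6 * (a div 6) + 3" using assms(2) by presburger
    have "a div 6 \<in> {..<17}" using assms(3) by auto
    then have "a \<in> (\<lambda>q. 6 * q + 3) ` {..<17}" using a by blast
    then show ?thesis by (simp add: lessThan_nat_numeral lessThan_Suc) blast
  qed
  have a3: "3 ^ m * a mod 3 = 0" "3 ^ m * a \<ge> 3"
  proof -
    have "a mod 3 = 0" "a \<ge> 3" using assms(1,2) by presburger+
    then show "3 ^ m * a mod 3 = 0" by auto
    show "3 ^ m * a \<ge> 3" using \<open>a \<ge> 3\<close> by (metis mult_le_mono nat_mult_1 one_le_numeral one_le_power)
  qed
  have pow: "resolved (3 ^ k * n)" if "resolved n" "odd n" "n mod 3 = 0" "n \<ge> 3" for k n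
    using resolved_pow3[OF that] .
  have r3: "resolved 27" "resolved 81" "resolved 45" "resolved 63" "resolved 99"
    using pow[OF resolved_9, of 1] pow[OF resolved_9, of 2] pow[OF resolved_15, of 1]
      pow[OF resolved_21, of 1] pow[OF resolved_33, of 1] by simp_all
  have first: "resolved (3 ^ m * a)" if "a \<notin> {57, 87, 93}"
  proof (cases "a = 3")
    case True
    \<comment> \<open>Order 3 has a single class, which cannot be its own successor. As
      \<open>m\<close> is odd, at least one factor of three is available and the induction can start
      from nine.\<close>
    then have "odd m" using assms(4) by simp
    then obtain k where "m = Suc k" by (cases m) auto
    then have "3 ^ m * a = 3 ^ k * 9" using True by simp
    then show ?thesis using pow[OF resolved_9, of k] by simp
  next
    case False
    have "resolved a" using a_cases that False r3 resolved_9 resolved_15 resolved_21 resolved_33 resolved_39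
        resolved_51 resolved_69 resolved_75 by auto
    moreover have "odd a" "a mod 3 = 0" "a \<ge> 3" using assms(1,2) by presburger+
    ultimately show ?thesis by (rule pow)
  qed
  have nine: "resolved (9 ^ k * W + 1)" if "resolved (W + 1)" "W mod 6 = 3" "W \<ge> 9" for k W
    using resolved_pow9[OF that] .
  have r9: "resolved (81 + 1)" "resolved (189 + 1)" "resolved (297 + 1)"
    using resolved_nine[of 9] resolved_nine[of 21] resolved_nine[of 33] resolved_10 resolved_22 resolved_34 by simp_all
  have second: "resolved (3 ^ m * a + 1)" if "a \<notin> {51, 69, 75}"
  proof (cases "a mod 12 = 3")
    case True
    \<comment> \<open>The nine-fold construction uses up factors of three in pairs. For
      \<open>a\<close> congruent to 3 modulo 12 the odd one is joined to \<open>a\<close>, and the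
      start is 3 a; in both cases it is congruent to 9 modulo 12.\<close>
    then obtain k where m: "m = 2 * k + 1" using assms(4) by (metis oddE)
    have "3 ^ m * a = 9 ^ k * (3 * a)" unfolding m by (simp add: power_add power_mult)
    moreover have "resolved (3 * a + 1)"
      using a_cases that True r9 resolved_10 resolved_46 resolved_118 resolved_262 by auto
    moreover have "3 * a mod 6 = 3" "3 * a \<ge> 9" using assms(1,2) by presburger+
    ultimately show ?thesis using nine[of "3 * a" k] by (simp only:)
  next
    case False
    then have a9: "a mod 12 = 9" using assms(2) by presburger
    then obtain k where m: "m = 2 * k" using assms(5) by (metis evenE)
    have "3 ^ m * a = 9 ^ k * a" unfolding m by (simp add: power_mult)
    moreover have "resolved (a + 1)"
      using a_cases that a9 r9 resolved_10 resolved_22 resolved_34 resolved_46 resolved_58 resolved_94 by auto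
    moreover have "a \<ge> 9" using a9 by presburger
    ultimately show ?thesis using nine[of a k] assms(2) by (simp only:)
  qed
  show ?thesis
  proof (intro conjI impI)
    assume "a \<notin> {57, 87, 93}"
    then show "TOC_exists 3 (3 ^ m * a) 5 3" using resolved_TOC[OF first a3(2)] a3(1) by simp
  next
    assume "a \<notin> {51, 69, 75}"
    moreover have "(3 ^ m * a + 1) mod 3 \<noteq> 2" using a3(1) by presburger
    moreover have "3 ^ m * a + 1 \<ge> 3" using a3(2) by simp
    ultimately show "TOC_exists 3 (3 ^ m * a + 1) 5 3" using resolved_TOC[OF second] by blast
  qed
qed

end
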